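(* Let $\mathfrak g$ be a simple Lie algebra, $t\in\mathbb C^\times$ not a root of unity, and $\mathcal K_t^-(\mathfrak g)=\bigcap_{i\in I}\operatorname{Ker}S_i^-$. (1) Every element of $\mathcal K^-_t(\mathfrak g)$ is characterized by the multiplicities (coefficients) of the dominant monomials contained in it. (2) For every dominant monomial $m$ there is a unique element $F(m)\in\mathcal K_t^-(\mathfrak g)$ such that $m$ is the unique dominant monomial of $F(m)$ (occurring with coefficient $1$). Therefore the elements $F(m)$, with $m$ ranging over all dominant monomials, form a basis of $\mathcal K_t^-(\mathfrak g)$.
   Context: $I$ is the vertex set of the Dynkin diagram of $\mathfrak g$, $C_{ij}=2(\alpha_i,\alpha_j)/(\alpha_i,\alpha_i)$ its Cartan matrix, $I_{ij}=2\delta_{ij}-C_{ij}$. $\mathcal Y=\mathbb C[Y_j(zt^n)^{\pm1}]_{j\in I,n\in\mathbb Z}$ is the Laurent polynomial algebra in independent variables ($z$ is a formal symbol). For $n\in\mathbb Z$, $A_i(zt^n)=Y_i(zt^{n+1})Y_i(zt^{n-1})\prod_{j\neq i}Y_j(zt^n)^{-I_{ji}}$. The screening operator $S_i^-$ is the derivation from $\mathcal Y$ to the quotient of the free $\mathcal Y$-module on symbols $S_i^-(zt^m)$, $m\in\mathbb Z$, by the submodule generated by $S_i^-(zt^{m+2})-A_i(zt^{m+1})S_i^-(zt^m)$, $m\in\mathbb Z$, determined by $S_i^-\cdot Y_j(zt^n)^{\pm1}=\pm\delta_{ij}Y_j(zt^n)^{\pm1}\otimes S_i^-(zt^n)$.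 A monomial in the variables $Y_j(zt^n)^{\pm1}$ is called dominant if all exponents are non-negative. *)

theory Defs
  imports Complex_Main "HOL-Library.Poly_Mapping"
begin

section \<open>Simple Lie algebras, roots and the Cartan matrix\<close>

locale lie_algebra = vector_space scale
  for scale :: "'k::field \<Rightarrow> 'g::ab_group_add \<Rightarrow> 'g" +
  fixes bracket :: "'g \<Rightarrow> 'g \<Rightarrow> 'g"
  assumes bracket_add_left: "bracket (x + y) z = bracket x z + bracket y z"
    and bracket_add_right: "bracket x (y + z) = bracket x y + bracket x z"
    and bracket_scale_left: "bracket (scale c x) y = scale c (bracket x y)"
    and bracket_scale_right: "bracket x (scale c y) = scale c (bracket x y)"
    and bracket_alternating: "bracket x x = 0"
    and jacobi:
      "bracket x (bracket y z) + bracket y (bracket z x) + bracket z (bracket x y) = 0"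
begin

definition lie_ideal :: "'g set \<Rightarrow> bool" where
  "lie_ideal J \<longleftrightarrow> subspace J \<and> (\<forall>x. \<forall>y\<in>J. bracket x y \<in> J)"

text \<open>\<open>extend_basis {}\<close> is a basis of the whole space. The trace is only meaningful in
  finite dimension, where it does not depend on that choice of basis.\<close>

definition trace :: "('g \<Rightarrow> 'g) \<Rightarrow> 'k" where
  "trace f = (\<Sum>b\<in>extend_basis {}. representation (extend_basis {}) (f b) b)"

definition killing :: "'g \<Rightarrow> 'g \<Rightarrow> 'k" where
  "killing x y = trace (\<lambda>z. bracket x (bracket y z))"

text \<open>For a semisimple complex Lie algebra, a Cartan subalgebra is a maximal abelian subalgebra
  consisting of ad-diagonalizable elements.\<close>

definition cartan_subalgebra :: "'g set \<Rightarrow> bool" where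
  "cartan_subalgebra H \<longleftrightarrow>
     subspace H \<and>
     (\<forall>x\<in>H. \<forall>y\<in>H. bracket x y = 0) \<and>
     (\<forall>x. (\<forall>y\<in>H. bracket y x = 0) \<longrightarrow> x \<in> H) \<and>
     (\<forall>y\<in>H. span {x. \<exists>c. bracket y x = scale c x} = UNIV)"

text \<open>A functional on \<open>H\<close> is represented by the function that extends it by \<open>0\<close> outside \<open>H\<close>
  (this extension is not linear on the whole space), so that equality of functionals on \<open>H\<close> is
  equality of functions. Linearity on \<open>H\<close> of a root follows from the root vector condition.\<close>

definition roots :: "'g set \<Rightarrow> ('g \<Rightarrow> 'k) set" where
  "roots H = {\<beta>. (\<forall>y. y \<notin> H \<longrightarrow> \<beta> y = 0) \<and> (\<exists>y\<in>H. \<beta> y \<noteq> 0) \<and>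
                 (\<exists>x. x \<noteq> 0 \<and> (\<forall>y\<in>H. bracket y x = scale (\<beta> y) x))}"

definition simple_roots :: "'g set \<Rightarrow> ('i::finite \<Rightarrow> 'g \<Rightarrow> 'k) \<Rightarrow> bool" where
  "simple_roots H \<alpha> \<longleftrightarrow>
     range \<alpha> \<subseteq> roots H \<and>
     (\<forall>c. (\<forall>y\<in>H. (\<Sum>i\<in>UNIV. c i * \<alpha> i y) = 0) \<longrightarrow> (\<forall>i. c i = 0)) \<and>
     (\<forall>\<beta>\<in>roots H. \<exists>k :: 'i \<Rightarrow> nat.
        \<beta> = (\<lambda>y. \<Sum>i\<in>UNIV. of_nat (k i) * \<alpha> i y) \<or>
        \<beta> = (\<lambda>y. - (\<Sum>i\<in>UNIV. of_nat (k i) * \<alpha> i y)))"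

text \<open>The bilinear form on the dual of \<open>H\<close> that is transported from the restriction of the Killing
  form to \<open>H\<close>.\<close>

definition killing_rep :: "'g set \<Rightarrow> ('g \<Rightarrow> 'k) \<Rightarrow> 'g" where
  "killing_rep H \<beta> = (THE x. x \<in> H \<and> (\<forall>y\<in>H. killing x y = \<beta> y))"

definition dual_form :: "'g set \<Rightarrow> ('g \<Rightarrow> 'k) \<Rightarrow> ('g \<Rightarrow> 'k) \<Rightarrow> 'k" where
  "dual_form H \<beta> \<gamma> = killing (killing_rep H \<beta>) (killing_rep H \<gamma>)"

text \<open>The Cartan integers enter below as exponents, hence the integer type.\<close>

definition is_cartan_matrix ::
  "'g set \<Rightarrow> ('i \<Rightarrow> 'g \<Rightarrow> 'k) \<Rightarrow> ('i \<Rightarrow> 'i \<Rightarrow> int) \<Rightarrow> bool" where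
  "is_cartan_matrix H \<alpha> C \<longleftrightarrow>
     (\<forall>i j. of_int (C i j) = 2 * dual_form H (\<alpha> i) (\<alpha> j) / dual_form H (\<alpha> i) (\<alpha> i))"

end

locale simple_lie_algebra = lie_algebra scale bracket
  for scale :: "complex \<Rightarrow> 'g::ab_group_add \<Rightarrow> 'g" and bracket +
  assumes finite_dim: "\<exists>B. finite B \<and> span B = UNIV"
    and non_abelian: "\<exists>x y. bracket x y \<noteq> 0"
    and no_ideals: "lie_ideal J \<Longrightarrow> J = {0} \<or> J = UNIV"


section \<open>The Laurent polynomial algebra and the screening operators\<close>

text \<open>The Laurent polynomial algebra is the group algebra of the free abelian group of Laurent
  monomials; a monomial is its exponent function, with \<open>(j, n)\<close> standing for the variable
  \<open>Y\<^sub>j(z t\<^sup>n)\<close>. The coefficient of \<open>m\<close> in \<open>x\<close> is \<open>lookup x m\<close>.\<close>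

type_synonym 'i ymon = "('i \<times> int) \<Rightarrow>\<^sub>0 int"
type_synonym 'i ylaurent = "'i ymon \<Rightarrow>\<^sub>0 complex"

text \<open>The free module on the symbols \<open>S\<^sub>i(z t\<^sup>m)\<close>, for one fixed \<open>i\<close>.\<close>

type_synonym 'i scr_free = "int \<Rightarrow>\<^sub>0 'i ylaurent"

abbreviation lookup where "lookup \<equiv> Poly_Mapping.lookup"
abbreviation keys where "keys \<equiv> Poly_Mapping.keys"
abbreviation single where "single \<equiv> Poly_Mapping.single"

definition mon :: "'i ymon \<Rightarrow> 'i ylaurent" where
  "mon m = single m 1"

definition Yvar :: "'i \<Rightarrow> int \<Rightarrow> 'i ylaurent" where
  "Yvar j n = mon (single (j, n) 1)"

definition Yinv :: "'i \<Rightarrow> int \<Rightarrow> 'i ylaurent" where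
  "Yinv j n = mon (single (j, n) (- 1))"

definition incidence :: "('i \<Rightarrow> 'i \<Rightarrow> int) \<Rightarrow> 'i \<Rightarrow> 'i \<Rightarrow> int" where
  "incidence C i j = 2 * (if i = j then 1 else 0) - C i j"

definition Avar :: "('i::finite \<Rightarrow> 'i \<Rightarrow> int) \<Rightarrow> 'i \<Rightarrow> int \<Rightarrow> 'i ylaurent" where
  "Avar C i n = Yvar i (n + 1) * Yvar i (n - 1) *
     (\<Prod>j\<in>UNIV - {i}. mon (single (j, n) (- incidence C j i)))"

definition cscale :: "complex \<Rightarrow> 'i ylaurent \<Rightarrow> 'i ylaurent" where
  "cscale c x = Poly_Mapping.map ((*) c) x"

definition fscale :: "'i ylaurent \<Rightarrow> 'i scr_free \<Rightarrow> 'i scr_free" where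
  "fscale y v = Poly_Mapping.map ((*) y) v"

definition scr_rel :: "('i::finite \<Rightarrow> 'i \<Rightarrow> int) \<Rightarrow> 'i \<Rightarrow> 'i scr_free set" where
  "scr_rel C i = module.span fscale
     (range (\<lambda>m. single (m + 2) 1 - fscale (Avar C i (m + 1)) (single m 1)))"

text \<open>The quotient of the free module by \<open>scr_rel\<close> is realized by cosets.\<close>

definition scr_class :: "('i::finite \<Rightarrow> 'i \<Rightarrow> int) \<Rightarrow> 'i \<Rightarrow> 'i scr_free \<Rightarrow> 'i scr_free set" where
  "scr_class C i v = {w. w - v \<in> scr_rel C i}"

definition qadd :: "'i scr_free set \<Rightarrow> 'i scr_free set \<Rightarrow> 'i scr_free set" where
  "qadd P Q = {v + w | v w. v \<in> P \<and> w \<in> Q}"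

definition qscale :: "('i::finite \<Rightarrow> 'i \<Rightarrow> int) \<Rightarrow> 'i \<Rightarrow>
    'i ylaurent \<Rightarrow> 'i scr_free set \<Rightarrow> 'i scr_free set" where
  "qscale C i y P = {fscale y v + r | v r. v \<in> P \<and> r \<in> scr_rel C i}"

definition is_scr_derivation :: "('i::finite \<Rightarrow> 'i \<Rightarrow> int) \<Rightarrow> 'i \<Rightarrow>
    ('i ylaurent \<Rightarrow> 'i scr_free set) \<Rightarrow> bool" where
  "is_scr_derivation C i D \<longleftrightarrow>
     range D \<subseteq> range (scr_class C i) \<and>
     (\<forall>x y. D (x + y) = qadd (D x) (D y)) \<and>
     (\<forall>c x. D (cscale c x) = qscale C i (cscale c 1) (D x)) \<and>
     (\<forall>x y. D (x * y) = qadd (qscale C i x (D y)) (qscale C i y (D x)))"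

definition is_screening :: "('i::finite \<Rightarrow> 'i \<Rightarrow> int) \<Rightarrow> 'i \<Rightarrow>
    ('i ylaurent \<Rightarrow> 'i scr_free set) \<Rightarrow> bool" where
  "is_screening C i D \<longleftrightarrow>
     is_scr_derivation C i D \<and>
     (\<forall>j n. D (Yvar j n) = scr_class C i (if i = j then single n (Yvar j n) else 0)) \<and>
     (\<forall>j n. D (Yinv j n) = scr_class C i (if i = j then single n (- Yinv j n) else 0))"

text \<open>Well-definedness is the lemma \<open>ex1_screening\<close> below.\<close>

definition screening :: "('i::finite \<Rightarrow> 'i \<Rightarrow> int) \<Rightarrow> 'i \<Rightarrow>
    'i ylaurent \<Rightarrow> 'i scr_free set" where
  "screening C i = (THE D. is_screening C i D)"

definition Kminus :: "('i::finite \<Rightarrow> 'i \<Rightarrow> int) \<Rightarrow> 'i ylaurent set" where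
  "Kminus C = (\<Inter>i. {x. screening C i x = scr_class C i 0})"

definition dominant :: "'i ymon \<Rightarrow> bool" where
  "dominant m \<longleftrightarrow> (\<forall>k. lookup m k \<ge> 0)"

definition has_unique_dominant :: "('i::finite \<Rightarrow> 'i \<Rightarrow> int) \<Rightarrow> 'i ymon \<Rightarrow> 'i ylaurent \<Rightarrow> bool" where
  "has_unique_dominant C m x \<longleftrightarrow>
     x \<in> Kminus C \<and> {m' \<in> keys x. dominant m'} = {m} \<and> lookup x m = 1"

definition Felt :: "('i::finite \<Rightarrow> 'i \<Rightarrow> int) \<Rightarrow> 'i ymon \<Rightarrow> 'i ylaurent" where
  "Felt C m = (THE x. has_unique_dominant C m x)"


section \<open>Existence and uniqueness of the screening operators\<close>

lemma poly_mapping_single_induct [case_names single sum]: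
  fixes x :: "'a \<Rightarrow>\<^sub>0 'b::comm_monoid_add"
  assumes single: "\<And>k v. P (single k v)"
    and sum: "\<And>f g. P f \<Longrightarrow> P g \<Longrightarrow> P (f + g)"
  shows "P x"
proof (induction x rule: update_induct)
  case const
  show ?case using single[of undefined 0] by simp
next
  case (update f a b)
  have "Poly_Mapping.update a b f = f + single a b"
    by (rule poly_mapping_eqI)
      (use update in \<open>auto simp: lookup_update lookup_add lookup_single when_def in_keys_iff\<close>)
  then show ?case using sum[OF update.IH single] by simp
qed

lemma lookup_cscale: "lookup (cscale c x) m = c * lookup x m"
  by (simp add: cscale_def Poly_Mapping.map.rep_eq when_def)

lemma lookup_fscale: "lookup (fscale y v) n = y * lookup v n"
  by (simp add: fscale_def Poly_Mapping.map.rep_eq when_def)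

lemma vector_space_cscale: "vector_space (cscale :: complex \<Rightarrow> 'i ylaurent \<Rightarrow> 'i ylaurent)"
  by unfold_locales
    (auto intro!: poly_mapping_eqI simp: lookup_cscale lookup_add algebra_simps)

lemma module_fscale: "module (fscale :: 'i ylaurent \<Rightarrow> 'i scr_free \<Rightarrow> 'i scr_free)"
  by unfold_locales
    (auto intro!: poly_mapping_eqI simp: lookup_fscale lookup_add algebra_simps)

lemma fscale_single: "fscale y (single n x) = single n (y * x)"
  by (rule poly_mapping_eqI) (auto simp: lookup_fscale lookup_single when_def)

lemma cscale_single: "cscale c (single m d) = single m (c * d)"
  by (rule poly_mapping_eqI) (auto simp: lookup_cscale lookup_single when_def)

lemma cscale_one_mult:
  fixes x :: "'i ylaurent"
  shows "cscale c 1 * x = cscale c x"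
proof (induction x rule: poly_mapping_single_induct)
  case (single k v)
  have "(cscale c 1 :: 'i ylaurent) = single 0 c" using cscale_single[of c 0 1] by simp
  then show ?case by (simp add: mult_single cscale_single)
next
  case (sum f g)
  have "cscale c (f + g) = cscale c f + cscale c g"
    by (rule poly_mapping_eqI) (simp add: lookup_cscale lookup_add algebra_simps)
  then show ?case using sum by (simp add: distrib_left)
qed

lemma rel_closed:
  shows rel_zero: "0 \<in> scr_rel C i"
    and rel_add: "u \<in> scr_rel C i \<Longrightarrow> v \<in> scr_rel C i \<Longrightarrow> u + v \<in> scr_rel C i"
    and rel_diff: "u \<in> scr_rel C i \<Longrightarrow> v \<in> scr_rel C i \<Longrightarrow> u - v \<in> scr_rel C i"
    and rel_scale: "u \<in> scr_rel C i \<Longrightarrow> fscale y u \<in> scr_rel C i"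
  unfolding scr_rel_def
  by (simp_all add: module.span_zero[OF module_fscale] module.span_add[OF module_fscale]
      module.span_diff[OF module_fscale] module.span_scale[OF module_fscale])

lemma scr_class_eq_iff: "scr_class C i v = scr_class C i w \<longleftrightarrow> v - w \<in> scr_rel C i"
proof
  assume "scr_class C i v = scr_class C i w"
  moreover have "v \<in> scr_class C i v" by (simp add: scr_class_def rel_zero)
  ultimately have "v \<in> scr_class C i w" by simp
  then show "v - w \<in> scr_rel C i" by (simp add: scr_class_def)
next
  assume *: "v - w \<in> scr_rel C i"
  have "u - v \<in> scr_rel C i \<longleftrightarrow> u - w \<in> scr_rel C i" for u
    using rel_add[OF _ *, of "u - v"] rel_diff[OF _ *, of "u - w"] by auto
  then show "scr_class C i v = scr_class C i w" by (auto simp: scr_class_def)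
qed

lemma qadd_class: "qadd (scr_class C i v) (scr_class C i w) = scr_class C i (v + w)"
proof (rule set_eqI, rule iffI)
  fix u assume "u \<in> qadd (scr_class C i v) (scr_class C i w)"
  then obtain a b where ab: "u = a + b" "a - v \<in> scr_rel C i" "b - w \<in> scr_rel C i"
    by (auto simp: qadd_def scr_class_def)
  have "u - (v + w) = (a - v) + (b - w)" by (simp add: ab)
  then have "u - (v + w) \<in> scr_rel C i" using rel_add[OF ab(2,3)] by metis
  then show "u \<in> scr_class C i (v + w)" by (simp add: scr_class_def)
next
  fix u assume "u \<in> scr_class C i (v + w)"
  then have "u = v + (u - v)" "v \<in> scr_class C i v" "u - v \<in> scr_class C i w"
    by (auto simp: scr_class_def rel_zero algebra_simps)
  then show "u \<in> qadd (scr_class C i v) (scr_class C i w)" unfolding qadd_def by blast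
qed

lemma fscale_diff: "fscale y (v - w) = fscale y v - fscale y w"
  by (rule poly_mapping_eqI) (simp add: lookup_fscale lookup_minus algebra_simps)

lemma qscale_class: "qscale C i y (scr_class C i v) = scr_class C i (fscale y v)"
proof (rule set_eqI, rule iffI)
  fix u assume "u \<in> qscale C i y (scr_class C i v)"
  then obtain a r where ar: "u = fscale y a + r" "a - v \<in> scr_rel C i" "r \<in> scr_rel C i"
    by (auto simp: qscale_def scr_class_def)
  have "u - fscale y v = fscale y (a - v) + r" by (simp add: ar fscale_diff)
  then show "u \<in> scr_class C i (fscale y v)"
    using rel_add[OF rel_scale[OF ar(2)] ar(3)] by (simp add: scr_class_def)
next
  fix u assume "u \<in> scr_class C i (fscale y v)"
  then have "u = fscale y v + (u - fscale y v)" "v \<in> scr_class C i v"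
    "u - fscale y v \<in> scr_rel C i"
    by (auto simp: scr_class_def rel_zero)
  then show "u \<in> qscale C i y (scr_class C i v)" unfolding qscale_def by blast
qed

text \<open>The logarithmic derivative \<open>Y \<partial>/\<partial>Y\<close> with respect to the variable \<open>k\<close>, and the lift of the
  screening operator to the free module.\<close>

definition euler :: "'i \<times> int \<Rightarrow> 'i ylaurent \<Rightarrow> 'i ylaurent" where
  "euler k x = Poly_Mapping.mapp (\<lambda>m c. of_int (lookup m k) * c) x"

definition scr_lift :: "'i \<Rightarrow> 'i ylaurent \<Rightarrow> 'i scr_free" where
  "scr_lift i x = (\<Sum>n\<in>{n. \<exists>m\<in>keys x. (i, n) \<in> keys m}. single n (euler (i, n) x))"

lemma lookup_euler: "lookup (euler k x) m = of_int (lookup m k) * lookup x m"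
  by (auto simp: euler_def lookup_mapp when_def in_keys_iff)

lemma euler_add: "euler k (x + y) = euler k x + euler k y"
  by (rule poly_mapping_eqI) (simp add: lookup_euler lookup_add algebra_simps)

lemma euler_single: "euler k (single m c) = single m (of_int (lookup m k) * c)"
  by (rule poly_mapping_eqI) (auto simp: lookup_euler lookup_single when_def)

lemma euler_mult: "euler k (x * y) = x * euler k y + y * euler k x"
proof (induction x rule: poly_mapping_single_induct)
  case (single m c)
  show ?case
  proof (induction y rule: poly_mapping_single_induct)
    case (single m' c')
    have "of_int (lookup (m + m') k) * (c * c') =
        c * (of_int (lookup m' k) * c') + c' * (of_int (lookup m k) * c)"
      by (simp add: lookup_add algebra_simps)
    then show ?case
      by (simp add: mult_single euler_single add.commute[of m' m] flip: single_add)
  next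
    case (sum f g)
    then show ?case by (simp add: euler_add algebra_simps)
  qed
next
  case (sum f g)
  then show ?case by (simp add: euler_add algebra_simps)
qed

lemma lookup_scr_lift: "lookup (scr_lift i x) n = euler (i, n) x"
proof -
  let ?N = "{n. \<exists>m\<in>keys x. (i, n) \<in> keys m}"
  have "?N = (\<Union>m\<in>keys x. Pair i -` keys m)" by auto
  moreover have "finite (Pair i -` keys m)" for m :: "'a ymon"
    by (rule finite_vimageI) (auto simp: inj_on_def)
  ultimately have fin: "finite ?N" by simp
  have "euler (i, n) x = 0" if "n \<notin> ?N"
  proof (rule poly_mapping_eqI)
    fix m
    show "lookup (euler (i, n) x) m = lookup 0 m"
      using that by (auto simp: lookup_euler in_keys_iff)
  qed
  then show ?thesis
    using fin by (simp add: scr_lift_def lookup_sum lookup_single when_def sum.delta)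
qed

lemma euler_cscale: "euler k (cscale c x) = cscale c (euler k x)"
  by (rule poly_mapping_eqI) (simp add: lookup_euler lookup_cscale)

lemma is_screening_lift: "is_screening C i (\<lambda>x. scr_class C i (scr_lift i x))"
proof -
  have add: "scr_lift i (x + y) = scr_lift i x + scr_lift i y" for x y
    by (rule poly_mapping_eqI) (simp add: lookup_scr_lift lookup_add euler_add)
  have scale: "scr_lift i (cscale c x) = fscale (cscale c 1) (scr_lift i x)" for c x
    by (rule poly_mapping_eqI)
      (simp add: lookup_scr_lift lookup_fscale euler_cscale cscale_one_mult)
  have mult: "scr_lift i (x * y) = fscale x (scr_lift i y) + fscale y (scr_lift i x)" for x y
    by (rule poly_mapping_eqI) (simp add: lookup_scr_lift lookup_add lookup_fscale euler_mult)
  have Y: "scr_lift i (Yvar j n) = (if i = j then single n (Yvar j n) else 0)" for j n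
    by (rule poly_mapping_eqI)
      (auto simp: lookup_scr_lift Yvar_def mon_def euler_single lookup_single when_def)
  have Yi: "scr_lift i (Yinv j n) = (if i = j then single n (- Yinv j n) else 0)" for j n
    by (rule poly_mapping_eqI)
      (auto simp: lookup_scr_lift Yinv_def mon_def euler_single lookup_single when_def
        simp flip: single_uminus)
  show ?thesis
    unfolding is_screening_def is_scr_derivation_def
    by (auto simp: add scale mult Y Yi qadd_class qscale_class)
qed

lemma mon_add: "mon (m + m') = mon m * mon m'"
  by (simp add: mon_def mult_single)

lemma ylaurent_induct:
  fixes x :: "'i ylaurent"
  assumes add: "\<And>x y. P x \<Longrightarrow> P y \<Longrightarrow> P (x + y)"
    and scale: "\<And>c x. P x \<Longrightarrow> P (cscale c x)"
    and mult: "\<And>x y. P x \<Longrightarrow> P y \<Longrightarrow> P (x * y)"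
    and Y: "\<And>j n. P (Yvar j n)" and Yi: "\<And>j n. P (Yinv j n)"
  shows "P x"
proof -
  have one: "P 1"
  proof -
    fix j :: 'i
    have "Yvar j 0 * Yinv j 0 = 1"
      by (simp add: Yvar_def Yinv_def mon_def mult_single flip: single_add)
    then show ?thesis using mult[OF Y[of j 0] Yi[of j 0]] by simp
  qed
  have nat: "P (mon (single (j, n) (int e)))" "P (mon (single (j, n) (- int e)))" for j n e
  proof (induction e)
    case 0
    { case 1 show ?case using one by (simp add: mon_def) }
    { case 2 show ?case using one by (simp add: mon_def) }
  next
    case (Suc e)
    { case 1
      have "mon (single (j, n) (int (Suc e))) = Yvar j n * mon (single (j, n) (int e))"
        by (simp add: Yvar_def single_add flip: mon_add)
      then show ?case using mult[OF Y Suc(1)] by simp }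
    { case 2
      have "mon (single (j, n) (- int (Suc e))) = Yinv j n * mon (single (j, n) (- int e))"
        by (simp add: Yinv_def flip: mon_add single_add)
      then show ?case using mult[OF Yi Suc(2)] by simp }
  qed
  have mono: "P (mon (single k e))" for k e
    using nat[of "fst k" "snd k" "nat \<bar>e\<bar>"] by (cases "e \<ge> 0") auto
  have all_mon: "P (mon m)" for m
    by (induction m rule: poly_mapping_single_induct) (auto simp: mono mon_add mult)
  show ?thesis
  proof (induction x rule: poly_mapping_single_induct)
    case (single m c)
    show ?case using scale[OF all_mon[of m], of c] by (simp add: mon_def cscale_single)
  qed (use add in auto)
qed

lemma ex1_screening: "\<exists>!D. is_screening C i D"
proof (rule ex1I[where a = "\<lambda>x. scr_class C i (scr_lift i x)"])
  show "is_screening C i (\<lambda>x. scr_class C i (scr_lift i x))" by (rule is_screening_lift)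
next
  fix D assume D: "is_screening C i D"
  let ?L = "\<lambda>x. scr_class C i (scr_lift i x)"
  note L = is_screening_lift[of C i]
  have "D x = ?L x" for x
  proof (induction x rule: ylaurent_induct)
    case (1 x y)
    then show ?case using D L unfolding is_screening_def is_scr_derivation_def by metis
  next
    case (2 c x)
    then show ?case using D L unfolding is_screening_def is_scr_derivation_def by metis
  next
    case (3 x y)
    then show ?case using D L unfolding is_screening_def is_scr_derivation_def by metis
  next
    case (4 j n)
    then show ?case using D L unfolding is_screening_def by metis
  next
    case (5 j n)
    then show ?case using D L unfolding is_screening_def by metis
  qed
  then show "D = ?L" by blast
qed

lemma screening_eq: "screening C i x = scr_class C i (scr_lift i x)"
proof -
  have "is_screening C i (screening C i)"
    unfolding screening_def by (rule theI'[OF ex1_screening])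
  then have "screening C i = (\<lambda>x. scr_class C i (scr_lift i x))"
    using ex1_screening[of C i] is_screening_lift[of C i] by blast
  then show ?thesis by (rule fun_cong)
qed

lemma Kminus_eq: "Kminus C = {x. \<forall>i. scr_lift i x \<in> scr_rel C i}"
  by (auto simp: Kminus_def screening_eq scr_class_eq_iff)

end

theory Submission
  imports Defs "HOL-Library.Multiset" "HOL-Analysis.Cartesian_Euclidean_Space"
begin

text \<open>Order the monomials by divisibility through products of the \<open>A\<^sub>i(zt\<^sup>n)\<^sup>-\<^sup>1\<close>. The kernel of \<open>S\<^sub>i\<close> is spanned
  by the elements \<open>m \<Prod> (1 + A\<^sub>i(zt\<^sup>n\<^sup>+\<^sup>1)\<^sup>-\<^sup>1)\<close>, one factor for each \<open>Y\<^sub>i(zt\<^sup>n)\<close> in the \<open>i\<close>-dominant monomial \<open>m\<close>, and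
  a lexicographically maximal monomial of a common kernel element is dominant. This gives uniqueness.

  For existence, coefficients are fixed monomial by monomial from \<open>m\<close> downwards so that for every \<open>i\<close>
  separately they extend to the kernel of \<open>S\<^sub>i\<close>. The coefficient at a monomial that is neither \<open>i\<close>- nor
  \<open>j\<close>-dominant is prescribed twice; the two values agree because the claim holds in rank two, where the
  types \<open>A\<^sub>1 \<times> A\<^sub>1\<close>, \<open>A\<^sub>2\<close>, \<open>B\<^sub>2\<close>, \<open>G\<^sub>2\<close> are settled by explicit fundamental elements. The result is a finite sum: the
  weights that occur are not longer than the weight of \<open>m\<close>, in the norm of the positive definite form
  that the Killing form induces on the real span of the simple roots.\<close>

section \<open>The order of the monomials\<close>

text \<open>Write A_i(n) for \<open>A\<^sub>i(zt\<^sup>n)\<close>. The obstacle to existence is that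
  infinitely many monomials lie below \<open>m\<close>, the level of a factor A_i(n)^-1 being
  unrestricted: a recursion over all of them would only give an infinite series. Coefficients are
  therefore computed on a finite set closed upwards, along with one element of each single kernel
  that has these coefficients there. These elements may differ elsewhere. The length bound shows
  that the terms of their expansions that matter start in a smaller finite set; keeping only those
  terms makes the elements coincide.

  Lengths do not grow because an \<open>i\<close>-dominant monomial of weight mu produces only the
  weights mu - c alpha_i with 0 <= c <= <mu, alpha_i^vee>, which lie between mu and its reflection.

  The shift in A_i(n) is 1 for long and short roots alike. The fundamental elements of B_2 and G_2
  are therefore those of A_3 and D_4 with the outer vertices of the diagram identified, which is why
  coefficients above 1 occur.\<close>

definition aexp :: "('i::finite \<Rightarrow> 'i \<Rightarrow> int) \<Rightarrow> 'i \<times> int \<Rightarrow> 'i ymon" where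
  "aexp C k = single (fst k, snd k + 1) 1 + single (fst k, snd k - 1) 1 +
     (\<Sum>j\<in>UNIV - {fst k}. single (j, snd k) (C j (fst k)))"

lemma mon_zero [simp]: "mon 0 = 1"
  by (simp add: mon_def)

lemma mon_sum: "finite S \<Longrightarrow> mon (\<Sum>j\<in>S. f j) = (\<Prod>j\<in>S. mon (f j))"
  by (induction S rule: finite_induct) (auto simp: mon_add)

lemma Avar_eq_mon: "Avar C i n = mon (aexp C (i, n))"
proof -
  have "(\<Prod>j\<in>UNIV - {i}. mon (single (j, n) (- incidence C j i))) =
      (\<Prod>j\<in>UNIV - {i}. mon (single (j, n) (C j i)))"
    by (rule prod.cong) (auto simp: incidence_def)
  then show ?thesis
    by (simp add: Avar_def aexp_def Yvar_def mon_add mon_sum)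
qed

lemma lookup_aexp:
  "lookup (aexp C (i, n)) (j, p) =
     (if j = i then of_bool (p = n + 1) + of_bool (p = n - 1) else (if p = n then C j i else 0))"
proof -
  have "lookup (\<Sum>j\<in>UNIV - {i}. single (j, n) (C j i)) (j, p) =
      (\<Sum>k\<in>UNIV - {i}. if k = j then (if p = n then C j i else 0) else 0)"
    unfolding lookup_sum by (rule sum.cong) (auto simp: lookup_single when_def)
  also have "\<dots> = (if j \<noteq> i \<and> p = n then C j i else 0)"
    by (subst sum.delta) auto
  finally show ?thesis
    by (auto simp: aexp_def lookup_add lookup_single when_def)
qed

definition asum :: "('i::finite \<Rightarrow> 'i \<Rightarrow> int) \<Rightarrow> ('i \<times> int) multiset \<Rightarrow> 'i ymon" where
  "asum C v = (\<Sum>k\<in>#v. aexp C k)"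

lemma asum_simps [simp]:
  "asum C {#} = 0" "asum C (add_mset k v) = aexp C k + asum C v"
  "asum C (v + w) = asum C v + asum C w"
  by (simp_all add: asum_def)

lemma lookup_asum:
  "lookup (asum C v) (i, n) = int (count v (i, n + 1)) + int (count v (i, n - 1)) +
     (\<Sum>j\<in>UNIV - {i}. C i j * int (count v (j, n)))"
proof (induction v)
  case (add k v)
  obtain j p where k: "k = (j, p)" by (cases k)
  have "(\<Sum>l\<in>UNIV - {i}. C i l * int (count (add_mset k v) (l, n))) =
      (\<Sum>l\<in>UNIV - {i}. C i l * int (count v (l, n)) + (if l = j then (if p = n then C i j else 0) else 0))"
    by (rule sum.cong) (auto simp: k algebra_simps)
  also have "\<dots> = (\<Sum>l\<in>UNIV - {i}. C i l * int (count v (l, n))) + (if j \<noteq> i \<and> p = n then C i j else 0)"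
    by (simp add: sum.distrib sum.delta)
  finally show ?case
    using add by (auto simp: k lookup_add lookup_aexp)
qed simp

text \<open>At the lowest level \<open>n\<close> where \<open>v\<close> and \<open>w\<close> differ, the multiplicity of \<open>(i, n)\<close> is read off
  the exponent at \<open>(i, n - 1)\<close>.\<close>

lemma asum_inj:
  assumes eq: "asum C v = asum C w"
  shows "v = w"
proof (rule ccontr)
  assume ne: "v \<noteq> w"
  define S where "S = {n. \<exists>i. count v (i, n) \<noteq> count w (i, n)}"
  have "S \<subseteq> snd ` (set_mset v \<union> set_mset w)"
  proof
    fix n assume "n \<in> S"
    then obtain i where "count v (i, n) \<noteq> count w (i, n)" by (auto simp: S_def)
    then have "(i, n) \<in> set_mset v \<union> set_mset w" by (metis UnCI not_in_iff)
    then show "n \<in> snd ` (set_mset v \<union> set_mset w)" by force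
  qed
  then have fin: "finite S" by (rule finite_subset) auto
  have "S \<noteq> {}" using ne by (auto simp: S_def multiset_eq_iff)
  define n where "n = Min S"
  have "n \<in> S" using fin \<open>S \<noteq> {}\<close> by (simp add: n_def)
  then obtain i where i: "count v (i, n) \<noteq> count w (i, n)" by (auto simp: S_def)
  have low: "count v (j, p) = count w (j, p)" if "p < n" for j p
    using that fin by (metis (mono_tags, lifting) Min_le S_def linorder_not_less mem_Collect_eq n_def)
  have "lookup (asum C v) (i, n - 1) = lookup (asum C w) (i, n - 1)" using eq by simp
  then have "int (count v (i, n)) = int (count w (i, n))"
    by (simp add: lookup_asum low)
  then show False using i by simp
qed

text \<open>\<open>J\<close> is the set of vertices whose A's may be used: one vertex for a single
  screening operator, two in rank two, \<open>UNIV\<close> for the common kernel.\<close>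

definition mle :: "('i::finite \<Rightarrow> 'i \<Rightarrow> int) \<Rightarrow> 'i set \<Rightarrow> 'i ymon \<Rightarrow> 'i ymon \<Rightarrow> bool" where
  "mle C J m' m \<longleftrightarrow> (\<exists>v. fst ` set_mset v \<subseteq> J \<and> m = m' + asum C v)"

lemma mle_refl [simp]: "mle C J m m"
  unfolding mle_def by (rule exI[of _ "{#}"]) simp

lemma mle_trans: "mle C J m1 m2 \<Longrightarrow> mle C J m2 m3 \<Longrightarrow> mle C J m1 m3"
proof -
  assume "mle C J m1 m2" "mle C J m2 m3"
  then obtain v w where "fst ` set_mset v \<subseteq> J" "m2 = m1 + asum C v"
    "fst ` set_mset w \<subseteq> J" "m3 = m2 + asum C w" by (auto simp: mle_def)
  then show ?thesis unfolding mle_def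
    by (intro exI[of _ "v + w"]) (auto simp: add.assoc)
qed

lemma mle_antisym: "mle C J m1 m2 \<Longrightarrow> mle C J' m2 m1 \<Longrightarrow> m1 = m2"
proof -
  assume "mle C J m1 m2" "mle C J' m2 m1"
  then obtain v w where vw: "m2 = m1 + asum C v" "m1 = m2 + asum C w" unfolding mle_def by blast
  then have "m1 = m1 + (asum C v + asum C w)" by (metis add.assoc)
  then have "asum C (v + w) = asum C {#}" by simp
  then have "v + w = {#}" by (rule asum_inj)
  then show ?thesis using vw by simp
qed

lemma mle_mono: "mle C J m1 m2 \<Longrightarrow> J \<subseteq> J' \<Longrightarrow> mle C J' m1 m2"
  unfolding mle_def by blast

lemma mle_add: "mle C J m1 m2 \<Longrightarrow> mle C J m3 m4 \<Longrightarrow> mle C J (m1 + m3) (m2 + m4)"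
proof -
  assume "mle C J m1 m2" "mle C J m3 m4"
  then obtain v w where "fst ` set_mset v \<subseteq> J" "m2 = m1 + asum C v"
    "fst ` set_mset w \<subseteq> J" "m4 = m3 + asum C w" by (auto simp: mle_def)
  then show ?thesis unfolding mle_def
    by (intro exI[of _ "v + w"]) (auto simp: algebra_simps)
qed

lemma mle_diff_asum: "fst ` set_mset v \<subseteq> J \<Longrightarrow> mle C J (m - asum C v) m"
  unfolding mle_def by (rule exI[of _ v]) simp

lemma finite_below_multiset: "finite {v. v \<subseteq># (w :: 'a multiset)}"
proof (induction w)
  case (add x w)
  have "{v. v \<subseteq># add_mset x w} \<subseteq> {v. v \<subseteq># w} \<union> add_mset x ` {v. v \<subseteq># w}"
  proof
    fix v assume v: "v \<in> {v. v \<subseteq># add_mset x w}"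
    show "v \<in> {v. v \<subseteq># w} \<union> add_mset x ` {v. v \<subseteq># w}"
    proof (cases "x \<in># v")
      case True
      then obtain v' where "v = add_mset x v'" by (metis insert_DiffM)
      then show ?thesis using v by auto
    next
      case False
      then have "v \<subseteq># w" using v
        by (metis diff_single_trivial diff_subset_eq_self mem_Collect_eq subset_eq_diff_conv
            add_mset_add_single diff_union_swap)
      then show ?thesis by simp
    qed
  qed
  then show ?case using add by (meson finite_Un finite_imageI finite_subset)
qed simp

text \<open>By \<open>asum_inj\<close> the monomials in between correspond to sub-multisets of one
  multiset. Only intervals are finite, not the set of all monomials below \<open>m0\<close>.\<close>

lemma finite_mle_interval: "finite {m'. mle C J m m' \<and> mle C J m' m0}"
proof (cases "mle C J m m0")
  case True
  then obtain v where v: "m0 = m + asum C v" by (auto simp: mle_def)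
  have "{m'. mle C J m m' \<and> mle C J m' m0} \<subseteq> (\<lambda>w. m + asum C w) ` {w. w \<subseteq># v}"
  proof
    fix m' assume "m' \<in> {m'. mle C J m m' \<and> mle C J m' m0}"
    then obtain w w' where w: "m' = m + asum C w" "m0 = m' + asum C w'" by (auto simp: mle_def)
    then have "m + asum C v = m + asum C (w + w')" using v by (simp add: add.assoc)
    then have "v = w + w'" by (metis add_left_cancel asum_inj)
    then show "m' \<in> (\<lambda>w. m + asum C w) ` {w. w \<subseteq># v}" using w by auto
  qed
  then show ?thesis using finite_below_multiset finite_surj by blast
next
  case False
  then have "{m'. mle C J m m' \<and> mle C J m' m0} = {}" by (blast intro: mle_trans)
  then show ?thesis by (simp only: finite.emptyI)
qed

definition nonneg_on :: "'i set \<Rightarrow> 'i ymon \<Rightarrow> bool" where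
  "nonneg_on J m \<longleftrightarrow> (\<forall>i\<in>J. \<forall>n. lookup m (i, n) \<ge> 0)"

lemma nonneg_on_UNIV: "nonneg_on UNIV m = dominant m"
  by (auto simp: nonneg_on_def dominant_def)

text \<open>A_i(n) raises the exponent at \<open>(i, n - 1)\<close>. As that exponent is nonnegative
  in \<open>d\<close>, the multiplicity of A_i(n) in the quotient of \<open>m\<close> by
  \<open>d\<close> is at most the exponent of \<open>m\<close> there.\<close>

lemma finite_dom_mle: "finite {d. nonneg_on {i} d \<and> mle C {i} d m}"
proof -
  have "finite {n. lookup m (i, n - 1) \<noteq> 0}"
  proof -
    have "{n. lookup m (i, n - 1) \<noteq> 0} \<subseteq> (\<lambda>k. snd k + 1) ` keys m"
      by (force simp: in_keys_iff)
    then show ?thesis by (rule finite_subset) simp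
  qed
  define w where "w = (\<Sum>k\<in>keys m. replicate_mset (nat (lookup m k)) (fst k, snd k + 1))"
  have cw: "count w (i, n) \<ge> nat (lookup m (i, n - 1))" for n
  proof (cases "(i, n - 1) \<in> keys m")
    case True
    have "count w (i, n) = (\<Sum>k\<in>keys m. count (replicate_mset (nat (lookup m k)) (fst k, snd k + 1)) (i, n))"
      by (simp add: w_def count_sum)
    also have "\<dots> \<ge> count (replicate_mset (nat (lookup m (i, n - 1))) (fst (i, n - 1), snd (i, n - 1) + 1)) (i, n)"
      by (rule member_le_sum[OF True]) auto
    finally show ?thesis by simp
  next
    case False
    then show ?thesis by (simp add: in_keys_iff)
  qed
  have "{d. nonneg_on {i} d \<and> mle C {i} d m} \<subseteq> (\<lambda>v. m - asum C v) ` {v. v \<subseteq># w}"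
  proof
    fix d assume "d \<in> {d. nonneg_on {i} d \<and> mle C {i} d m}"
    then obtain v where v: "nonneg_on {i} d" "fst ` set_mset v \<subseteq> {i}" "m = d + asum C v"
      by (auto simp: mle_def)
    have z: "count v (j, n) = 0" if "j \<noteq> i" for j n
      using v(2) that by (metis fst_conv image_subset_iff not_in_iff singletonD)
    have "count v (j, n) \<le> count w (j, n)" for j n
    proof (cases "j = i")
      case True
      have "lookup m (i, n - 1) = lookup d (i, n - 1) + lookup (asum C v) (i, n - 1)"
        by (simp add: v(3) lookup_add)
      moreover have "lookup d (i, n - 1) \<ge> 0" using v(1) by (simp add: nonneg_on_def)
      moreover have "(\<Sum>j\<in>UNIV - {i}. C i j * int (count v (j, n - 1))) = 0"
        by (rule sum.neutral) (simp add: z)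
      ultimately have "int (count v (i, n)) \<le> lookup m (i, n - 1)"
        by (simp add: lookup_asum)
      then show ?thesis using cw[of n] True by simp
    qed (simp add: z)
    then have "v \<subseteq># w" by (auto simp: subseteq_mset_def)
    then show "d \<in> (\<lambda>v. m - asum C v) ` {v. v \<subseteq># w}" using v(3) by auto
  qed
  then show ?thesis using finite_below_multiset finite_surj by blast
qed

section \<open>The kernel of a screening operator\<close>

lemma scr_lift_add: "scr_lift i (x + y) = scr_lift i x + scr_lift i y"
  by (rule poly_mapping_eqI) (simp add: lookup_scr_lift lookup_add euler_add)

lemma scr_lift_cscale: "scr_lift i (cscale c x) = fscale (cscale c 1) (scr_lift i x)"
  by (rule poly_mapping_eqI)
    (simp add: lookup_scr_lift lookup_fscale euler_cscale cscale_one_mult)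

lemma scr_lift_mult: "scr_lift i (x * y) = fscale x (scr_lift i y) + fscale y (scr_lift i x)"
  by (rule poly_mapping_eqI) (simp add: lookup_scr_lift lookup_add lookup_fscale euler_mult)

definition Ker :: "('i::finite \<Rightarrow> 'i \<Rightarrow> int) \<Rightarrow> 'i \<Rightarrow> 'i ylaurent set" where
  "Ker C i = {x. scr_lift i x \<in> scr_rel C i}"

lemma Kminus_eq_Ker: "Kminus C = (\<Inter>i. Ker C i)"
  by (auto simp: Kminus_eq Ker_def)

lemma Ker_zero [simp]: "0 \<in> Ker C i"
proof -
  have "scr_lift i 0 = 0"
    by (rule poly_mapping_eqI, rule poly_mapping_eqI) (simp add: lookup_scr_lift lookup_euler)
  then show ?thesis by (simp add: Ker_def rel_zero)
qed

lemma Ker_add: "x \<in> Ker C i \<Longrightarrow> y \<in> Ker C i \<Longrightarrow> x + y \<in> Ker C i"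
  by (simp add: Ker_def scr_lift_add rel_add)

lemma Ker_cscale: "x \<in> Ker C i \<Longrightarrow> cscale c x \<in> Ker C i"
  by (simp add: Ker_def scr_lift_cscale rel_scale)

lemma Ker_mult: "x \<in> Ker C i \<Longrightarrow> y \<in> Ker C i \<Longrightarrow> x * y \<in> Ker C i"
  by (simp add: Ker_def scr_lift_mult rel_add rel_scale)

lemma cscale_minus_one: "cscale (- 1) x = - x"
  by (rule poly_mapping_eqI) (simp add: lookup_cscale)

lemma Ker_diff: "x \<in> Ker C i \<Longrightarrow> y \<in> Ker C i \<Longrightarrow> x - y \<in> Ker C i"
  using Ker_add[OF _ Ker_cscale[of y C i "- 1"], of x] by (simp add: cscale_minus_one)

lemma Ker_sum: "(\<And>d. d \<in> S \<Longrightarrow> f d \<in> Ker C i) \<Longrightarrow> (\<Sum>d\<in>S. f d) \<in> Ker C i"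
  by (induction S rule: infinite_finite_induct) (auto intro: Ker_add)

lemma scr_lift_mon:
  "scr_lift i (mon m) = (\<Sum>n\<in>{n. (i, n) \<in> keys m}. single n (cscale (of_int (lookup m (i, n))) (mon m)))"
  by (auto simp: scr_lift_def mon_def euler_single cscale_single intro!: sum.cong)

lemma Ker_mon: "(\<And>n. lookup m (i, n) = 0) \<Longrightarrow> mon m \<in> Ker C i"
  by (simp add: Ker_def scr_lift_mon in_keys_iff rel_zero)

text \<open>With A = A_i(n + 1), the operator gives \<open>mon m\<close> S(n) on the first term and
  minus \<open>mon m\<close> A^-1 S(n + 2) on the second; they cancel since S(n + 2) = A S(n) in the
  quotient.\<close>

lemma Ker_one_step:
  assumes "\<And>k. lookup m (i, k) = (if k = n then 1 else 0)"
  shows "mon m * (1 + mon (- aexp C (i, n + 1))) \<in> Ker C i"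
proof -
  let ?b = "aexp C (i, n + 1)"
  have l: "lookup (m - ?b) (i, k) = (if k = n + 2 then - 1 else 0)" for k
    using assms by (simp add: lookup_minus lookup_aexp)
  have 1: "scr_lift i (mon m) = single n (mon m)"
  proof -
    have "{k. (i, k) \<in> keys m} = {n}" using assms by (auto simp: in_keys_iff)
    then show ?thesis using assms
      by (simp add: scr_lift_mon) (simp add: mon_def cscale_single)
  qed
  have 2: "scr_lift i (mon (m - ?b)) = single (n + 2) (- mon (m - ?b))"
  proof -
    have "{k. (i, k) \<in> keys (m - ?b)} = {n + 2}" using l by (auto simp: in_keys_iff)
    then show ?thesis using l
      by (simp add: scr_lift_mon cscale_minus_one)
  qed
  have 3: "mon m * (1 + mon (- ?b)) = mon m + mon (m - ?b)"
    by (simp add: distrib_left flip: mon_add)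
  let ?r = "single (n + 2) 1 - fscale (Avar C i (n + 1)) (single n 1)"
  have "?r \<in> scr_rel C i"
    unfolding scr_rel_def by (rule module.span_base[OF module_fscale]) auto
  then have "fscale (- mon (m - ?b)) ?r \<in> scr_rel C i" by (rule rel_scale)
  moreover have "fscale (- mon (m - ?b)) ?r = single (n + 2) (- mon (m - ?b)) + single n (mon m)"
    by (simp add: fscale_diff fscale_single Avar_eq_mon mon_add[symmetric]
        single_uminus)
  ultimately show ?thesis
    unfolding Ker_def 3 scr_lift_add mem_Collect_eq 1 2 by (simp add: add.commute)
qed

definition lowering :: "('i::finite \<Rightarrow> 'i \<Rightarrow> int) \<Rightarrow> 'i \<Rightarrow> int multiset \<Rightarrow> 'i ylaurent" where
  "lowering C i ns = (\<Prod>n\<in>#ns. 1 + mon (- aexp C (i, n + 1)))"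

text \<open>The kernel of a derivation is a subalgebra: the product splits into elements of
  \<open>Ker_one_step\<close>, one for each Y_i, and a monomial free of Y_i.\<close>

lemma Ker_lowering:
  assumes "\<And>k. lookup m (i, k) = int (count ns k)"
  shows "mon m * lowering C i ns \<in> Ker C i"
  using assms
proof (induction ns arbitrary: m)
  case empty
  then show ?case by (auto simp: lowering_def intro: Ker_mon)
next
  case (add n ns)
  let ?s = "single (i, n) 1 :: 'a ymon"
  have "mon (m - ?s) * lowering C i ns \<in> Ker C i"
    by (rule add.IH) (use add.prems in \<open>auto simp: lookup_minus lookup_single when_def\<close>)
  moreover have "mon ?s * (1 + mon (- aexp C (i, n + 1))) \<in> Ker C i"
    by (rule Ker_one_step) (auto simp: lookup_single when_def)
  ultimately have "(mon (m - ?s) * lowering C i ns) * (mon ?s * (1 + mon (- aexp C (i, n + 1)))) \<in> Ker C i"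
    by (blast intro: Ker_mult)
  moreover have "(mon (m - ?s) * lowering C i ns) * (mon ?s * (1 + mon (- aexp C (i, n + 1)))) =
      mon (m - ?s) * mon ?s * lowering C i (add_mset n ns)"
    by (simp only: lowering_def image_mset_add_mset prod_mset.add_mset mult.assoc mult.left_commute mult.commute)
  ultimately show ?case by (simp flip: mon_add)
qed

text \<open>Negative exponents are cut off at 0, so this records the Y_i-part of \<open>m\<close>
  faithfully only if \<open>m\<close> is \<open>i\<close>-dominant.\<close>

definition levels :: "'i \<Rightarrow> 'i ymon \<Rightarrow> int multiset" where
  "levels i m = Abs_multiset (\<lambda>n. nat (lookup m (i, n)))"

lemma count_levels: "count (levels i m) n = nat (lookup m (i, n))"
proof -
  have "{n. 0 < nat (lookup m (i, n))} \<subseteq> snd ` keys m"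
  proof
    fix n assume "n \<in> {n. 0 < nat (lookup m (i, n))}"
    then have "(i, n) \<in> keys m" by (simp add: in_keys_iff)
    then show "n \<in> snd ` keys m" by (rule image_eqI[rotated]) simp
  qed
  then have "finite {n. 0 < nat (lookup m (i, n))}" by (rule finite_subset) simp
  then show ?thesis by (simp add: levels_def)
qed

text \<open>For dominant \<open>m\<close> in type A_1 this is the q-character of a tensor product of
  two-dimensional evaluation modules.\<close>

definition Lel :: "('i::finite \<Rightarrow> 'i \<Rightarrow> int) \<Rightarrow> 'i \<Rightarrow> 'i ymon \<Rightarrow> 'i ylaurent" where
  "Lel C i m = mon m * lowering C i (levels i m)"

lemma Lel_Ker: "nonneg_on {i} m \<Longrightarrow> Lel C i m \<in> Ker C i"
  unfolding Lel_def by (rule Ker_lowering) (simp add: count_levels nonneg_on_def)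

lemma keys_mon_mult: "keys (mon m * x) = (\<lambda>p. m + p) ` keys x"
proof -
  have "mon m * x = Poly_Mapping.map_key (\<lambda>p. p - m) x"
  proof (rule poly_mapping_eqI)
    fix p
    have inj: "inj (\<lambda>p. p - m)" by (auto simp: inj_on_def)
    show "lookup (mon m * x) p = lookup (Poly_Mapping.map_key (\<lambda>p. p - m) x) p"
      using inj
    proof (induction x rule: poly_mapping_single_induct)
      case (single k v)
      then show ?case
        by (auto simp: mon_def mult_single map_key.rep_eq lookup_single when_def algebra_simps)
    next
      case (sum f g)
      then show ?case by (simp add: distrib_left lookup_add map_key.rep_eq)
    qed
  qed
  moreover have "inj (\<lambda>p. p - m)" by (auto simp: inj_on_def)
  ultimately show ?thesis
    by (force simp: in_keys_iff map_key.rep_eq image_iff)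
qed

lemma lookup_mon_mult: "lookup (mon m * x) (m + p) = lookup x p"
proof (induction x rule: poly_mapping_single_induct)
  case (single k v)
  then show ?case by (auto simp: mon_def mult_single lookup_single when_def)
next
  case (sum f g)
  then show ?case by (simp add: distrib_left lookup_add)
qed

lemma keys_lowering:
  "keys (lowering C i ns) \<subseteq> {- asum C (image_mset (\<lambda>n. (i, n + 1)) w) | w. w \<subseteq># ns}"
proof (induction ns)
  case empty
  then show ?case by (simp add: lowering_def)
next
  case (add n ns)
  let ?b = "aexp C (i, n + 1)"
  have eq: "lowering C i (add_mset n ns) = lowering C i ns + mon (- ?b) * lowering C i ns"
    by (simp add: lowering_def distrib_right)
  show ?case
  proof
    fix p assume "p \<in> keys (lowering C i (add_mset n ns))"
    then have "p \<in> keys (lowering C i ns) \<or> p \<in> (\<lambda>p. - ?b + p) ` keys (lowering C i ns)"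
      unfolding eq using keys_add keys_mon_mult by fastforce
    then show "p \<in> {- asum C (image_mset (\<lambda>n. (i, n + 1)) w) | w. w \<subseteq># add_mset n ns}"
    proof
      assume "p \<in> keys (lowering C i ns)"
      then obtain w where "w \<subseteq># ns" "p = - asum C (image_mset (\<lambda>n. (i, n + 1)) w)"
        using add by blast
      then show ?thesis
        by (metis (mono_tags, lifting) mem_Collect_eq add_mset_add_single mset_subset_eq_add_left subset_mset.order_trans)
    next
      assume "p \<in> (\<lambda>p. - ?b + p) ` keys (lowering C i ns)"
      then obtain w where "w \<subseteq># ns" "p = - ?b - asum C (image_mset (\<lambda>n. (i, n + 1)) w)"
        using add by auto
      then show ?thesis
        by (intro CollectI exI[of _ "add_mset n w"]) auto
    qed
  qed
qed

text \<open>Nothing cancels the 1: by \<open>asum_inj\<close> no nonempty product of A's is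
  trivial.\<close>

lemma lookup_lowering_zero: "lookup (lowering C i ns) 0 = 1"
proof (induction ns)
  case empty
  then show ?case by (simp add: lowering_def)
next
  case (add n ns)
  let ?b = "aexp C (i, n + 1)"
  have eq: "lowering C i (add_mset n ns) = lowering C i ns + mon (- ?b) * lowering C i ns"
    by (simp add: lowering_def distrib_right)
  have "?b \<notin> keys (lowering C i ns)"
  proof
    assume "?b \<in> keys (lowering C i ns)"
    then obtain w where "?b = - asum C (image_mset (\<lambda>n. (i, n + 1)) w)" using keys_lowering by blast
    then have "asum C (add_mset (i, n + 1) (image_mset (\<lambda>n. (i, n + 1)) w)) = asum C {#}" by simp
    from asum_inj[OF this] show False by simp
  qed
  then have "lookup (mon (- ?b) * lowering C i ns) 0 = 0"
    using lookup_mon_mult[of "- ?b" "lowering C i ns" ?b] by (simp add: in_keys_iff)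
  then show ?case by (simp add: eq lookup_add add)
qed

lemma keys_Lel:
  assumes "p \<in> keys (Lel C i m)"
  obtains w where "w \<subseteq># levels i m" "p = m - asum C (image_mset (\<lambda>n. (i, n + 1)) w)"
  using assms keys_lowering[of C i "levels i m"] that by (auto simp: Lel_def keys_mon_mult)

lemma lookup_Lel: "lookup (Lel C i m) m = 1"
  using lookup_mon_mult[of m "lowering C i (levels i m)" 0] by (simp add: Lel_def lookup_lowering_zero)

lemma keys_Lel_mle: "p \<in> keys (Lel C i m) \<Longrightarrow> mle C {i} p m"
  by (elim keys_Lel) (auto intro!: mle_diff_asum)

section \<open>Leading monomials of the elements of the kernel\<close>

definition chain_sum :: "int \<Rightarrow> (int \<Rightarrow> 'i ymon) \<Rightarrow> 'i scr_free \<Rightarrow> complex" where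
  "chain_sum n q v = (\<Sum>k\<in>{k. n + 2 * k \<in> keys v}. lookup (lookup v (n + 2 * k)) (q k))"

lemma finite_chain_index: "finite {k. n + 2 * k \<in> keys (v :: 'i scr_free)}"
proof -
  have "inj (\<lambda>k. n + 2 * k)" by (auto simp: inj_on_def)
  then have "finite ((\<lambda>k. n + 2 * k) -` keys v)" by (intro finite_vimageI) auto
  then show ?thesis by (simp add: vimage_def)
qed

lemma chain_sum_superset:
  assumes "finite S" "{k. n + 2 * k \<in> keys v} \<subseteq> S"
  shows "chain_sum n q v = (\<Sum>k\<in>S. lookup (lookup v (n + 2 * k)) (q k))"
  unfolding chain_sum_def using assms
  by (intro sum.mono_neutral_left) (auto simp: in_keys_iff)

lemma chain_sum_add: "chain_sum n q (u + v) = chain_sum n q u + chain_sum n q v"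
proof -
  let ?S = "{k. n + 2 * k \<in> keys u} \<union> {k. n + 2 * k \<in> keys v}"
  have S: "finite ?S" by (simp add: finite_chain_index)
  have "{k. n + 2 * k \<in> keys (u + v)} \<subseteq> ?S" using keys_add[of u v] by blast
  then show ?thesis
    using chain_sum_superset[OF S, of n "u + v" q] chain_sum_superset[OF S, of n u q]
      chain_sum_superset[OF S, of n v q]
    by (simp add: lookup_add sum.distrib)
qed

text \<open>Expressing every symbol \<open>S\<^sub>i(zt\<^sup>n\<^sup>+\<^sup>2\<^sup>k)\<close> through \<open>S\<^sub>i(zt\<^sup>n)\<close> turns \<open>v\<close> into a multiple of \<open>S\<^sub>i(zt\<^sup>n)\<close>;
  \<open>chain_sum n q v\<close> is its coefficient at \<open>q 0\<close>.\<close>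

lemma chain_sum_rel:
  assumes q: "\<And>k. q (k + 1) = q k - aexp C (i, n + 2 * k + 1)"
    and v: "v \<in> scr_rel C i"
  shows "chain_sum n q v = 0"
proof -
  have single: "chain_sum n q (single p x) = (if even (p - n) then lookup x (q ((p - n) div 2)) else 0)"
    for p x
  proof -
    let ?S = "{(p - n) div 2}"
    have "{k. n + 2 * k \<in> keys (single p x)} \<subseteq> ?S"
      by (auto split: if_splits)
    from chain_sum_superset[OF _ this, of q]
    have eq: "chain_sum n q (single p x) = lookup (lookup (single p x) (n + 2 * ((p - n) div 2))) (q ((p - n) div 2))"
      by simp
    show ?thesis
    proof (cases "even (p - n)")
      case True
      then have "n + 2 * ((p - n) div 2) = p" by simp
      with True show ?thesis unfolding eq by (simp only: lookup_single_eq if_True)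
    next
      case False
      then have ne: "p \<noteq> n + 2 * ((p - n) div 2)" by (metis add_diff_cancel_left' dvd_triv_left)
      show ?thesis unfolding eq lookup_single_not_eq[OF ne] using False by (simp only: lookup_zero if_False)
    qed
  qed
  \<comment> \<open>A relation links only symbols of equal parity, so a chain meets both of its
    terms or neither; if both, the step of \<open>q\<close> is the exponent of the
    \<open>Avar\<close> in the relation.\<close>
  have gen: "chain_sum n q (fscale y (single (m + 2) 1 - fscale (Avar C i (m + 1)) (single m 1))) = 0"
    for y m
  proof -
    have "fscale y (single (m + 2) 1 - fscale (Avar C i (m + 1)) (single m 1)) =
        single (m + 2) y + single m (- (mon (aexp C (i, m + 1)) * y))"
      by (simp add: fscale_diff fscale_single Avar_eq_mon single_uminus mult.commute)
    moreover have "lookup y (q ((m + 2 - n) div 2)) - lookup (mon (aexp C (i, m + 1)) * y) (q ((m - n) div 2)) = 0"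
      if ev: "even (m - n)"
    proof -
      define k where "k = (m - n) div 2"
      have m: "m = n + 2 * k" using ev by (simp add: k_def)
      have k1: "(m + 2 - n) div 2 = k + 1" "(m - n) div 2 = k" by (simp_all add: m)
      have "q k = aexp C (i, m + 1) + q (k + 1)" using q[of k] by (simp add: m)
      then have "lookup (mon (aexp C (i, m + 1)) * y) (q k) = lookup y (q (k + 1))"
        by (simp only: lookup_mon_mult)
      then show ?thesis by (simp only: k1 diff_self)
    qed
    ultimately show ?thesis by (simp add: chain_sum_add single)
  qed
  have "\<forall>y. chain_sum n q (fscale y v) = 0"
    using v unfolding scr_rel_def
  proof (induction rule: module.span_induct_alt[OF module_fscale, consumes 1])
    case 1
    have "fscale y 0 = (0 :: 'a scr_free)" for y by (rule poly_mapping_eqI) (simp add: lookup_fscale)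
    then show ?case by (simp add: chain_sum_def)
  next
    case (2 c x u)
    have "fscale y (fscale c x + u) = fscale (y * c) x + fscale y u" for y
      by (rule poly_mapping_eqI) (simp add: lookup_fscale lookup_add algebra_simps)
    then show ?case using 2 gen by (auto simp: chain_sum_add)
  qed
  then have "chain_sum n q (fscale 1 v) = 0" by blast
  moreover have "fscale 1 v = v" by (rule poly_mapping_eqI) (simp add: lookup_fscale)
  ultimately show ?thesis by simp
qed

text \<open>Low levels count first, because multiplying by a nonempty product of A's changes the
  exponents at the lowest level affected only upwards, hence makes a monomial larger. At the
  deciding level all vertices must agree on the direction, so the order is partial.\<close>

definition lexgt :: "'i ymon \<Rightarrow> 'i ymon \<Rightarrow> bool" where
  "lexgt m' m \<longleftrightarrow> (\<exists>n. (\<forall>k<n. \<forall>j. lookup m' (j, k) = lookup m (j, k)) \<and>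
     (\<forall>j. lookup m' (j, n) \<ge> lookup m (j, n)) \<and> (\<exists>j. lookup m' (j, n) > lookup m (j, n)))"

lemma lexgt_irrefl: "\<not> lexgt m m"
  by (auto simp: lexgt_def)

lemma lexgt_trans: "lexgt m1 m2 \<Longrightarrow> lexgt m2 m3 \<Longrightarrow> lexgt m1 m3"
proof -
  assume "lexgt m1 m2" "lexgt m2 m3"
  then obtain n p where n: "\<forall>k<n. \<forall>j. lookup m1 (j, k) = lookup m2 (j, k)"
      "\<forall>j. lookup m1 (j, n) \<ge> lookup m2 (j, n)" "\<exists>j. lookup m1 (j, n) > lookup m2 (j, n)"
    and p: "\<forall>k<p. \<forall>j. lookup m2 (j, k) = lookup m3 (j, k)"
      "\<forall>j. lookup m2 (j, p) \<ge> lookup m3 (j, p)" "\<exists>j. lookup m2 (j, p) > lookup m3 (j, p)"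
    unfolding lexgt_def by blast
  consider "n < p" | "n = p" | "p < n" by linarith
  then show ?thesis
  proof cases
    case 1
    with n p show ?thesis unfolding lexgt_def by (intro exI[of _ n]) auto
  next
    case 2
    obtain j where "lookup m1 (j, n) > lookup m2 (j, n)" using n by blast
    moreover have "lookup m2 (j, n) \<ge> lookup m3 (j, n)" using p 2 by blast
    ultimately have "\<exists>j. lookup m1 (j, n) > lookup m3 (j, n)" by (intro exI[of _ j]) simp
    moreover have "lookup m1 (j, n) \<ge> lookup m3 (j, n)" for j using n(2) p(2) 2 order.trans by metis
    ultimately show ?thesis unfolding lexgt_def using n(1) p(1) 2 by (intro exI[of _ n]) auto
  next
    case 3
    with n p show ?thesis unfolding lexgt_def by (intro exI[of _ p]) auto
  qed
qed

lemma finite_lex_maximal: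
  assumes "finite S" "S \<noteq> {}"
  obtains m where "m \<in> S" "\<And>m'. m' \<in> S \<Longrightarrow> \<not> lexgt m' m"
proof -
  have "\<exists>m\<in>S. \<forall>m'\<in>S. \<not> lexgt m' m"
    using assms
  proof (induction S rule: finite_ne_induct)
    case (singleton x)
    then show ?case by (simp add: lexgt_irrefl)
  next
    case (insert x F)
    then obtain m where m: "m \<in> F" "\<forall>m'\<in>F. \<not> lexgt m' m" by blast
    show ?case
    proof (cases "lexgt x m")
      case True
      have "\<forall>m'\<in>F. \<not> lexgt m' x" using m True lexgt_trans by blast
      then show ?thesis by (auto simp: lexgt_irrefl)
    next
      case False
      then show ?thesis using m by auto
    qed
  qed
  then show ?thesis using that by blast
qed

lemma int_sequence_exists:
  fixes f :: "int \<Rightarrow> 'b::ab_group_add"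
  shows "\<exists>q. q 0 = m \<and> (\<forall>k. q (k + 1) = q k - f k)"
proof -
  define q where "q k = m - (\<Sum>l\<in>{0..<k}. f l) + (\<Sum>l\<in>{k..<0}. f l)" for k
  have "q 0 = m" by (simp add: q_def)
  moreover have "q (k + 1) = q k - f k" for k
  proof (cases "k \<ge> 0")
    case True
    then have "{0..<k + 1} = insert k {0..<k}" by auto
    then show ?thesis using True by (simp add: q_def algebra_simps)
  next
    case False
    then have "{k..<0} = insert k {k + 1..<0}" by auto
    then show ?thesis using False by (simp add: q_def algebra_simps)
  qed
  ultimately show ?thesis by blast
qed

text \<open>Among the monomials that agree with \<open>m\<close> below level \<open>n\<close> and, off \<open>i\<close>, at level \<open>n\<close>, take one
  with the least exponent at \<open>(i, n)\<close>. The chain through it meets no other monomial: its upper part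
  is lexicographically larger than \<open>m\<close>, its lower part has a smaller exponent at \<open>(i, n)\<close>. Hence
  that least exponent vanishes.\<close>

lemma lex_maximal_dom:
  assumes x: "x \<in> Ker C i" and m: "m \<in> keys x"
    and max: "\<And>m'. m' \<in> keys x \<Longrightarrow> \<not> lexgt m' m"
  shows "lookup m (i, n) \<ge> 0"
proof -
  define A where "A = {m' \<in> keys x. (\<forall>k<n. \<forall>j. lookup m' (j, k) = lookup m (j, k)) \<and>
    (\<forall>j. j \<noteq> i \<longrightarrow> lookup m' (j, n) = lookup m (j, n))}"
  have A: "finite A" "m \<in> A" using m by (auto simp: A_def)
  have "\<exists>m'. is_arg_min (\<lambda>p. lookup p (i, n)) (\<lambda>p. p \<in> A) m'"
    using A by (intro ex_is_arg_min_if_finite) blast+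
  then obtain m' where m': "m' \<in> A" and min: "\<And>p. p \<in> A \<Longrightarrow> lookup m' (i, n) \<le> lookup p (i, n)"
    unfolding is_arg_min_linorder by blast
  obtain q where q0: "q 0 = m'" and q: "\<And>k. q (k + 1) = q k - aexp C (i, n + 2 * k + 1)"
    using int_sequence_exists[of m' "\<lambda>k. aexp C (i, n + 2 * k + 1)"] by blast
  have up: "q k \<notin> keys x" if "k < 0" for k
  proof -
    \<comment> \<open>The lowest factor between \<open>m'\<close> and \<open>q k\<close> is A_i(n +
      2k + 1), whose lowest variable is Y_i at level n + 2k < n.\<close>
    have "(\<forall>p<n + 2 * k. \<forall>j. lookup (q k) (j, p) = lookup m' (j, p)) \<and>
       (\<forall>j. lookup (q k) (j, n + 2 * k) = lookup m' (j, n + 2 * k) + (if j = i then 1 else 0))"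
      using that
    proof (induction k rule: int_less_induct)
      case base
      have "q (- 1) = m' + aexp C (i, n - 1)" using q[of "- 1"] q0 by simp
      then show ?case by (simp add: lookup_add lookup_aexp)
    next
      case (step k)
      have "q (k - 1) = q k + aexp C (i, n + 2 * k - 1)" using q[of "k - 1"] by simp
      then show ?case using step by (simp add: lookup_add lookup_aexp algebra_simps)
    qed
    moreover have "\<forall>p<n. \<forall>j. lookup m' (j, p) = lookup m (j, p)" using m' by (simp add: A_def)
    ultimately have "lexgt (q k) m"
      unfolding lexgt_def using that by (intro exI[of _ "n + 2 * k"]) auto
    then show ?thesis using max by blast
  qed
  have down: "q k \<notin> keys x" if "k > 0" for k
  proof -
    have "(\<forall>p<n. \<forall>j. lookup (q k) (j, p) = lookup m' (j, p)) \<and>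
       (\<forall>j. lookup (q k) (j, n) = lookup m' (j, n) - (if j = i then 1 else 0))"
      using that
    proof (induction k rule: int_gr_induct)
      case base
      have "q 1 = m' - aexp C (i, n + 1)" using q[of 0] q0 by simp
      then show ?case by (simp add: lookup_minus lookup_aexp)
    next
      case (step k)
      then show ?case by (simp add: q lookup_minus lookup_aexp)
    qed
    then have "q k \<in> keys x \<longrightarrow> q k \<in> A \<and> lookup (q k) (i, n) < lookup m' (i, n)"
      using m' by (simp add: A_def)
    then show ?thesis using min by fastforce
  qed
  have "chain_sum n q (scr_lift i x) = 0"
    using x by (intro chain_sum_rel[OF q]) (auto simp: Ker_def)
  moreover have "chain_sum n q (scr_lift i x) = of_int (lookup m' (i, n)) * lookup x m'"
  proof -
    let ?S = "{k. n + 2 * k \<in> keys (scr_lift i x)}"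
    have "chain_sum n q (scr_lift i x) = (\<Sum>k\<in>insert 0 ?S. lookup (lookup (scr_lift i x) (n + 2 * k)) (q k))"
      by (rule chain_sum_superset) (auto simp: finite_chain_index)
    also have "\<dots> = (\<Sum>k\<in>insert 0 ?S. if k = 0 then of_int (lookup m' (i, n)) * lookup x m' else 0)"
    proof (rule sum.cong)
      fix k assume "k \<in> insert 0 ?S"
      have "k \<noteq> 0 \<Longrightarrow> lookup x (q k) = 0" using up[of k] down[of k] by (force simp: in_keys_iff)
      then show "lookup (lookup (scr_lift i x) (n + 2 * k)) (q k) =
          (if k = 0 then of_int (lookup m' (i, n)) * lookup x m' else 0)"
        using q0 by (simp add: lookup_scr_lift lookup_euler)
    qed simp
    also have "\<dots> = of_int (lookup m' (i, n)) * lookup x m'"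
      by (subst sum.delta) (auto simp: finite_chain_index)
    finally show ?thesis .
  qed
  ultimately have "lookup m' (i, n) = 0" using m' by (auto simp: A_def in_keys_iff)
  then show ?thesis using min[OF A(2)] by simp
qed

text \<open>Maximality does not refer to a vertex, so one and the same maximal monomial is
  \<open>i\<close>-dominant for all \<open>i\<close> in \<open>J\<close>. Used with
  \<open>{i}\<close> for a single kernel and with \<open>UNIV\<close> for uniqueness.\<close>

lemma Ker_dom_zero:
  assumes "J \<noteq> {}" "\<And>i. i \<in> J \<Longrightarrow> x \<in> Ker C i" "\<And>m. nonneg_on J m \<Longrightarrow> lookup x m = 0"
  shows "x = 0"
proof (rule ccontr)
  assume "x \<noteq> 0"
  then have "keys x \<noteq> {}" by simp
  then obtain m where m: "m \<in> keys x" "\<And>m'. m' \<in> keys x \<Longrightarrow> \<not> lexgt m' m"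
    by (metis finite_lex_maximal finite_keys)
  then have "nonneg_on J m" using lex_maximal_dom[OF assms(2) m] by (simp add: nonneg_on_def)
  then show False using assms(3) m(1) by (simp add: in_keys_iff)
qed

section \<open>Triangular families and the expansion of kernel elements\<close>

definition lin :: "('d \<Rightarrow> 'i ylaurent) \<Rightarrow> ('d \<Rightarrow>\<^sub>0 complex) \<Rightarrow> 'i ylaurent" where
  "lin E l = (\<Sum>d\<in>keys l. cscale (lookup l d) (E d))"

lemma lookup_lin: "lookup (lin E l) m = (\<Sum>d\<in>keys l. lookup l d * lookup (E d) m)"
  by (simp add: lin_def lookup_sum lookup_cscale)

lemma lin_superset:
  "finite S \<Longrightarrow> keys l \<subseteq> S \<Longrightarrow> lin E l = (\<Sum>d\<in>S. cscale (lookup l d) (E d))"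
  unfolding lin_def
  by (rule sum.mono_neutral_left) (auto simp: in_keys_iff intro!: poly_mapping_eqI simp: lookup_cscale)

lemma lin_add: "lin E (k + l) = lin E k + lin E l"
proof -
  let ?S = "keys k \<union> keys l"
  have "keys (k + l) \<subseteq> ?S" by (rule keys_add)
  then show ?thesis
    using lin_superset[of ?S "k + l" E] lin_superset[of ?S k E] lin_superset[of ?S l E]
    by (auto intro!: poly_mapping_eqI
      simp: lookup_sum lookup_cscale lookup_add distrib_right simp flip: sum.distrib)
qed

lemma lin_single: "lin E (single d c) = cscale c (E d)"
  by (auto simp: lin_def intro!: poly_mapping_eqI simp: lookup_cscale)

lemma lin_Ker: "(\<And>d. d \<in> keys l \<Longrightarrow> E d \<in> Ker C i) \<Longrightarrow> lin E l \<in> Ker C i"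
  unfolding lin_def by (intro Ker_sum Ker_cscale)

lemma keys_lin: "m \<in> keys (lin E l) \<Longrightarrow> \<exists>d\<in>keys l. m \<in> keys (E d)"
  by (rule ccontr) (simp add: in_keys_iff[of m] lookup_lin)

lemma finite_mle_maximal:
  assumes "finite S" "S \<noteq> {}"
  shows "\<exists>m\<in>S. \<forall>m'\<in>S. mle C J m m' \<longrightarrow> m' = m"
proof -
  interpret order "mle C J" "\<lambda>m m'. mle C J m m' \<and> m \<noteq> m'"
    by unfold_locales (auto intro: mle_trans mle_antisym)
  show ?thesis using finite_has_maximal[OF assms] by metis
qed

lemma finite_mle_minimal:
  assumes "finite S" "S \<noteq> {}"
  shows "\<exists>m\<in>S. \<forall>m'\<in>S. mle C J m' m \<longrightarrow> m' = m"
proof -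
  interpret order "mle C J" "\<lambda>m m'. mle C J m m' \<and> m \<noteq> m'"
    by unfold_locales (auto intro: mle_trans mle_antisym)
  show ?thesis using finite_has_minimal[OF assms] by metis
qed

text \<open>The system is unitriangular: at a maximal \<open>q\<close> of \<open>Q\<close> no
  \<open>E d\<close> with another \<open>d\<close> in \<open>Q\<close> contributes, so the
  coefficient of \<open>E q\<close> is \<open>lookup z q\<close>; its multiple is subtracted and
  \<open>Q\<close> shrinks.\<close>

lemma interpolate_triangular:
  assumes "finite Q"
    and "\<And>d. d \<in> Q \<Longrightarrow> lookup (E d) d = 1"
    and "\<And>d p. d \<in> Q \<Longrightarrow> p \<in> keys (E d) \<Longrightarrow> mle C J p d"
  shows "\<exists>l. keys l \<subseteq> Q \<and> (\<forall>d\<in>Q. lookup (lin E l) d = lookup z d)"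
  using assms
proof (induction "card Q" arbitrary: Q z)
  case 0
  then show ?case by (intro exI[of _ 0]) simp
next
  case (Suc n)
  then have "Q \<noteq> {}" by auto
  then obtain q where q: "q \<in> Q" "\<And>m'. m' \<in> Q \<Longrightarrow> mle C J q m' \<Longrightarrow> m' = q"
    using finite_mle_maximal[OF Suc.prems(1), of C J] by blast
  let ?z = "z - cscale (lookup z q) (E q)"
  obtain l where l: "keys l \<subseteq> Q - {q}" "\<forall>d\<in>Q - {q}. lookup (lin E l) d = lookup ?z d"
    using Suc.hyps(1)[of "Q - {q}" ?z] Suc.prems \<open>Suc n = card Q\<close>[symmetric] q(1)
    by (auto simp: card_Diff_singleton)
  have "lookup (lin E l) q = 0"
  proof (rule ccontr)
    assume "lookup (lin E l) q \<noteq> 0"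
    then obtain d where "d \<in> keys l" "q \<in> keys (E d)" using keys_lin by (metis in_keys_iff)
    then show False using q(2) Suc.prems(3) l(1) by blast
  qed
  then have "lookup (lin E (single q (lookup z q) + l)) d = lookup z d" if "d \<in> Q" for d
    using l(2) Suc.prems(2)[OF q(1)] that
    by (cases "d = q") (auto simp: lin_add lin_single lookup_add lookup_cscale lookup_minus)
  moreover have "keys (single q (lookup z q) + l) \<subseteq> Q"
    using keys_add[of "single q (lookup z q)" l] l(1) q(1) by (auto split: if_splits)
  ultimately show ?case by blast
qed

text \<open>A combination that agrees with \<open>z\<close> at all \<open>i\<close>-dominant
  monomials equals \<open>z\<close> by \<open>Ker_dom_zero\<close>.\<close>

lemma Ker_decomposition:
  assumes "z \<in> Ker C i"
  shows "\<exists>l. (\<forall>d\<in>keys l. nonneg_on {i} d \<and> (\<exists>m\<in>keys z. mle C {i} d m)) \<and> z = lin (Lel C i) l"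
proof -
  \<comment> \<open>Contains every \<open>i\<close>-dominant monomial of \<open>z\<close> and, with
    each \<open>d\<close>, those of \<open>Lel C i d\<close>; so agreement on \<open>Q\<close> is
    agreement at all \<open>i\<close>-dominant monomials.\<close>
  define Q where "Q = (\<Union>m\<in>keys z. {d. nonneg_on {i} d \<and> mle C {i} d m})"
  have finQ: "finite Q" by (simp add: Q_def finite_dom_mle)
  have "\<exists>l. keys l \<subseteq> Q \<and> (\<forall>d\<in>Q. lookup (lin (Lel C i) l) d = lookup z d)"
    by (rule interpolate_triangular[OF finQ lookup_Lel]) (rule keys_Lel_mle)
  then obtain l where l: "keys l \<subseteq> Q" "\<forall>d\<in>Q. lookup (lin (Lel C i) l) d = lookup z d" by blast
  let ?y = "z - lin (Lel C i) l"
  have "?y = 0"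
  proof (rule Ker_dom_zero[of "{i}"])
    fix j assume "j \<in> {i}"
    then show "?y \<in> Ker C j"
      using assms l(1) by (auto intro!: Ker_diff lin_Ker Lel_Ker simp: Q_def)
  next
    fix d assume d: "nonneg_on {i} d"
    show "lookup ?y d = 0"
    proof (rule ccontr)
      assume ne: "lookup ?y d \<noteq> 0"
      then have "d \<in> keys z \<or> d \<in> keys (lin (Lel C i) l)" by (auto simp: lookup_minus in_keys_iff)
      then have "d \<in> Q"
      proof
        assume "d \<in> keys (lin (Lel C i) l)"
        then obtain d' where "d' \<in> keys l" "d \<in> keys (Lel C i d')" using keys_lin by blast
        then have "d' \<in> Q" "mle C {i} d d'" using l(1) keys_Lel_mle by auto
        then show ?thesis unfolding Q_def using d mle_trans by blast
      qed (use d mle_refl in \<open>unfold Q_def, blast\<close>)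
      then show False using l(2) ne by (simp add: lookup_minus)
    qed
  qed simp
  then have "z = lin (Lel C i) l" by simp
  then show ?thesis using l(1) unfolding Q_def by blast
qed

lemma lin_Lel_maximal:
  assumes l: "\<And>d. d \<in> keys l \<Longrightarrow> nonneg_on {i} d"
    and d: "d \<in> keys l" "\<And>d'. d' \<in> keys l \<Longrightarrow> mle C {i} d d' \<Longrightarrow> d' = d"
  shows "lookup (lin (Lel C i) l) d = lookup l d"
proof -
  have "lookup (lin (Lel C i) l) d = (\<Sum>e\<in>keys l. if e = d then lookup l d else 0)"
    unfolding lookup_lin
  proof (rule sum.cong)
    fix e assume "e \<in> keys l"
    then show "lookup l e * lookup (Lel C i e) d = (if e = d then lookup l d else 0)"
      using d(2) keys_Lel_mle[of d C i e] by (auto simp: lookup_Lel in_keys_iff)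
  qed simp
  then show ?thesis using d(1) by simp
qed

text \<open>If \<open>w\<close> occurs, it lies below some term of the expansion. A maximal term
  above \<open>w\<close> is not cancelled in \<open>z\<close>, and it differs from \<open>w\<close>,
  which is not \<open>i\<close>-dominant. Thus coefficients at monomials that are not
  \<open>i\<close>-dominant are dictated by those above them.\<close>

lemma Ker_maximal_dom:
  assumes z: "z \<in> Ker C i" and w: "\<And>w'. mle C {i} w w' \<Longrightarrow> w' \<noteq> w \<Longrightarrow> lookup z w' = 0"
    and "\<not> nonneg_on {i} w"
  shows "lookup z w = 0"
proof (rule ccontr)
  assume ne: "lookup z w \<noteq> 0"
  obtain l where l: "\<forall>d\<in>keys l. nonneg_on {i} d" "z = lin (Lel C i) l"
    using Ker_decomposition[OF z] by blast
  define S where "S = {d \<in> keys l. mle C {i} w d}"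
  obtain d0 where "d0 \<in> keys l" "w \<in> keys (Lel C i d0)" using ne keys_lin l(2) by (metis in_keys_iff)
  then have "d0 \<in> S" by (simp add: S_def keys_Lel_mle)
  moreover have "finite S" by (simp add: S_def)
  ultimately obtain d where d: "d \<in> S" "\<And>d'. d' \<in> S \<Longrightarrow> mle C {i} d d' \<Longrightarrow> d' = d"
    using finite_mle_maximal[of S C "{i}"] by blast
  have "lookup z d = lookup l d" unfolding l(2)
    by (rule lin_Lel_maximal) (use l d mle_trans in \<open>unfold S_def, blast+\<close>)
  moreover have "d \<noteq> w" using assms(3) d(1) l(1) by (auto simp: S_def)
  ultimately show False using w[of d] d(1) by (simp add: S_def in_keys_iff)
qed

text \<open>The counterpart of \<open>Lel\<close> for several vertices. It fixes only the top, so
  such elements are in general not unique.\<close>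

definition leading :: "('i::finite \<Rightarrow> 'i \<Rightarrow> int) \<Rightarrow> 'i set \<Rightarrow> 'i ymon \<Rightarrow> 'i ylaurent \<Rightarrow> bool" where
  "leading C J m x \<longleftrightarrow>
     (\<forall>i\<in>J. x \<in> Ker C i) \<and> lookup x m = 1 \<and> (\<forall>p\<in>keys x. mle C J p m)"

lemma leading_mon: "(\<And>i n. i \<in> J \<Longrightarrow> lookup m (i, n) = 0) \<Longrightarrow> leading C J m (mon m)"
  by (auto simp: leading_def Ker_mon) (simp_all add: mon_def)

lemma leading_mult:
  assumes x: "leading C J m x" and y: "leading C J m' y"
  shows "leading C J (m + m') (x * y)"
proof -
  let ?x = "x - mon m"
  have "lookup (?x * y) (m + m') = 0"
  proof (rule ccontr)
    assume "lookup (?x * y) (m + m') \<noteq> 0"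
    then have "m + m' \<in> keys (?x * y)" by (simp add: in_keys_iff)
    then obtain p q where pq: "m + m' = p + q" "p \<in> keys ?x" "q \<in> keys y"
      using keys_mult[of ?x y] by blast
    have "lookup (mon m) m = 1" by (simp add: mon_def)
    then have pm: "p \<noteq> m" using pq(2) x by (auto simp: in_keys_iff lookup_minus leading_def)
    then have "lookup (mon m) p = 0" by (simp add: mon_def lookup_single_not_eq)
    then have "p \<in> keys x" using pq(2) by (simp add: in_keys_iff lookup_minus)
    then have "mle C J p m" "mle C J q m'" using x y pq(3) by (auto simp: leading_def)
    then obtain v w where vw: "m = p + asum C v" "m' = q + asum C w" unfolding mle_def by blast
    have "asum C (v + w) = asum C {#}" using pq(1) vw by (simp add: algebra_simps)
    then have "v + w = {#}" by (rule asum_inj)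
    then show False using vw pm by simp
  qed
  moreover have "x * y = mon m * y + ?x * y" by (simp add: algebra_simps)
  ultimately have "lookup (x * y) (m + m') = 1"
    using y by (simp add: lookup_add lookup_mon_mult leading_def)
  moreover have "mle C J p (m + m')" if p: "p \<in> keys (x * y)" for p
  proof -
    obtain a b where "p = a + b" "a \<in> keys x" "b \<in> keys y" using keys_mult[of x y] p by blast
    then show ?thesis using x y by (auto simp: leading_def intro: mle_add)
  qed
  ultimately show ?thesis using x y by (auto simp: leading_def intro: Ker_mult)
qed

text \<open>Leading elements multiply, and monomials in the variables off \<open>J\<close> lie in
  all kernels concerned, so it is enough to treat single variables.\<close>

lemma leading_exists:
  assumes fund: "\<And>i n. i \<in> J \<Longrightarrow> \<exists>x. leading C J (single (i, n) 1) x"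
    and m: "nonneg_on J m"
  shows "\<exists>x. leading C J m x"
proof -
  define v where "v = Abs_multiset (\<lambda>k. if fst k \<in> J then nat (lookup m k) else 0)"
  have "{k. 0 < (if fst k \<in> J then nat (lookup m k) else 0)} \<subseteq> keys m"
    by (auto simp: in_keys_iff split: if_splits)
  then have "finite {k. 0 < (if fst k \<in> J then nat (lookup m k) else 0)}"
    by (rule finite_subset) simp
  then have cv: "count v k = (if fst k \<in> J then nat (lookup m k) else 0)" for k
    by (simp add: v_def)
  have sum_single: "lookup (\<Sum>k\<in>#w. single k 1) k = int (count w k)" for w :: "('a \<times> int) multiset" and k
    by (induction w) (auto simp: lookup_add lookup_single when_def)
  have ex: "fst ` set_mset w \<subseteq> J \<Longrightarrow> \<exists>x. leading C J (\<Sum>k\<in>#w. single k 1) x" for w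
  proof (induction w)
    case empty
    have "leading C J 0 (mon 0)" by (rule leading_mon) simp
    then show ?case by auto
  next
    case (add k w)
    then obtain x where x: "leading C J (\<Sum>k\<in>#w. single k 1) x" by auto
    moreover obtain y where "leading C J (single k 1) y"
      using fund[of "fst k" "snd k"] add.prems by auto
    ultimately show ?case using leading_mult by fastforce
  qed
  have "fst ` set_mset v \<subseteq> J"
  proof
    fix i assume "i \<in> fst ` set_mset v"
    then obtain k where "k \<in># v" "i = fst k" by blast
    then show "i \<in> J" using cv[of k] by (metis not_in_iff)
  qed
  from ex[OF this] obtain x where x: "leading C J (\<Sum>k\<in>#v. single k 1) x" by blast
  have "leading C J (m - (\<Sum>k\<in>#v. single k 1)) (mon (m - (\<Sum>k\<in>#v. single k 1)))"
    by (rule leading_mon) (use m in \<open>simp add: lookup_minus sum_single cv nonneg_on_def\<close>)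
  from leading_mult[OF this x] show ?thesis by auto
qed

section \<open>Rank two\<close>

text \<open>Polynomials without constant term in the inverses of the A's of \<open>J\<close>, so
  that \<open>1 + r\<close> has leading term 1.\<close>

definition lower :: "('i::finite \<Rightarrow> 'i \<Rightarrow> int) \<Rightarrow> 'i set \<Rightarrow> 'i ylaurent set" where
  "lower C J = {x. \<forall>p\<in>keys x. \<exists>v. fst ` set_mset v \<subseteq> J \<and> v \<noteq> {#} \<and> p = - asum C v}"

lemma lower_aexp: "k \<in> J \<Longrightarrow> mon (- aexp C (k, n)) \<in> lower C J"
  unfolding lower_def mon_def by (auto intro!: exI[of _ "{#(k, n)#}"])

lemma lower_add: "x \<in> lower C J \<Longrightarrow> y \<in> lower C J \<Longrightarrow> x + y \<in> lower C J"
  unfolding lower_def using keys_add[of x y] by blast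

lemma lower_mult:
  assumes "x \<in> lower C J" "y \<in> lower C J"
  shows "x * y \<in> lower C J"
  unfolding lower_def
proof (intro CollectI ballI)
  fix p assume "p \<in> keys (x * y)"
  then obtain a b where "p = a + b" "a \<in> keys x" "b \<in> keys y" using keys_mult[of x y] by blast
  moreover from this assms obtain v w where "fst ` set_mset v \<subseteq> J" "v \<noteq> {#}" "a = - asum C v"
    "fst ` set_mset w \<subseteq> J" "w \<noteq> {#}" "b = - asum C w" unfolding lower_def by blast
  ultimately show "\<exists>v. fst ` set_mset v \<subseteq> J \<and> v \<noteq> {#} \<and> p = - asum C v"
    by (intro exI[of _ "v + w"]) auto
qed

lemma numeral_mult_eq_cscale: "(numeral k :: 'i ylaurent) * x = cscale (numeral k) x"
proof -
  have "(numeral k :: 'i ylaurent) = cscale (numeral k) 1"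
    by (rule poly_mapping_eqI) (simp add: lookup_numeral lookup_cscale lookup_one when_def)
  then show ?thesis by (metis cscale_one_mult)
qed

lemma lower_numeral: "x \<in> lower C J \<Longrightarrow> numeral k * x \<in> lower C J"
  by (auto simp: numeral_mult_eq_cscale lower_def in_keys_iff lookup_cscale)

lemma Ker_numeral: "x \<in> Ker C i \<Longrightarrow> numeral k * x \<in> Ker C i"
  by (simp add: numeral_mult_eq_cscale Ker_cscale)

lemma Ker_uminus: "x \<in> Ker C i \<Longrightarrow> - x \<in> Ker C i"
  using Ker_cscale[of x C i "- 1"] by (simp add: cscale_minus_one)

lemma leading_lower:
  assumes "r \<in> lower C J" "\<And>i. i \<in> J \<Longrightarrow> mon m * (1 + r) \<in> Ker C i"
  shows "leading C J m (mon m * (1 + r))"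
proof -
  have "0 \<notin> keys r"
  proof
    assume "0 \<in> keys r"
    then obtain v where "v \<noteq> {#}" "asum C v = asum C {#}" using assms(1) by (force simp: lower_def)
    then show False using asum_inj by blast
  qed
  then have "lookup (mon m * (1 + r)) m = 1"
    using lookup_mon_mult[of m "1 + r" 0] by (simp add: lookup_add in_keys_iff)
  moreover have "mle C J p m" if "p \<in> keys (mon m * (1 + r))" for p
  proof -
    have "p \<in> (\<lambda>p. m + p) ` keys (1 + r)" using that by (simp only: keys_mon_mult)
    then obtain q where q: "p = m + q" "q \<in> keys (1 + r)" by (rule imageE)
    then have "q = 0 \<or> q \<in> keys r" using keys_add[of 1 r] by auto
    then show ?thesis
    proof
      assume "q \<in> keys r"
      then obtain v where "fst ` set_mset v \<subseteq> J" "q = - asum C v" using assms(1) by (auto simp: lower_def)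
      then show ?thesis using q(1) mle_diff_asum[of v J C m] by simp
    qed (simp add: q(1))
  qed
  ultimately show ?thesis using assms(2) by (auto simp: leading_def)
qed

text \<open>One summand of a candidate: \<open>v\<close> leads from \<open>m\<close> down to the
  monomial at which an element of \<open>Ker_lowering\<close> starts. The premise is a comparison of
  exponents that simplification can do.\<close>

lemma Ker_term:
  assumes "\<And>k. lookup (m - asum C v) (i, k) = int (count ns k)"
  shows "mon m * ((\<Prod>k\<in>#v. mon (- aexp C k)) * lowering C i ns) \<in> Ker C i"
proof -
  have "mon (- asum C v) = (\<Prod>k\<in>#v. mon (- aexp C k))"
  proof (induction v)
    case (add k v)
    have "- asum C (add_mset k v) = - aexp C k + - asum C v" by simp
    then have "mon (- asum C (add_mset k v)) = mon (- aexp C k) * mon (- asum C v)"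
      by (simp only: mon_add)
    then show ?case using add by simp
  qed simp
  then have "mon (m - asum C v) = mon m * (\<Prod>k\<in>#v. mon (- aexp C k))"
    by (metis mon_add diff_conv_add_uminus)
  with Ker_lowering[OF assms] show ?thesis by (simp add: mult.assoc)
qed

lemmas Ker_term_simps = lookup_minus lookup_add lookup_aexp lookup_single when_def of_bool_def

text \<open>Here A_i contains no Y_j, so both monomials of the A_1 formula are annihilated at the
  second vertex.\<close>

lemma fundamental_orthogonal:
  assumes ij: "i \<noteq> j" and C: "C i j = 0" "C j i = 0"
  shows "\<exists>x. leading C {i, j} (single (i, n) 1) x"
proof -
  have "mon (single (i, n) 1) * (1 + mon (- aexp C (i, n + 1))) \<in> Ker C i"
    by (rule Ker_one_step) (simp add: lookup_single when_def)
  moreover have "mon (single (i, n) 1) * (1 + mon (- aexp C (i, n + 1))) \<in> Ker C j"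
    unfolding distrib_left mon_add[symmetric] mult_1_right
    by (rule Ker_add; rule Ker_mon) (use ij C in \<open>simp_all add: lookup_add lookup_minus lookup_single lookup_aexp when_def\<close>)
  ultimately have "leading C {i, j} (single (i, n) 1) (mon (single (i, n) 1) * (1 + mon (- aexp C (i, n + 1))))"
    by (intro leading_lower) (auto intro: lower_aexp)
  then show ?thesis by blast
qed

text \<open>Only the Cartan integers between \<open>s\<close> and \<open>l\<close> matter, as the other variables are units on which both
  screening operators vanish. The polynomials in \<open>U\<close> and \<open>V\<close> are found from the top: as long as the
  coefficient of some \<open>i\<close>-dominant monomial, \<open>i \<in> {s, l}\<close>, is not accounted for in the kernel of \<open>S\<^sub>i\<close>,
  a multiple of its \<open>Lel\<close> is added there.\<close>

lemma fundamental_single_bond_short: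
  assumes sl: "s \<noteq> l" and C: "C l s = - 1" "C s l = - 1"
  shows "\<exists>x. leading C {s, l} (single (s, n) 1) x"
proof -
  define U where "U k = mon (- aexp C (s, n + k))" for k
  define V where "V k = mon (- aexp C (l, n + k))" for k
  let ?r = "(U 1) + (U 1 * V 2)"
  have UV: "U k \<in> lower C {s, l}" "V k \<in> lower C {s, l}" for k
    by (simp_all add: U_def V_def lower_aexp)
  have "?r \<in> lower C {s, l}"
    by (intro lower_add lower_mult lower_numeral UV)
  moreover have "mon (single (s, n) 1) * (1 + ?r) \<in> Ker C s"
  proof -
    have a: "mon (single (s, n) 1) * ((1 + U 1)) \<in> Ker C s"
      using Ker_term[of "single (s, n) 1" C "{#}" s "{#n#}"] sl C
      by (simp add: Ker_term_simps lowering_def U_def V_def ac_simps)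
    have b: "mon (single (s, n) 1) * (U 1 * V 2) \<in> Ker C s"
      using Ker_term[of "single (s, n) 1" C "{#(s, n + 1), (l, n + 2)#}" s "{#}"] sl C
      by (simp add: Ker_term_simps lowering_def U_def V_def ac_simps)
    have "mon (single (s, n) 1) * (1 + ?r) = (mon (single (s, n) 1) * ((1 + U 1))) + (mon (single (s, n) 1) * (U 1 * V 2))"
      by (simp add: algebra_simps)
    also have "\<dots> \<in> Ker C s"
      by (intro Ker_add Ker_numeral Ker_uminus a b)
    finally show ?thesis .
  qed
  moreover have "mon (single (s, n) 1) * (1 + ?r) \<in> Ker C l"
  proof -
    have a: "mon (single (s, n) 1) * (1) \<in> Ker C l"
      using Ker_term[of "single (s, n) 1" C "{#}" l "{#}"] sl C
      by (simp add: Ker_term_simps lowering_def U_def V_def ac_simps)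
    have b: "mon (single (s, n) 1) * (U 1 * (1 + V 2)) \<in> Ker C l"
      using Ker_term[of "single (s, n) 1" C "{#(s, n + 1)#}" l "{#n + 1#}"] sl C
      by (simp add: Ker_term_simps lowering_def U_def V_def ac_simps)
    have "mon (single (s, n) 1) * (1 + ?r) = (mon (single (s, n) 1) * (1)) + (mon (single (s, n) 1) * (U 1 * (1 + V 2)))"
      by (simp add: algebra_simps)
    also have "\<dots> \<in> Ker C l"
      by (intro Ker_add Ker_numeral Ker_uminus a b)
    finally show ?thesis .
  qed
  ultimately have "leading C {s, l} (single (s, n) 1) (mon (single (s, n) 1) * (1 + ?r))"
    by (intro leading_lower) auto
  then show ?thesis by blast
qed

lemma fundamental_single_bond_long:
  assumes sl: "s \<noteq> l" and C: "C l s = - 1" "C s l = - 1"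
  shows "\<exists>x. leading C {s, l} (single (l, n) 1) x"
proof -
  define U where "U k = mon (- aexp C (s, n + k))" for k
  define V where "V k = mon (- aexp C (l, n + k))" for k
  let ?r = "(V 1) + (U 2 * V 1)"
  have UV: "U k \<in> lower C {s, l}" "V k \<in> lower C {s, l}" for k
    by (simp_all add: U_def V_def lower_aexp)
  have "?r \<in> lower C {s, l}"
    by (intro lower_add lower_mult lower_numeral UV)
  moreover have "mon (single (l, n) 1) * (1 + ?r) \<in> Ker C s"
  proof -
    have a: "mon (single (l, n) 1) * (1) \<in> Ker C s"
      using Ker_term[of "single (l, n) 1" C "{#}" s "{#}"] sl C
      by (simp add: Ker_term_simps lowering_def U_def V_def ac_simps)
    have b: "mon (single (l, n) 1) * (V 1 * (1 + U 2)) \<in> Ker C s"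
      using Ker_term[of "single (l, n) 1" C "{#(l, n + 1)#}" s "{#n + 1#}"] sl C
      by (simp add: Ker_term_simps lowering_def U_def V_def ac_simps)
    have "mon (single (l, n) 1) * (1 + ?r) = (mon (single (l, n) 1) * (1)) + (mon (single (l, n) 1) * (V 1 * (1 + U 2)))"
      by (simp add: algebra_simps)
    also have "\<dots> \<in> Ker C s"
      by (intro Ker_add Ker_numeral Ker_uminus a b)
    finally show ?thesis .
  qed
  moreover have "mon (single (l, n) 1) * (1 + ?r) \<in> Ker C l"
  proof -
    have a: "mon (single (l, n) 1) * ((1 + V 1)) \<in> Ker C l"
      using Ker_term[of "single (l, n) 1" C "{#}" l "{#n#}"] sl C
      by (simp add: Ker_term_simps lowering_def U_def V_def ac_simps)
    have b: "mon (single (l, n) 1) * (U 2 * V 1) \<in> Ker C l"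
      using Ker_term[of "single (l, n) 1" C "{#(s, n + 2), (l, n + 1)#}" l "{#}"] sl C
      by (simp add: Ker_term_simps lowering_def U_def V_def ac_simps)
    have "mon (single (l, n) 1) * (1 + ?r) = (mon (single (l, n) 1) * ((1 + V 1))) + (mon (single (l, n) 1) * (U 2 * V 1))"
      by (simp add: algebra_simps)
    also have "\<dots> \<in> Ker C l"
      by (intro Ker_add Ker_numeral Ker_uminus a b)
    finally show ?thesis .
  qed
  ultimately have "leading C {s, l} (single (l, n) 1) (mon (single (l, n) 1) * (1 + ?r))"
    by (intro leading_lower) auto
  then show ?thesis by blast
qed

text \<open>The q-character of the four-dimensional fundamental module of an outer vertex of A_3,
  with both outer vertices identified with \<open>s\<close> and the middle one with
  \<open>l\<close>.\<close>

lemma fundamental_double_bond_short: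
  assumes sl: "s \<noteq> l" and C: "C l s = - 1" "C s l = - 2"
  shows "\<exists>x. leading C {s, l} (single (s, n) 1) x"
proof -
  define U where "U k = mon (- aexp C (s, n + k))" for k
  define V where "V k = mon (- aexp C (l, n + k))" for k
  let ?r = "(U 1) + (U 1 * V 2) + (U 1 * U 3 * V 2)"
  have UV: "U k \<in> lower C {s, l}" "V k \<in> lower C {s, l}" for k
    by (simp_all add: U_def V_def lower_aexp)
  have "?r \<in> lower C {s, l}"
    by (intro lower_add lower_mult lower_numeral UV)
  moreover have "mon (single (s, n) 1) * (1 + ?r) \<in> Ker C s"
  proof -
    have a: "mon (single (s, n) 1) * ((1 + U 1)) \<in> Ker C s"
      using Ker_term[of "single (s, n) 1" C "{#}" s "{#n#}"] sl C
      by (simp add: Ker_term_simps lowering_def U_def V_def ac_simps)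
    have b: "mon (single (s, n) 1) * (U 1 * V 2 * (1 + U 3)) \<in> Ker C s"
      using Ker_term[of "single (s, n) 1" C "{#(s, n + 1), (l, n + 2)#}" s "{#n + 2#}"] sl C
      by (simp add: Ker_term_simps lowering_def U_def V_def ac_simps)
    have "mon (single (s, n) 1) * (1 + ?r) = (mon (single (s, n) 1) * ((1 + U 1))) + (mon (single (s, n) 1) * (U 1 * V 2 * (1 + U 3)))"
      by (simp add: algebra_simps)
    also have "\<dots> \<in> Ker C s"
      by (intro Ker_add Ker_numeral Ker_uminus a b)
    finally show ?thesis .
  qed
  moreover have "mon (single (s, n) 1) * (1 + ?r) \<in> Ker C l"
  proof -
    have a: "mon (single (s, n) 1) * (1) \<in> Ker C l"
      using Ker_term[of "single (s, n) 1" C "{#}" l "{#}"] sl C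
      by (simp add: Ker_term_simps lowering_def U_def V_def ac_simps)
    have b: "mon (single (s, n) 1) * (U 1 * (1 + V 2)) \<in> Ker C l"
      using Ker_term[of "single (s, n) 1" C "{#(s, n + 1)#}" l "{#n + 1#}"] sl C
      by (simp add: Ker_term_simps lowering_def U_def V_def ac_simps)
    have c: "mon (single (s, n) 1) * (U 1 * U 3 * V 2) \<in> Ker C l"
      using Ker_term[of "single (s, n) 1" C "{#(s, n + 1), (s, n + 3), (l, n + 2)#}" l "{#}"] sl C
      by (simp add: Ker_term_simps lowering_def U_def V_def ac_simps)
    have "mon (single (s, n) 1) * (1 + ?r) = (mon (single (s, n) 1) * (1)) + (mon (single (s, n) 1) * (U 1 * (1 + V 2))) + (mon (single (s, n) 1) * (U 1 * U 3 * V 2))"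
      by (simp add: algebra_simps)
    also have "\<dots> \<in> Ker C l"
      by (intro Ker_add Ker_numeral Ker_uminus a b c)
    finally show ?thesis .
  qed
  ultimately have "leading C {s, l} (single (s, n) 1) (mon (single (s, n) 1) * (1 + ?r))"
    by (intro leading_lower) auto
  then show ?thesis by blast
qed

text \<open>The six-dimensional module of the middle vertex of A_3 after the same identification.
  Lowering by \<open>V 1\<close> produces Y_s at level n + 1 with exponent \<open>- C s l\<close> =
  2, hence the square of \<open>1 + U 2\<close> and the coefficient 2.\<close>

lemma fundamental_double_bond_long:
  assumes sl: "s \<noteq> l" and C: "C l s = - 1" "C s l = - 2"
  shows "\<exists>x. leading C {s, l} (single (l, n) 1) x"
proof -
  define U where "U k = mon (- aexp C (s, n + k))" for k
  define V where "V k = mon (- aexp C (l, n + k))" for k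
  let ?r = "(V 1) + 2 * (U 2 * V 1) + (U 2 * U 2 * V 1) + (U 2 * U 2 * V 1 * V 3)"
  have UV: "U k \<in> lower C {s, l}" "V k \<in> lower C {s, l}" for k
    by (simp_all add: U_def V_def lower_aexp)
  have "?r \<in> lower C {s, l}"
    by (intro lower_add lower_mult lower_numeral UV)
  moreover have "mon (single (l, n) 1) * (1 + ?r) \<in> Ker C s"
  proof -
    have a: "mon (single (l, n) 1) * (1) \<in> Ker C s"
      using Ker_term[of "single (l, n) 1" C "{#}" s "{#}"] sl C
      by (simp add: Ker_term_simps lowering_def U_def V_def ac_simps)
    have b: "mon (single (l, n) 1) * (V 1 * (1 + U 2) * (1 + U 2)) \<in> Ker C s"
      using Ker_term[of "single (l, n) 1" C "{#(l, n + 1)#}" s "{#n + 1, n + 1#}"] sl C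
      by (simp add: Ker_term_simps lowering_def U_def V_def ac_simps)
    have c: "mon (single (l, n) 1) * (U 2 * U 2 * V 1 * V 3) \<in> Ker C s"
      using Ker_term[of "single (l, n) 1" C "{#(s, n + 2), (s, n + 2), (l, n + 1), (l, n + 3)#}" s "{#}"] sl C
      by (simp add: Ker_term_simps lowering_def U_def V_def ac_simps)
    have "mon (single (l, n) 1) * (1 + ?r) = (mon (single (l, n) 1) * (1)) + (mon (single (l, n) 1) * (V 1 * (1 + U 2) * (1 + U 2))) + (mon (single (l, n) 1) * (U 2 * U 2 * V 1 * V 3))"
      by (simp add: algebra_simps)
    also have "\<dots> \<in> Ker C s"
      by (intro Ker_add Ker_numeral Ker_uminus a b c)
    finally show ?thesis .
  qed
  moreover have "mon (single (l, n) 1) * (1 + ?r) \<in> Ker C l"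
  proof -
    have a: "mon (single (l, n) 1) * ((1 + V 1)) \<in> Ker C l"
      using Ker_term[of "single (l, n) 1" C "{#}" l "{#n#}"] sl C
      by (simp add: Ker_term_simps lowering_def U_def V_def ac_simps)
    have b: "mon (single (l, n) 1) * (U 2 * V 1) \<in> Ker C l"
      using Ker_term[of "single (l, n) 1" C "{#(s, n + 2), (l, n + 1)#}" l "{#}"] sl C
      by (simp add: Ker_term_simps lowering_def U_def V_def ac_simps)
    have c: "mon (single (l, n) 1) * (U 2 * U 2 * V 1 * (1 + V 3)) \<in> Ker C l"
      using Ker_term[of "single (l, n) 1" C "{#(s, n + 2), (s, n + 2), (l, n + 1)#}" l "{#n + 2#}"] sl C
      by (simp add: Ker_term_simps lowering_def U_def V_def ac_simps)
    have "mon (single (l, n) 1) * (1 + ?r) = (mon (single (l, n) 1) * ((1 + V 1))) + 2 * (mon (single (l, n) 1) * (U 2 * V 1)) + (mon (single (l, n) 1) * (U 2 * U 2 * V 1 * (1 + V 3)))"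
      by (simp add: algebra_simps)
    also have "\<dots> \<in> Ker C l"
      by (intro Ker_add Ker_numeral Ker_uminus a b c)
    finally show ?thesis .
  qed
  ultimately have "leading C {s, l} (single (l, n) 1) (mon (single (l, n) 1) * (1 + ?r))"
    by (intro leading_lower) auto
  then show ?thesis by blast
qed

text \<open>The eight-dimensional module of an outer vertex of D_4, with the three outer vertices
  identified with \<open>s\<close>; the other two outer vertices give the square of
  \<open>1 + U 3\<close>.\<close>

lemma fundamental_triple_bond_short:
  assumes sl: "s \<noteq> l" and C: "C l s = - 1" "C s l = - 3"
  shows "\<exists>x. leading C {s, l} (single (s, n) 1) x"
proof -
  define U where "U k = mon (- aexp C (s, n + k))" for k
  define V where "V k = mon (- aexp C (l, n + k))" for k
  let ?r = "(U 1) + (U 1 * V 2) + 2 * (U 1 * U 3 * V 2) + (U 1 * U 3 * U 3 * V 2) + (U 1 * U 3 * U 3 * V 2 * V 4) + (U 1 * U 3 * U 3 * U 5 * V 2 * V 4)"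
  have UV: "U k \<in> lower C {s, l}" "V k \<in> lower C {s, l}" for k
    by (simp_all add: U_def V_def lower_aexp)
  have "?r \<in> lower C {s, l}"
    by (intro lower_add lower_mult lower_numeral UV)
  moreover have "mon (single (s, n) 1) * (1 + ?r) \<in> Ker C s"
  proof -
    have a: "mon (single (s, n) 1) * ((1 + U 1)) \<in> Ker C s"
      using Ker_term[of "single (s, n) 1" C "{#}" s "{#n#}"] sl C
      by (simp add: Ker_term_simps lowering_def U_def V_def ac_simps)
    have b: "mon (single (s, n) 1) * (U 1 * V 2 * (1 + U 3) * (1 + U 3)) \<in> Ker C s"
      using Ker_term[of "single (s, n) 1" C "{#(s, n + 1), (l, n + 2)#}" s "{#n + 2, n + 2#}"] sl C
      by (simp add: Ker_term_simps lowering_def U_def V_def ac_simps)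
    have c: "mon (single (s, n) 1) * (U 1 * U 3 * U 3 * V 2 * V 4 * (1 + U 5)) \<in> Ker C s"
      using Ker_term[of "single (s, n) 1" C "{#(s, n + 1), (s, n + 3), (s, n + 3), (l, n + 2), (l, n + 4)#}" s "{#n + 4#}"] sl C
      by (simp add: Ker_term_simps lowering_def U_def V_def ac_simps)
    have "mon (single (s, n) 1) * (1 + ?r) = (mon (single (s, n) 1) * ((1 + U 1))) + (mon (single (s, n) 1) * (U 1 * V 2 * (1 + U 3) * (1 + U 3))) + (mon (single (s, n) 1) * (U 1 * U 3 * U 3 * V 2 * V 4 * (1 + U 5)))"
      by (simp add: algebra_simps)
    also have "\<dots> \<in> Ker C s"
      by (intro Ker_add Ker_numeral Ker_uminus a b c)
    finally show ?thesis .
  qed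
  moreover have "mon (single (s, n) 1) * (1 + ?r) \<in> Ker C l"
  proof -
    have a: "mon (single (s, n) 1) * (1) \<in> Ker C l"
      using Ker_term[of "single (s, n) 1" C "{#}" l "{#}"] sl C
      by (simp add: Ker_term_simps lowering_def U_def V_def ac_simps)
    have b: "mon (single (s, n) 1) * (U 1 * (1 + V 2)) \<in> Ker C l"
      using Ker_term[of "single (s, n) 1" C "{#(s, n + 1)#}" l "{#n + 1#}"] sl C
      by (simp add: Ker_term_simps lowering_def U_def V_def ac_simps)
    have c: "mon (single (s, n) 1) * (U 1 * U 3 * V 2) \<in> Ker C l"
      using Ker_term[of "single (s, n) 1" C "{#(s, n + 1), (s, n + 3), (l, n + 2)#}" l "{#}"] sl C
      by (simp add: Ker_term_simps lowering_def U_def V_def ac_simps)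
    have d: "mon (single (s, n) 1) * (U 1 * U 3 * U 3 * V 2 * (1 + V 4)) \<in> Ker C l"
      using Ker_term[of "single (s, n) 1" C "{#(s, n + 1), (s, n + 3), (s, n + 3), (l, n + 2)#}" l "{#n + 3#}"] sl C
      by (simp add: Ker_term_simps lowering_def U_def V_def ac_simps)
    have e: "mon (single (s, n) 1) * (U 1 * U 3 * U 3 * U 5 * V 2 * V 4) \<in> Ker C l"
      using Ker_term[of "single (s, n) 1" C "{#(s, n + 1), (s, n + 3), (s, n + 3), (s, n + 5), (l, n + 2), (l, n + 4)#}" l "{#}"] sl C
      by (simp add: Ker_term_simps lowering_def U_def V_def ac_simps)
    have "mon (single (s, n) 1) * (1 + ?r) = (mon (single (s, n) 1) * (1)) + (mon (single (s, n) 1) * (U 1 * (1 + V 2))) + 2 * (mon (single (s, n) 1) * (U 1 * U 3 * V 2)) + (mon (single (s, n) 1) * (U 1 * U 3 * U 3 * V 2 * (1 + V 4))) + (mon (single (s, n) 1) * (U 1 * U 3 * U 3 * U 5 * V 2 * V 4))"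
      by (simp add: algebra_simps)
    also have "\<dots> \<in> Ker C l"
      by (intro Ker_add Ker_numeral Ker_uminus a b c d e)
    finally show ?thesis .
  qed
  ultimately have "leading C {s, l} (single (s, n) 1) (mon (single (s, n) 1) * (1 + ?r))"
    by (intro leading_lower) auto
  then show ?thesis by blast
qed

text \<open>The module of the middle vertex of D_4 after the same identification. With the leading 1
  the coefficients add up to 29: the 28-dimensional adjoint representation and a trivial
  summand.\<close>

lemma fundamental_triple_bond_long:
  assumes sl: "s \<noteq> l" and C: "C l s = - 1" "C s l = - 3"
  shows "\<exists>x. leading C {s, l} (single (l, n) 1) x"
proof -
  define U where "U k = mon (- aexp C (s, n + k))" for k
  define V where "V k = mon (- aexp C (l, n + k))" for k
  let ?r = "(V 1) + 3 * (U 2 * V 1) + 3 * (U 2 * U 2 * V 1) + (U 2 * U 2 * U 2 * V 1) + 3 * (U 2 * U 2 * V 1 * V 3) + 2 * (U 2 * U 2 * U 2 * V 1 * V 3) + 3 * (U 2 * U 2 * U 4 * V 1 * V 3) + 3 * (U 2 * U 2 * U 2 * U 4 * V 1 * V 3) + (U 2 * U 2 * U 2 * V 1 * V 3 * V 3) + 3 * (U 2 * U 2 * U 2 * U 4 * V 1 * V 3 * V 3) + 3 * (U 2 * U 2 * U 2 * U 4 * U 4 * V 1 * V 3 * V 3) + (U 2 * U 2 * U 2 * U 4 * U 4 * U 4 * V 1 * V 3 * V 3) + (U 2 * U 2 * U 2 * U 4 * U 4 * U 4 * V 1 * V 3 * V 3 * V 5)"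
  have UV: "U k \<in> lower C {s, l}" "V k \<in> lower C {s, l}" for k
    by (simp_all add: U_def V_def lower_aexp)
  have "?r \<in> lower C {s, l}"
    by (intro lower_add lower_mult lower_numeral UV)
  moreover have "mon (single (l, n) 1) * (1 + ?r) \<in> Ker C s"
  proof -
    have a: "mon (single (l, n) 1) * (1) \<in> Ker C s"
      using Ker_term[of "single (l, n) 1" C "{#}" s "{#}"] sl C
      by (simp add: Ker_term_simps lowering_def U_def V_def ac_simps)
    have b: "mon (single (l, n) 1) * (V 1 * (1 + U 2) * (1 + U 2) * (1 + U 2)) \<in> Ker C s"
      using Ker_term[of "single (l, n) 1" C "{#(l, n + 1)#}" s "{#n + 1, n + 1, n + 1#}"] sl C
      by (simp add: Ker_term_simps lowering_def U_def V_def ac_simps)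
    have c: "mon (single (l, n) 1) * (U 2 * U 2 * V 1 * V 3 * (1 + U 4) * (1 + U 2)) \<in> Ker C s"
      using Ker_term[of "single (l, n) 1" C "{#(s, n + 2), (s, n + 2), (l, n + 1), (l, n + 3)#}" s "{#n + 3, n + 1#}"] sl C
      by (simp add: Ker_term_simps lowering_def U_def V_def ac_simps)
    have d: "mon (single (l, n) 1) * (U 2 * U 2 * U 2 * V 1 * V 3) \<in> Ker C s"
      using Ker_term[of "single (l, n) 1" C "{#(s, n + 2), (s, n + 2), (s, n + 2), (l, n + 1), (l, n + 3)#}" s "{#}"] sl C
      by (simp add: Ker_term_simps lowering_def U_def V_def ac_simps)
    have e: "mon (single (l, n) 1) * (U 2 * U 2 * U 2 * V 1 * V 3 * V 3 * (1 + U 4) * (1 + U 4) * (1 + U 4)) \<in> Ker C s"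
      using Ker_term[of "single (l, n) 1" C "{#(s, n + 2), (s, n + 2), (s, n + 2), (l, n + 1), (l, n + 3), (l, n + 3)#}" s "{#n + 3, n + 3, n + 3#}"] sl C
      by (simp add: Ker_term_simps lowering_def U_def V_def ac_simps)
    have f: "mon (single (l, n) 1) * (U 2 * U 2 * U 2 * U 4 * U 4 * U 4 * V 1 * V 3 * V 3 * V 5) \<in> Ker C s"
      using Ker_term[of "single (l, n) 1" C "{#(s, n + 2), (s, n + 2), (s, n + 2), (s, n + 4), (s, n + 4), (s, n + 4), (l, n + 1), (l, n + 3), (l, n + 3), (l, n + 5)#}" s "{#}"] sl C
      by (simp add: Ker_term_simps lowering_def U_def V_def ac_simps)
    \<comment> \<open>Three times the product with \<open>(1 + U 4) * (1 + U 2)\<close> would give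
      \<open>U 2 * U 2 * U 2 * V 1 * V 3\<close> the coefficient 3. The kernel at \<open>l\<close>
      requires 2, from the square of \<open>1 + V 3\<close>; the surplus can be subtracted since
      this monomial contains no Y_s.\<close>
    have "mon (single (l, n) 1) * (1 + ?r) = (mon (single (l, n) 1) * (1)) + (mon (single (l, n) 1) * (V 1 * (1 + U 2) * (1 + U 2) * (1 + U 2))) + 3 * (mon (single (l, n) 1) * (U 2 * U 2 * V 1 * V 3 * (1 + U 4) * (1 + U 2))) + (- (mon (single (l, n) 1) * (U 2 * U 2 * U 2 * V 1 * V 3))) + (mon (single (l, n) 1) * (U 2 * U 2 * U 2 * V 1 * V 3 * V 3 * (1 + U 4) * (1 + U 4) * (1 + U 4))) + (mon (single (l, n) 1) * (U 2 * U 2 * U 2 * U 4 * U 4 * U 4 * V 1 * V 3 * V 3 * V 5))"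
      by (simp add: algebra_simps)
    also have "\<dots> \<in> Ker C s"
      by (intro Ker_add Ker_numeral Ker_uminus a b c d e f)
    finally show ?thesis .
  qed
  moreover have "mon (single (l, n) 1) * (1 + ?r) \<in> Ker C l"
  proof -
    have a: "mon (single (l, n) 1) * ((1 + V 1)) \<in> Ker C l"
      using Ker_term[of "single (l, n) 1" C "{#}" l "{#n#}"] sl C
      by (simp add: Ker_term_simps lowering_def U_def V_def ac_simps)
    have b: "mon (single (l, n) 1) * (U 2 * V 1) \<in> Ker C l"
      using Ker_term[of "single (l, n) 1" C "{#(s, n + 2), (l, n + 1)#}" l "{#}"] sl C
      by (simp add: Ker_term_simps lowering_def U_def V_def ac_simps)
    have c: "mon (single (l, n) 1) * (U 2 * U 2 * V 1 * (1 + V 3)) \<in> Ker C l"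
      using Ker_term[of "single (l, n) 1" C "{#(s, n + 2), (s, n + 2), (l, n + 1)#}" l "{#n + 2#}"] sl C
      by (simp add: Ker_term_simps lowering_def U_def V_def ac_simps)
    have d: "mon (single (l, n) 1) * (U 2 * U 2 * U 2 * V 1 * (1 + V 3) * (1 + V 3)) \<in> Ker C l"
      using Ker_term[of "single (l, n) 1" C "{#(s, n + 2), (s, n + 2), (s, n + 2), (l, n + 1)#}" l "{#n + 2, n + 2#}"] sl C
      by (simp add: Ker_term_simps lowering_def U_def V_def ac_simps)
    have e: "mon (single (l, n) 1) * (U 2 * U 2 * U 4 * V 1 * V 3) \<in> Ker C l"
      using Ker_term[of "single (l, n) 1" C "{#(s, n + 2), (s, n + 2), (s, n + 4), (l, n + 1), (l, n + 3)#}" l "{#}"] sl C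
      by (simp add: Ker_term_simps lowering_def U_def V_def ac_simps)
    have f: "mon (single (l, n) 1) * (U 2 * U 2 * U 2 * U 4 * V 1 * V 3 * (1 + V 3)) \<in> Ker C l"
      using Ker_term[of "single (l, n) 1" C "{#(s, n + 2), (s, n + 2), (s, n + 2), (s, n + 4), (l, n + 1), (l, n + 3)#}" l "{#n + 2#}"] sl C
      by (simp add: Ker_term_simps lowering_def U_def V_def ac_simps)
    have g: "mon (single (l, n) 1) * (U 2 * U 2 * U 2 * U 4 * U 4 * V 1 * V 3 * V 3) \<in> Ker C l"
      using Ker_term[of "single (l, n) 1" C "{#(s, n + 2), (s, n + 2), (s, n + 2), (s, n + 4), (s, n + 4), (l, n + 1), (l, n + 3), (l, n + 3)#}" l "{#}"] sl C
      by (simp add: Ker_term_simps lowering_def U_def V_def ac_simps)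
    have h: "mon (single (l, n) 1) * (U 2 * U 2 * U 2 * U 4 * U 4 * U 4 * V 1 * V 3 * V 3 * (1 + V 5)) \<in> Ker C l"
      using Ker_term[of "single (l, n) 1" C "{#(s, n + 2), (s, n + 2), (s, n + 2), (s, n + 4), (s, n + 4), (s, n + 4), (l, n + 1), (l, n + 3), (l, n + 3)#}" l "{#n + 4#}"] sl C
      by (simp add: Ker_term_simps lowering_def U_def V_def ac_simps)
    have "mon (single (l, n) 1) * (1 + ?r) = (mon (single (l, n) 1) * ((1 + V 1))) + 3 * (mon (single (l, n) 1) * (U 2 * V 1)) + 3 * (mon (single (l, n) 1) * (U 2 * U 2 * V 1 * (1 + V 3))) + (mon (single (l, n) 1) * (U 2 * U 2 * U 2 * V 1 * (1 + V 3) * (1 + V 3))) + 3 * (mon (single (l, n) 1) * (U 2 * U 2 * U 4 * V 1 * V 3)) + 3 * (mon (single (l, n) 1) * (U 2 * U 2 * U 2 * U 4 * V 1 * V 3 * (1 + V 3))) + 3 * (mon (single (l, n) 1) * (U 2 * U 2 * U 2 * U 4 * U 4 * V 1 * V 3 * V 3)) + (mon (single (l, n) 1) * (U 2 * U 2 * U 2 * U 4 * U 4 * U 4 * V 1 * V 3 * V 3 * (1 + V 5)))"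
      by (simp add: algebra_simps)
    also have "\<dots> \<in> Ker C l"
      by (intro Ker_add Ker_numeral Ker_uminus a b c d e f g h)
    finally show ?thesis .
  qed
  ultimately have "leading C {s, l} (single (l, n) 1) (mon (single (l, n) 1) * (1 + ?r))"
    by (intro leading_lower) auto
  then show ?thesis by blast
qed

lemma pos_def_diag:
  fixes B :: "'i::finite \<Rightarrow> 'i \<Rightarrow> real"
  assumes "\<And>k. k \<noteq> (\<lambda>_. 0) \<Longrightarrow> (\<Sum>i\<in>UNIV. \<Sum>j\<in>UNIV. B i j * k i * k j) > 0"
  shows "B i i > 0"
proof -
  define k where "k x = (if x = i then 1 else 0 :: real)" for x
  have "k i \<noteq> 0" by (simp add: k_def)
  then have "k \<noteq> (\<lambda>_. 0)" by metis
  from assms[OF this] show ?thesis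
    by (simp add: k_def if_distrib[of "\<lambda>x. _ * x"] sum.delta cong: if_cong)
qed

text \<open>The interface to Lie theory: \<open>B i j\<close> will be (alpha_i, alpha_j), computed
  from the Killing form.\<close>

locale finite_type =
  fixes C :: "'i::finite \<Rightarrow> 'i \<Rightarrow> int" and B :: "'i \<Rightarrow> 'i \<Rightarrow> real"
  assumes diag: "C i i = 2"
    and offdiag: "i \<noteq> j \<Longrightarrow> C i j \<le> 0"
    and sym: "B i j = B j i"
    and cartan: "of_int (C i j) * B i i = 2 * B i j"
    and pos_def: "k \<noteq> (\<lambda>_. 0) \<Longrightarrow> (\<Sum>i\<in>UNIV. \<Sum>j\<in>UNIV. B i j * k i * k j) > 0"
begin

lemma form_two_point:
  assumes "i \<noteq> j"
  shows "(\<Sum>x\<in>UNIV. \<Sum>y\<in>UNIV. B x y * (if x = i then a else if x = j then b else 0) *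
      (if y = i then a else if y = j then b else 0)) = B i i * a * a + 2 * B i j * a * b + B j j * b * b"
proof -
  define k where "k x = (if x = i then a else if x = j then b else 0)" for x
  have s: "(\<Sum>y\<in>UNIV. f y * k y) = f i * a + f j * b" for f
  proof -
    have "(\<Sum>y\<in>UNIV. f y * k y) = (\<Sum>y\<in>{i, j}. f y * k y)"
      by (rule sum.mono_neutral_right) (auto simp: k_def)
    then show ?thesis using assms by (simp add: k_def)
  qed
  have "(\<Sum>x\<in>UNIV. \<Sum>y\<in>UNIV. B x y * k x * k y) = (\<Sum>x\<in>UNIV. (B x i * a + B x j * b) * k x)"
    by (intro sum.cong refl) (subst s, simp add: algebra_simps)
  also have "\<dots> = B i i * a * a + 2 * B i j * a * b + B j j * b * b"
    unfolding s using sym[of j i] by (simp add: algebra_simps)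
  finally show ?thesis by (simp add: k_def)
qed

lemma B_pos: "B i i > 0"
  using pos_def by (rule pos_def_diag)

lemma cartan_product:
  assumes "i \<noteq> j"
  shows "C i j * C j i < 4"
proof -
  \<comment> \<open>A multiple of the component of alpha_i orthogonal to alpha_j; its squared length
    is \<open>B j j\<close> times a 2x2 Gram determinant.\<close>
  define k where "k x = (if x = i then B j j else if x = j then - B i j else 0)" for x
  have "k i \<noteq> 0" using B_pos[of j] by (simp add: k_def)
  then have "k \<noteq> (\<lambda>_. 0)" by metis
  from pos_def[OF this]
  have "0 < B j j * (B i i * B j j - B i j * B i j)"
    unfolding k_def form_two_point[OF assms] by (simp add: algebra_simps)
  then have 1: "B i j * B i j < B i i * B j j" using B_pos[of j] by (simp add: zero_less_mult_iff)
  have "real_of_int (C i j * C j i) * (B i i * B j j) = (C i j * B i i) * (C j i * B j j)"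
    by (simp add: algebra_simps)
  also have "\<dots> = 4 * (B i j * B i j)" by (simp add: cartan sym[of j i])
  also have "\<dots> < 4 * (B i i * B j j)" using 1 by simp
  finally have "real_of_int (C i j * C j i) < 4"
    using B_pos[of i] B_pos[of j] by (simp add: mult_less_cancel_right_pos)
  then show ?thesis by linarith
qed

lemma cartan_zero: "C i j = 0 \<Longrightarrow> C j i = 0"
  using cartan[of i j] cartan[of j i] sym[of i j] B_pos[of j] by simp

lemma fundamental_rank_two:
  assumes "i \<noteq> j" "k \<in> {i, j}"
  shows "\<exists>x. leading C {i, j} (single (k, n) 1) x"
proof -
  have cases: "(C i j = 0 \<and> C j i = 0) \<or> (C i j = - 1 \<and> C j i = - 1) \<or> (C i j = - 1 \<and> C j i = - 2) \<or>
      (C i j = - 2 \<and> C j i = - 1) \<or> (C i j = - 1 \<and> C j i = - 3) \<or> (C i j = - 3 \<and> C j i = - 1)"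
  proof (cases "C i j = 0 \<or> C j i = 0")
    case True
    then show ?thesis using cartan_zero by blast
  next
    case False
    define a b where "a = - C i j" and "b = - C j i"
    have ab: "a \<ge> 1" "b \<ge> 1" "a * b < 4"
      using False offdiag[of i j] offdiag[of j i] cartan_product assms(1) by (auto simp: a_def b_def)
    have "a < 4" using mult_left_mono[of 1 b a] ab by linarith
    moreover have "b < 4" using mult_right_mono[of 1 a b] ab by linarith
    ultimately have "a \<in> {1, 2, 3}" "b \<in> {1, 2, 3}" using ab by auto
    then have "(a = 1 \<and> b = 1) \<or> (a = 1 \<and> b = 2) \<or> (a = 2 \<and> b = 1) \<or> (a = 1 \<and> b = 3) \<or> (a = 3 \<and> b = 1)"
      using ab(3) by auto
    then show ?thesis by (auto simp: a_def b_def)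
  qed
  have comm: "{i, j} = {j, i}" by auto
  have ji: "j \<noteq> i" using assms(1) by simp
  note short = fundamental_single_bond_short fundamental_double_bond_short fundamental_triple_bond_short
  note long = fundamental_single_bond_long fundamental_double_bond_long fundamental_triple_bond_long
  have "\<exists>x. leading C {i, j} (single (i, n) 1) x"
    using cases short[OF assms(1), of C n] long[OF ji, of C n] fundamental_orthogonal[OF assms(1), of C n]
    unfolding comm[symmetric] by (elim disjE conjE) simp_all
  moreover have "\<exists>x. leading C {i, j} (single (j, n) 1) x"
    using cases short[OF ji, of C n] long[OF assms(1), of C n] fundamental_orthogonal[OF ji, of C n]
    unfolding comm[symmetric] by (elim disjE conjE) simp_all
  ultimately show ?thesis using assms(2) by blast
qed

end

text \<open>Two elements of the kernels of \<open>S\<^sub>i\<close> and \<open>S\<^sub>j\<close> that agree above \<open>m\<close> agree there with one element of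
  both kernels, a combination of the rank two elements.\<close>

lemma (in finite_type) Ker_pair_agree:
  fixes m0 :: "'i ymon"
  defines "P \<equiv> {p. mle C UNIV p m0}"
  assumes ij: "i \<noteq> j" and y: "yi \<in> Ker C i" "yj \<in> Ker C j" "keys yi \<subseteq> P" "keys yj \<subseteq> P"
    and U: "finite U" "U \<subseteq> P" "\<And>p q. p \<in> U \<Longrightarrow> q \<in> P \<Longrightarrow> mle C UNIV p q \<Longrightarrow> q \<in> U"
    and agree: "\<And>p. p \<in> U \<Longrightarrow> lookup yi p = lookup yj p"
    and m: "m \<in> P" "\<And>p. p \<in> P \<Longrightarrow> mle C UNIV m p \<Longrightarrow> p \<noteq> m \<Longrightarrow> p \<in> U"
    and nd: "\<not> nonneg_on {i} m" "\<not> nonneg_on {j} m"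
  shows "lookup yi m = lookup yj m"
proof -
  define E where "E d = (SOME x. leading C {i, j} d x)" for d
  have E: "leading C {i, j} d (E d)" if "nonneg_on {i, j} d" for d
    unfolding E_def
    by (rule someI_ex, rule leading_exists[OF _ that]) (rule fundamental_rank_two[OF ij])
  define Q where "Q = {d \<in> U. nonneg_on {i, j} d}"
  have "\<exists>l. keys l \<subseteq> Q \<and> (\<forall>d\<in>Q. lookup (lin E l) d = lookup yi d)"
    by (rule interpolate_triangular[where C = C and J = "{i, j}"])
      (use E U(1) in \<open>auto simp: Q_def leading_def\<close>)
  then obtain l where l: "keys l \<subseteq> Q" "\<forall>d\<in>Q. lookup (lin E l) d = lookup yi d" by blast
  define y where "y = lin E l"
  have yK: "y \<in> Ker C i" "y \<in> Ker C j"
    unfolding y_def using E l(1) by (auto intro!: lin_Ker simp: Q_def leading_def)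
  have yP: "keys y \<subseteq> P"
  proof
    fix p assume "p \<in> keys y"
    then obtain d where "d \<in> keys l" "p \<in> keys (E d)" unfolding y_def using keys_lin by blast
    then have "d \<in> P" "mle C {i, j} p d" using l(1) U(2) E by (auto simp: Q_def leading_def)
    then show "p \<in> P" unfolding P_def using mle_trans mle_mono by blast
  qed
  \<comment> \<open>A maximal disagreement inside \<open>U\<close> is not in \<open>Q\<close>, so it
    fails to be dominant at \<open>i\<close> or \<open>j\<close>, and \<open>Ker_maximal_dom\<close>
    restores agreement with \<open>yi\<close> or \<open>yj\<close>, which coincide on
    \<open>U\<close>. At \<open>m\<close> itself both vertices apply.\<close>
  define S where "S = {w \<in> insert m U. lookup y w \<noteq> lookup yi w \<or> lookup y w \<noteq> lookup yj w}"
  have "S = {}"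
  proof (rule ccontr)
    assume "S \<noteq> {}"
    moreover have "finite S" using U(1) by (simp add: S_def)
    ultimately obtain w where w: "w \<in> S" "\<And>w'. w' \<in> S \<Longrightarrow> mle C UNIV w w' \<Longrightarrow> w' = w"
      using finite_mle_maximal[of S C UNIV] by blast
    have wP: "w \<in> P" using w(1) m(1) U(2) by (auto simp: S_def)
    have above: "lookup y p = lookup yi p \<and> lookup y p = lookup yj p"
      if "mle C {k} w p" "p \<noteq> w" for p k
    proof (cases "p \<in> P")
      case True
      have "mle C UNIV w p" using that(1) mle_mono by blast
      moreover from this have "p \<in> U"
        using w(1) True m(2)[OF True] U(3)[OF _ True] that(2) by (auto simp: S_def)
      moreover from calculation have "p \<notin> S" using w(2)[of p] that(2) by blast
      ultimately show ?thesis unfolding S_def by blast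
    next
      case False
      then have "p \<notin> keys y" "p \<notin> keys yi" "p \<notin> keys yj" using yP y by blast+
      then show ?thesis by (simp add: in_keys_iff)
    qed
    have i: "lookup y w = lookup yi w" if "\<not> nonneg_on {i} w"
    proof -
      have "lookup (y - yi) w = 0"
        by (rule Ker_maximal_dom[OF Ker_diff[OF yK(1) y(1)] _ that])
          (simp add: lookup_minus, metis above)
      then show ?thesis by (simp add: lookup_minus)
    qed
    have j: "lookup y w = lookup yj w" if "\<not> nonneg_on {j} w"
    proof -
      have "lookup (y - yj) w = 0"
        by (rule Ker_maximal_dom[OF Ker_diff[OF yK(2) y(2)] _ that])
          (simp add: lookup_minus, metis above)
      then show ?thesis by (simp add: lookup_minus)
    qed
    show False
    proof (cases "w \<in> U")
      case True
      then have "w \<in> Q \<Longrightarrow> False" using l(2) agree[OF True] w(1) by (simp add: S_def y_def)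
      then have "\<not> nonneg_on {i} w \<or> \<not> nonneg_on {j} w" using True by (auto simp: Q_def nonneg_on_def)
      then show False using i j agree[OF True] w(1) by (auto simp: S_def)
    next
      case False
      then have "w = m" using w(1) by (auto simp: S_def)
      then show False using i j nd w(1) by (auto simp: S_def)
    qed
  qed
  then show ?thesis by (auto simp: S_def)
qed

text \<open>A minimal monomial \<open>m\<close> is added to \<open>U\<close>: where \<open>m\<close> is \<open>i\<close>-dominant, a multiple of \<open>Lel C i m\<close> corrects the
  value at \<open>m\<close>, and the remaining \<open>i\<close> agree on it by the previous lemma.\<close>

lemma (in finite_type) partial_solution:
  fixes m0 :: "'i ymon"
  defines "P \<equiv> {p. mle C UNIV p m0}"
  assumes "finite U" "U \<subseteq> P" "\<And>p q. p \<in> U \<Longrightarrow> q \<in> P \<Longrightarrow> mle C UNIV p q \<Longrightarrow> q \<in> U"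
    and m0: "dominant m0"
  shows "\<exists>c y. (\<forall>m\<in>U. dominant m \<longrightarrow> c m = (if m = m0 then 1 else 0)) \<and>
     (\<forall>i. y i \<in> Ker C i \<and> keys (y i) \<subseteq> P \<and> (\<forall>m\<in>U. lookup (y i) m = c m))"
  using assms(2-4)
proof (induction "card U" arbitrary: U)
  case 0
  then show ?case by (intro exI[of _ "\<lambda>_. 0"]) simp
next
  case (Suc n)
  have "U \<noteq> {}" using Suc.hyps(2) by auto
  then obtain m where m: "m \<in> U" "\<And>m'. m' \<in> U \<Longrightarrow> mle C UNIV m' m \<Longrightarrow> m' = m"
    using finite_mle_minimal[OF Suc.prems(1), of C UNIV] by blast
  define U' where "U' = U - {m}"
  have U': "finite U'" "U' \<subseteq> P" "n = card U'"
    using Suc.prems Suc.hyps(2) m(1) by (auto simp: U'_def card_Diff_singleton)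
  have up: "q \<in> U'" if "p \<in> U'" "q \<in> P" "mle C UNIV p q" for p q
    using Suc.prems(3)[of p q] that m by (auto simp: U'_def)
  obtain c y where c: "\<And>p. p \<in> U' \<Longrightarrow> dominant p \<Longrightarrow> c p = (if p = m0 then 1 else 0)"
    and y: "\<And>i. y i \<in> Ker C i" "\<And>i. keys (y i) \<subseteq> P" "\<And>i p. p \<in> U' \<Longrightarrow> lookup (y i) p = c p"
  proof -
    have "\<exists>c y. (\<forall>m\<in>U'. dominant m \<longrightarrow> c m = (if m = m0 then 1 else 0)) \<and>
       (\<forall>i. y i \<in> Ker C i \<and> keys (y i) \<subseteq> P \<and> (\<forall>m\<in>U'. lookup (y i) m = c m))"
      by (rule Suc.hyps(1)[OF U'(3,1,2)]) (rule up)
    then show ?thesis using that by blast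
  qed
  have mP: "m \<in> P" using m(1) Suc.prems(2) by blast
  have eqm: "lookup (y i) m = lookup (y j) m" if "\<not> nonneg_on {i} m" "\<not> nonneg_on {j} m" for i j
  proof (cases "i = j")
    case False
    show ?thesis
    proof (rule Ker_pair_agree[OF False y(1) y(1), of m0 U'])
      show "p \<in> U'" if "p \<in> {p. mle C UNIV p m0}" "mle C UNIV m p" "p \<noteq> m" for p
        using Suc.prems(3)[OF m(1), of p] that by (simp add: P_def U'_def)
    qed (use y U' up mP that in \<open>simp_all add: P_def\<close>)
  qed simp
  \<comment> \<open>A dominant \<open>m\<close> gets the prescribed value. Otherwise any vertex at
    which \<open>m\<close> is not dominant decides; by \<open>eqm\<close> all of them give the same
    value.\<close>
  define t where "t = (if dominant m then (if m = m0 then 1 else 0)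
    else lookup (y (SOME i. \<not> nonneg_on {i} m)) m)"
  have t: "lookup (y i) m = t" if "\<not> nonneg_on {i} m" for i
  proof -
    have "\<not> dominant m" using that by (auto simp: nonneg_on_def dominant_def)
    moreover have "\<not> nonneg_on {SOME i. \<not> nonneg_on {i} m} m" using that by (rule someI)
    ultimately show ?thesis unfolding t_def using eqm[OF that] by simp
  qed
  define y' where "y' i = (if nonneg_on {i} m then y i + cscale (t - lookup (y i) m) (Lel C i m) else y i)" for i
  \<comment> \<open>\<open>Lel C i m\<close> lives below \<open>m\<close>, which is minimal in
    \<open>U\<close>, so the correction leaves the values on \<open>U'\<close> alone.\<close>
  have Lzero: "lookup (Lel C i m) p = 0" if "p \<in> U'" for i p
  proof (rule ccontr)
    assume "lookup (Lel C i m) p \<noteq> 0"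
    then have "mle C {i} p m" by (simp add: in_keys_iff keys_Lel_mle)
    then have "mle C UNIV p m" using mle_mono by blast
    then show False using m(2)[of p] that by (simp add: U'_def)
  qed
  have "y' i \<in> Ker C i" for i
    using y(1) by (auto simp: y'_def intro: Ker_add Ker_cscale Lel_Ker)
  moreover have "keys (y' i) \<subseteq> P" for i
  proof
    fix p assume "p \<in> keys (y' i)"
    then have "p \<in> keys (y i) \<or> p \<in> keys (Lel C i m)"
      by (auto simp: y'_def in_keys_iff lookup_add lookup_cscale split: if_splits)
    then show "p \<in> P"
    proof
      assume "p \<in> keys (Lel C i m)"
      then have "mle C UNIV p m" using keys_Lel_mle mle_mono by blast
      then show ?thesis using mP mle_trans unfolding P_def by blast
    qed (use y(2) in blast)
  qed
  moreover have "lookup (y' i) p = (c(m := t)) p" if "p \<in> U" for i p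
  proof (cases "p = m")
    case True
    then show ?thesis using t[of i] by (simp add: y'_def lookup_add lookup_cscale lookup_Lel)
  next
    case False
    then have "p \<in> U'" using that by (simp add: U'_def)
    then show ?thesis using False y(3) Lzero by (simp add: y'_def lookup_add lookup_cscale)
  qed
  moreover have "(c(m := t)) p = (if p = m0 then 1 else 0)" if "p \<in> U" "dominant p" for p
    using that c[of p] by (auto simp: t_def U'_def)
  ultimately show ?case by blast
qed

section \<open>Finiteness\<close>

text \<open>Forgets the levels: the coefficient of the \<open>i\<close>-th fundamental weight in the
  weight of \<open>m\<close>.\<close>

definition weight :: "'i \<Rightarrow> 'i ymon \<Rightarrow> int" where
  "weight i m = (\<Sum>k\<in>keys m. if fst k = i then lookup m k else 0)"

lemma weight_superset:
  "finite S \<Longrightarrow> keys m \<subseteq> S \<Longrightarrow> weight i m = (\<Sum>k\<in>S. if fst k = i then lookup m k else 0)"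
  unfolding weight_def by (rule sum.mono_neutral_left) (auto simp: in_keys_iff)

lemma weight_zero [simp]: "weight i 0 = 0"
  by (simp add: weight_def)

lemma weight_add: "weight i (m + m') = weight i m + weight i m'"
proof -
  let ?S = "keys m \<union> keys m'"
  have "keys (m + m') \<subseteq> ?S" by (rule keys_add)
  then show ?thesis
    using weight_superset[of ?S "m + m'" i] weight_superset[of ?S m i] weight_superset[of ?S m' i]
    by (auto simp: lookup_add intro!: sum.cong simp flip: sum.distrib)
qed

lemma weight_diff: "weight i (m - m') = weight i m - weight i m'"
  using weight_add[of i "m - m'" m'] by simp

lemma weight_sum: "weight i (\<Sum>j\<in>S. f j) = (\<Sum>j\<in>S. weight i (f j))"
  by (induction S rule: infinite_finite_induct) (simp_all add: weight_add)

lemma weight_single: "weight i (single k c) = (if fst k = i then c else 0)"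
  by (simp add: weight_def)

lemma weight_nonneg: "nonneg_on {i} m \<Longrightarrow> weight i m \<ge> 0"
  unfolding weight_def by (rule sum_nonneg) (auto simp: nonneg_on_def)

text \<open>An \<open>i\<close>-dominant \<open>m\<close> has \<open>weight i m\<close> factors Y_i
  to lower, so the monomials of \<open>Lel C i m\<close> do not pass the reflection of its weight in
  alpha_i.\<close>

lemma size_le_weight:
  assumes "nonneg_on {i} m" "w \<subseteq># levels i m"
  shows "int (size w) \<le> weight i m"
proof -
  have l: "lookup (\<Sum>n\<in>#w. single (i, n) 1) (i, n) = int (count w n)" for w :: "int multiset" and n
    by (induction w) (auto simp: lookup_add lookup_single when_def)
  have s: "weight i (\<Sum>n\<in>#w. single (i, n) 1) = int (size w)" for w :: "int multiset"
    by (induction w) (simp_all add: weight_add weight_single)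
  have "nonneg_on {i} (m - (\<Sum>n\<in>#w. single (i, n) 1))"
  proof -
    have "int (count w n) \<le> lookup m (i, n)" for n
    proof -
      have "0 \<le> lookup m (i, n)" using assms(1) by (simp add: nonneg_on_def)
      moreover have "count w n \<le> nat (lookup m (i, n))"
        using mset_subset_eq_count[OF assms(2), of n] by (simp add: count_levels)
      ultimately show ?thesis by linarith
    qed
    then show ?thesis by (simp add: nonneg_on_def lookup_minus l)
  qed
  from weight_nonneg[OF this] show ?thesis by (simp add: weight_diff s)
qed

text \<open>The coefficient of alpha_i in the sum of simple roots that belongs to \<open>v\<close>;
  real, to enter the quadratic form.\<close>

definition color_count :: "('i \<times> int) multiset \<Rightarrow> 'i \<Rightarrow> real" where
  "color_count v i = real (size (filter_mset (\<lambda>k. fst k = i) v))"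

lemma color_count_simps [simp]:
  "color_count {#} i = 0"
  "color_count (add_mset k v) i = (if fst k = i then 1 else 0) + color_count v i"
  "color_count (v + w) i = color_count v i + color_count w i"
  by (simp_all add: color_count_def)

lemma color_count_image: "color_count (image_mset (\<lambda>n. (i, f n)) w) j = (if j = i then real (size w) else 0)"
  by (induction w) auto

lemma sum_color_count: "(\<Sum>i\<in>UNIV. color_count v i) = real (size (v :: ('i::finite \<times> int) multiset))"
  by (induction v) (simp_all add: sum.distrib)

lemma color_count_nonneg: "color_count v i \<ge> 0"
  by (simp add: color_count_def)

context finite_type
begin

text \<open>A_j(n) has weight alpha_j, whose coordinates in the fundamental weights form a column of
  \<open>C\<close>.\<close>

lemma weight_asum: "real_of_int (weight i (asum C v)) = (\<Sum>j\<in>UNIV. C i j * color_count v j)"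
proof (induction v)
  case (add k v)
  have "weight i (aexp C k) = (if fst k = i then 2 else 0) + (\<Sum>j\<in>UNIV - {fst k}. if j = i then C j (fst k) else 0)"
    by (simp add: aexp_def weight_add weight_single weight_sum)
  also have "\<dots> = C i (fst k)"
    using diag[of i] by (cases "fst k = i") (simp_all add: sum.delta)
  finally show ?case
    using add by (simp add: weight_add distrib_left sum.distrib if_distrib[of "\<lambda>x. _ * x"] sum.delta' cong: if_cong)
qed simp

text \<open>With \<open>\<lambda>\<close> the weight of \<open>m0\<close> and \<open>\<beta>\<close> the sum of simple roots that belongs to \<open>v\<close>, this is
  \<open>|\<lambda> - \<beta>|\<^sup>2 - |\<lambda>|\<^sup>2\<close>.\<close>

definition excess :: "'i ymon \<Rightarrow> ('i \<times> int) multiset \<Rightarrow> real" where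
  "excess m0 v = (\<Sum>i\<in>UNIV. \<Sum>j\<in>UNIV. B i j * color_count v i * color_count v j) -
     (\<Sum>i\<in>UNIV. B i i * weight i m0 * color_count v i)"

text \<open>With mu the weight of \<open>m0 - asum C v\<close> and c the size of \<open>w\<close>,
  the change is \<open>B i i\<close> c (c - <mu, alpha_i^vee>), where 0 <= c <= <mu,
  alpha_i^vee>.\<close>

lemma excess_lowering:
  assumes "int (size w) \<le> weight i (m0 - asum C v)"
  shows "excess m0 (v + image_mset (\<lambda>n. (i, n + 1)) w) \<le> excess m0 v"
proof -
  define k where "k = color_count v"
  define c where "c = real (size w)"
  define e where "e j = (if j = i then c else 0)" for j
  have cc: "color_count (v + image_mset (\<lambda>n. (i, n + 1)) w) j = k j + e j" for j
    by (simp add: color_count_image k_def e_def c_def)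
  have e: "(\<Sum>j\<in>UNIV. f j * e j) = f i * c" for f
    by (simp add: e_def if_distrib[of "\<lambda>x. _ * x"] sum.delta cong: if_cong)
  have "(\<Sum>x\<in>UNIV. \<Sum>y\<in>UNIV. B x y * (k x + e x) * (k y + e y)) =
      (\<Sum>x\<in>UNIV. (\<Sum>y\<in>UNIV. B x y * k x * k y) + (\<Sum>y\<in>UNIV. B x y * k y) * e x
        + (\<Sum>y\<in>UNIV. B x y * k x * e y) + (\<Sum>y\<in>UNIV. B x y * e x * e y))"
    by (simp add: algebra_simps sum.distrib sum_distrib_left sum_distrib_right)
  also have "\<dots> = (\<Sum>x\<in>UNIV. \<Sum>y\<in>UNIV. B x y * k x * k y) + (\<Sum>y\<in>UNIV. B i y * k y) * c
      + (\<Sum>x\<in>UNIV. B x i * k x * c) + B i i * c * c"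
    unfolding e sum.distrib
    by (simp only: e mult.commute[of "_ * e _"] mult.assoc[symmetric])
      (simp add: e mult.assoc mult.left_commute[of _ "e _"] algebra_simps)
  also have "(\<Sum>x\<in>UNIV. B x i * k x * c) = (\<Sum>y\<in>UNIV. B i y * k y) * c"
    by (simp add: sum_distrib_right sym[of _ i])
  finally have 1: "(\<Sum>x\<in>UNIV. \<Sum>y\<in>UNIV. B x y * (k x + e x) * (k y + e y)) =
     (\<Sum>x\<in>UNIV. \<Sum>y\<in>UNIV. B x y * k x * k y) + 2 * (\<Sum>y\<in>UNIV. B i y * k y) * c + B i i * c * c"
    by simp
  have 2: "(\<Sum>x\<in>UNIV. B x x * weight x m0 * (k x + e x)) =
     (\<Sum>x\<in>UNIV. B x x * weight x m0 * k x) + B i i * weight i m0 * c"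
    by (simp add: distrib_left sum.distrib e)
  have "2 * (\<Sum>y\<in>UNIV. B i y * k y) = (\<Sum>y\<in>UNIV. (C i y * B i i) * k y)"
    unfolding cartan by (simp add: sum_distrib_left mult.assoc)
  also have "\<dots> = B i i * weight i (asum C v)"
    by (simp add: weight_asum k_def sum_distrib_left algebra_simps)
  finally have 3: "2 * (\<Sum>y\<in>UNIV. B i y * k y) = B i i * weight i (asum C v)" .
  have "excess m0 (v + image_mset (\<lambda>n. (i, n + 1)) w) - excess m0 v =
      B i i * weight i (asum C v) * c + B i i * c * c - B i i * weight i m0 * c"
    unfolding excess_def cc 1 2 3 by (simp add: k_def)
  also have "\<dots> = (B i i * c) * (c - (weight i m0 - weight i (asum C v)))"
    by (simp add: algebra_simps)
  also have "\<dots> \<le> 0"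
  proof (rule mult_nonneg_nonpos)
    show "0 \<le> B i i * c" using B_pos[of i] by (simp add: c_def)
    have "real_of_int (int (size w)) \<le> real_of_int (weight i m0 - weight i (asum C v))"
      using assms unfolding weight_diff by (rule of_int_le_iff[THEN iffD2])
    then show "c - real_of_int (weight i m0 - weight i (asum C v)) \<le> 0" by (simp add: c_def)
  qed
  finally show ?thesis by simp
qed

text \<open>The form attains a positive minimum on the compact unit sphere; homogeneity does the
  rest.\<close>

lemma form_lower_bound: "\<exists>e>0. \<forall>k. (\<Sum>i\<in>UNIV. \<Sum>j\<in>UNIV. B i j * k i * k j) \<ge> e * (\<Sum>i\<in>UNIV. (k i)\<^sup>2)"
proof -
  define f where "f x = (\<Sum>i\<in>UNIV. \<Sum>j\<in>UNIV. B i j * x $ i * x $ j)" for x :: "real ^ 'i"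
  have "\<exists>x\<in>sphere (0 :: real ^ 'i) 1. \<forall>y\<in>sphere 0 1. f x \<le> f y"
    by (rule continuous_attains_inf) (auto simp: f_def intro!: continuous_intros)
  then obtain x0 :: "real ^ 'i" where x0: "norm x0 = 1" "\<And>y. norm y = 1 \<Longrightarrow> f x0 \<le> f y" by auto
  have pos: "f x > 0" if "x \<noteq> 0" for x
  proof -
    have "(\<lambda>i. x $ i) \<noteq> (\<lambda>_. 0)" using that by (auto simp: vec_eq_iff fun_eq_iff)
    from pos_def[OF this] show ?thesis by (simp add: f_def)
  qed
  have "f x0 * (\<Sum>i\<in>UNIV. (k i)\<^sup>2) \<le> (\<Sum>i\<in>UNIV. \<Sum>j\<in>UNIV. B i j * k i * k j)" for k
  proof -
    define x where "x = (\<chi> i. k i)"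
    have n: "(norm x)\<^sup>2 = (\<Sum>i\<in>UNIV. (k i)\<^sup>2)"
      unfolding power2_norm_eq_inner inner_vec_def by (simp add: x_def power2_eq_square)
    have "f x0 * (norm x)\<^sup>2 \<le> f x"
    proof (cases "x = 0")
      case False
      define y where "y = (1 / norm x) *\<^sub>R x"
      have "f x0 \<le> f y" using False by (intro x0(2)) (simp add: y_def)
      moreover have "f y = f x / (norm x)\<^sup>2"
        by (simp add: f_def y_def sum_divide_distrib power2_eq_square)
      ultimately show ?thesis using False by (simp add: field_simps)
    qed (simp add: f_def)
    then show ?thesis unfolding n by (simp add: f_def x_def)
  qed
  moreover have "f x0 > 0" using x0(1) by (intro pos) auto
  ultimately show ?thesis by blast
qed

text \<open>The quadratic part of the excess is at least a positive multiple of the square of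
  \<open>size v\<close>, by Cauchy-Schwarz, while its linear part is at most a multiple of
  \<open>size v\<close>.\<close>

lemma excess_bound: "\<exists>K. \<forall>v. excess m0 v \<le> 0 \<longrightarrow> size v \<le> (K :: nat)"
proof -
  obtain e where e: "e > 0"
    "\<And>k. e * (\<Sum>i\<in>UNIV. (k i)\<^sup>2) \<le> (\<Sum>i\<in>UNIV. \<Sum>j\<in>UNIV. B i j * k i * k j)"
    using form_lower_bound by blast
  define c where "c = (\<Sum>i\<in>UNIV. \<bar>B i i * weight i m0\<bar>)"
  have "real (size v) \<le> c * CARD('i) / e" if v: "excess m0 v \<le> 0" for v
  proof -
    let ?k = "color_count v" and ?n = "real (size v)"
    have "?n\<^sup>2 = (\<Sum>i\<in>UNIV. 1 * ?k i)\<^sup>2" by (simp add: sum_color_count)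
    also have "\<dots> \<le> (\<Sum>i\<in>(UNIV :: 'i set). 1\<^sup>2) * (\<Sum>i\<in>UNIV. (?k i)\<^sup>2)"
      by (rule Cauchy_Schwarz_ineq_sum)
    finally have 1: "?n\<^sup>2 \<le> CARD('i) * (\<Sum>i\<in>UNIV. (?k i)\<^sup>2)" by simp
    have "e * (\<Sum>i\<in>UNIV. (?k i)\<^sup>2) \<le> (\<Sum>i\<in>UNIV. B i i * weight i m0 * ?k i)"
      using e(2)[of ?k] v by (simp add: excess_def)
    also have "\<dots> \<le> (\<Sum>i\<in>UNIV. \<bar>B i i * weight i m0\<bar> * ?n)"
    proof (rule sum_mono)
      fix i
      have "?k i \<le> (\<Sum>i\<in>UNIV. ?k i)" by (rule member_le_sum) (auto simp: color_count_nonneg)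
      then have "?k i \<le> ?n" by (simp add: sum_color_count)
      then show "B i i * weight i m0 * ?k i \<le> \<bar>B i i * weight i m0\<bar> * ?n"
        by (intro mult_mono) (auto simp: color_count_nonneg)
    qed
    also have "\<dots> = c * ?n" by (simp add: c_def sum_distrib_right)
    finally have 2: "e * (\<Sum>i\<in>UNIV. (?k i)\<^sup>2) \<le> c * ?n" .
    have "e * ?n\<^sup>2 \<le> CARD('i) * (e * (\<Sum>i\<in>UNIV. (?k i)\<^sup>2))"
      using mult_left_mono[OF 1, of e] e(1) by (simp add: algebra_simps)
    also have "\<dots> \<le> CARD('i) * (c * ?n)" using 2 by (intro mult_left_mono) auto
    finally have "?n * (e * ?n) \<le> ?n * (c * CARD('i))" by (simp add: power2_eq_square algebra_simps)
    moreover have "c \<ge> 0" by (simp add: c_def sum_nonneg)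
    ultimately have "e * ?n \<le> c * CARD('i)"
      by (cases "?n = 0") (auto simp: mult_le_cancel_left_pos)
    then show ?thesis using e(1) by (simp add: field_simps)
  qed
  then have "\<forall>v. excess m0 v \<le> 0 \<longrightarrow> size v \<le> nat \<lfloor>c * CARD('i) / e\<rfloor>"
    by (simp add: le_nat_floor)
  then show ?thesis by blast
qed

end

text \<open>Keeps the spectral parameters of the occurring monomials bounded: the norm only controls how many
  \<open>A\<^sub>i(zt\<^sup>n)\<^sup>-\<^sup>1\<close> are used, not for which \<open>n\<close>.\<close>

fun descendants :: "('i::finite \<Rightarrow> 'i \<Rightarrow> int) \<Rightarrow> 'i ymon \<Rightarrow> nat \<Rightarrow> 'i ymon set" where
  "descendants C m0 0 = {m0}"
| "descendants C m0 (Suc h) =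
     descendants C m0 h \<union> (\<Union>i. \<Union>m\<in>descendants C m0 h. keys (Lel C i m))"

lemma finite_descendants: "finite (descendants C m0 h)"
  by (induction h) auto

lemma descendants_mono: "h \<le> h' \<Longrightarrow> descendants C m0 h \<subseteq> descendants C m0 h'"
  by (induction h' rule: dec_induct) auto

theorem (in finite_type) exists_unique_dominant:
  assumes m0: "dominant m0"
  shows "\<exists>x. (\<forall>i. x \<in> Ker C i) \<and> lookup x m0 = 1 \<and> (\<forall>m\<in>keys x. dominant m \<longrightarrow> m = m0)"
proof -
  define P where "P = {p. mle C UNIV p m0}"
  \<comment> \<open>The excess bounds \<open>size v\<close>, and this number bounds the generation,
    hence the levels; together they make \<open>G\<close> finite.\<close>
  define G where "G = {m0 - asum C v | v. excess m0 v \<le> 0 \<and> m0 - asum C v \<in> descendants C m0 (size v)}"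
  obtain K where K: "\<And>v. excess m0 v \<le> 0 \<Longrightarrow> size v \<le> K" using excess_bound by blast
  have "G \<subseteq> descendants C m0 K" using K descendants_mono by (fastforce simp: G_def)
  then have finG: "finite G" using finite_descendants finite_subset by blast
  have GP: "G \<subseteq> P" by (auto simp: G_def P_def intro: mle_diff_asum)
  have Gm0: "m0 \<in> G" unfolding G_def by (rule CollectI, rule exI[of _ "{#}"]) (simp add: excess_def)
  have Gstep: "m \<in> G" if d: "d \<in> G" "nonneg_on {i} d" "m \<in> keys (Lel C i d)" "m \<noteq> d" for i d m
  proof -
    obtain v where v: "d = m0 - asum C v" "excess m0 v \<le> 0" "d \<in> descendants C m0 (size v)"
      using d(1) by (auto simp: G_def)
    obtain w where w: "w \<subseteq># levels i d" "m = d - asum C (image_mset (\<lambda>n. (i, n + 1)) w)"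
      using d(3) by (rule keys_Lel)
    let ?v = "v + image_mset (\<lambda>n. (i, n + 1)) w"
    have "m = m0 - asum C ?v" by (simp add: v w algebra_simps)
    moreover have "excess m0 ?v \<le> 0"
      using excess_lowering[of w i m0 v] size_le_weight[OF d(2) w(1)] v by simp
    \<comment> \<open>A monomial other than \<open>d\<close> uses at least one more factor, which
      pays for the next generation.\<close>
    moreover have "w \<noteq> {#}" using d(4) w(2) by auto
    then have "Suc (size v) \<le> size ?v" by (simp add: Suc_leI nonempty_has_size)
    moreover have "m \<in> descendants C m0 (Suc (size v))" using v(3) d(3) by auto
    ultimately show ?thesis using descendants_mono unfolding G_def by blast
  qed
  \<comment> \<open>The extra step puts all monomials of the elements \<open>Lel C i d\<close> with
    \<open>d\<close> in \<open>G\<close> into \<open>U\<close>, so a combination of them vanishes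
    off \<open>U\<close>.\<close>
  define T where "T = G \<union> (\<Union>i. \<Union>m\<in>G. keys (Lel C i m))"
  have TP: "T \<subseteq> P"
  proof -
    have "p \<in> P" if "m \<in> G" "p \<in> keys (Lel C i m)" for i m p
    proof -
      have "mle C UNIV p m" using that(2) keys_Lel_mle mle_mono by blast
      then show ?thesis using that(1) GP mle_trans unfolding P_def by blast
    qed
    then show ?thesis using GP by (auto simp: T_def)
  qed
  define U where "U = (\<Union>m\<in>T. {p. mle C UNIV m p \<and> mle C UNIV p m0})"
  have "finite T" using finG by (auto simp: T_def)
  then have finU: "finite U" by (simp add: U_def finite_mle_interval)
  have UP: "U \<subseteq> P" by (auto simp: U_def P_def)
  have TU: "T \<subseteq> U" using TP by (auto simp: U_def P_def)
  have up: "q \<in> U" if "p \<in> U" "q \<in> P" "mle C UNIV p q" for p q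
    using that mle_trans unfolding U_def P_def by blast
  obtain c y where c: "\<And>m. m \<in> U \<Longrightarrow> dominant m \<Longrightarrow> c m = (if m = m0 then 1 else 0)"
    and y: "\<And>i. y i \<in> Ker C i" "\<And>i. keys (y i) \<subseteq> P" "\<And>i m. m \<in> U \<Longrightarrow> lookup (y i) m = c m"
  proof -
    have "\<exists>c y. (\<forall>m\<in>U. dominant m \<longrightarrow> c m = (if m = m0 then 1 else 0)) \<and>
       (\<forall>i. y i \<in> Ker C i \<and> keys (y i) \<subseteq> {p. mle C UNIV p m0} \<and> (\<forall>m\<in>U. lookup (y i) m = c m))"
      by (rule partial_solution[OF finU _ _ m0]) (use UP up in \<open>auto simp: P_def\<close>)
    then show ?thesis using that unfolding P_def by blast
  qed
  have "\<exists>l. (\<forall>d\<in>keys l. nonneg_on {i} d \<and> (\<exists>m\<in>keys (y i). mle C {i} d m)) \<and> y i = lin (Lel C i) l" for i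
    by (rule Ker_decomposition[OF y(1)])
  then obtain l where l: "\<And>i d. d \<in> keys (l i) \<Longrightarrow> nonneg_on {i} d"
    "\<And>i d. d \<in> keys (l i) \<Longrightarrow> \<exists>m\<in>keys (y i). mle C {i} d m" "\<And>i. y i = lin (Lel C i) (l i)"
    by metis
  have lP: "d \<in> P" if "d \<in> keys (l i)" for i d
  proof -
    have "\<exists>m\<in>keys (y i). mle C {i} d m" by (rule l(2)[OF that])
    then obtain m where "m \<in> keys (y i)" "mle C {i} d m" by blast
    then show ?thesis using y(2)[of i] mle_mono[of C "{i}" d m UNIV] mle_trans unfolding P_def by blast
  qed
  have upU: "d \<in> U" if "m \<in> U" "d \<in> keys (l i)" "m \<in> keys (Lel C i d)" for m d i
    using up[OF that(1) lP[OF that(2)]] keys_Lel_mle[OF that(3)] mle_mono by blast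
  \<comment> \<open>At a maximal \<open>m\<close> in \<open>S\<close> no other term of an expansion
    contributes: it would start in \<open>G\<close>, and \<open>Gstep\<close> would put
    \<open>m\<close> into \<open>G\<close>. If \<open>c m\<close> is nonzero, \<open>m\<close> is
    not dominant at some \<open>i\<close>, so it needs such a contribution in the expansion of
    \<open>y i\<close>. If \<open>c m\<close> is 0, the term at \<open>m\<close> itself has nothing
    to cancel it.\<close>
  define S where "S = {m \<in> U. (c m \<noteq> 0 \<or> (\<exists>i. m \<in> keys (l i))) \<and> m \<notin> G}"
  have "S = {}"
  proof (rule ccontr)
    assume "S \<noteq> {}"
    moreover have "finite S" using finU by (simp add: S_def)
    ultimately obtain m where m: "m \<in> S" "\<And>m'. m' \<in> S \<Longrightarrow> mle C UNIV m m' \<Longrightarrow> m' = m"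
      using finite_mle_maximal[of S C UNIV] by blast
    have mU: "m \<in> U" and mG: "m \<notin> G" using m(1) by (auto simp: S_def)
    have no: False if "d \<in> keys (l i)" "m \<in> keys (Lel C i d)" "d \<noteq> m" for i d
    proof -
      have "d \<in> U" by (rule upU[OF mU that(1,2)])
      moreover have "mle C UNIV m d" using keys_Lel_mle[OF that(2)] mle_mono by blast
      ultimately have "d \<in> G" using m(2)[of d] that(1,3) by (auto simp: S_def)
      then show False using Gstep[OF _ l(1)[OF that(1)] that(2)] that(3) mG by blast
    qed
    show False
    proof (cases "c m = 0")
      case False
      have "\<not> dominant m" using c[OF mU] False mG Gm0 by (auto split: if_splits)
      then obtain i where i: "\<not> nonneg_on {i} m" by (auto simp: nonneg_on_def dominant_def)
      have "m \<in> keys (lin (Lel C i) (l i))" using False y(3)[OF mU, of i] l(3)[of i] by (simp add: in_keys_iff)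
      then obtain d where d: "d \<in> keys (l i)" "m \<in> keys (Lel C i d)" using keys_lin by blast
      then show False using no[OF d] l(1)[OF d(1)] i by blast
    next
      case True
      then obtain i where i: "m \<in> keys (l i)" using m(1) by (auto simp: S_def)
      have "lookup (y i) m = (\<Sum>d\<in>keys (l i). if d = m then lookup (l i) m else 0)"
        unfolding l(3)[of i] lookup_lin
      proof (rule sum.cong)
        fix d assume d: "d \<in> keys (l i)"
        show "lookup (l i) d * lookup (Lel C i d) m = (if d = m then lookup (l i) m else 0)"
          using no[OF d] by (auto simp: lookup_Lel in_keys_iff)
      qed simp
      then show False using i y(3)[OF mU, of i] True by (simp add: in_keys_iff)
    qed
  qed
  then have inG: "m \<in> G" if "m \<in> U" "c m \<noteq> 0 \<or> m \<in> keys (l i)" for m i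
    using that by (auto simp: S_def)
  define x where "x = (\<Sum>m\<in>U. single m (c m))"
  have x: "lookup x m = (if m \<in> U then c m else 0)" for m
    using finU by (simp add: x_def lookup_sum lookup_single when_def sum.delta)
  have "x \<in> Ker C i" for i
  proof -
    \<comment> \<open>Only the terms starting in \<open>G\<close> are kept. On \<open>U\<close>
      nothing is lost, as a term that reaches \<open>U\<close> starts in \<open>U\<close> and hence
      in \<open>G\<close>; off \<open>U\<close> nothing is left. So the result does not depend on
      \<open>i\<close>.\<close>
    define y' where "y' = (\<Sum>d\<in>keys (l i) \<inter> G. cscale (lookup (l i) d) (Lel C i d))"
    have "y' = x"
    proof (rule poly_mapping_eqI)
      fix m
      have y': "lookup y' m = (\<Sum>d\<in>keys (l i) \<inter> G. lookup (l i) d * lookup (Lel C i d) m)"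
        by (simp add: y'_def lookup_sum lookup_cscale)
      show "lookup y' m = lookup x m"
      proof (cases "m \<in> U")
        case True
        have "lookup (y i) m = lookup y' m"
          unfolding y' l(3)[of i] lookup_lin
        proof (rule sum.mono_neutral_right)
          show "\<forall>d\<in>keys (l i) - keys (l i) \<inter> G. lookup (l i) d * lookup (Lel C i d) m = 0"
          proof
            fix d assume d: "d \<in> keys (l i) - keys (l i) \<inter> G"
            then have "m \<notin> keys (Lel C i d)" using upU[OF True] inG by blast
            then show "lookup (l i) d * lookup (Lel C i d) m = 0" by (simp add: in_keys_iff)
          qed
        qed auto
        then show ?thesis using y(3)[OF True, of i] True by (simp add: x)
      next
        case False
        have "m \<notin> keys (Lel C i d)" if "d \<in> G" for d
          using False TU that by (auto simp: T_def)
        then have "lookup y' m = 0" unfolding y' by (intro sum.neutral) (auto simp: in_keys_iff)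
        then show ?thesis using False by (simp add: x)
      qed
    qed
    moreover have "y' \<in> Ker C i"
      unfolding y'_def by (intro Ker_sum Ker_cscale Lel_Ker) (auto intro: l(1))
    ultimately show ?thesis by simp
  qed
  moreover have "m0 \<in> U" using Gm0 TU by (auto simp: T_def)
  then have "lookup x m0 = 1" using c m0 by (simp add: x)
  moreover have "m = m0" if "m \<in> keys x" "dominant m" for m
    using that c[of m] by (auto simp: x in_keys_iff split: if_splits)
  ultimately show ?thesis by blast
qed

section \<open>The Cartan matrix is of finite type\<close>

context lie_algebra
begin

definition is_linear :: "('g \<Rightarrow> 'g) \<Rightarrow> bool" where
  "is_linear f \<longleftrightarrow> (\<forall>x y. f (x + y) = f x + f y) \<and> (\<forall>c x. f (scale c x) = scale c (f x))"

lemma is_linear_zero: "is_linear f \<Longrightarrow> f 0 = 0"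
  unfolding is_linear_def by (metis scale_zero_left)

lemma is_linear_sum: "is_linear f \<Longrightarrow> f (\<Sum>a\<in>S. scale (c a) (g a)) = (\<Sum>a\<in>S. scale (c a) (f (g a)))"
  by (induction S rule: infinite_finite_induct) (auto simp: is_linear_zero is_linear_def)

lemma is_linear_compose: "is_linear f \<Longrightarrow> is_linear g \<Longrightarrow> is_linear (\<lambda>x. f (g x))"
  by (simp add: is_linear_def)

text \<open>\<open>trace\<close> is tied to an unspecified basis; with the basis as a parameter it
  can be computed in weight vectors.\<close>

definition btrace :: "'g set \<Rightarrow> ('g \<Rightarrow> 'g) \<Rightarrow> 'k" where
  "btrace B f = (\<Sum>b\<in>B. representation B (f b) b)"

lemma representation_linear_sum:
  assumes B: "independent B" "span B = UNIV"
  shows "representation B (\<Sum>a\<in>S. scale (c a) (g a)) b = (\<Sum>a\<in>S. c a * representation B (g a) b)"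
  by (simp add: B representation_sum representation_scale)

lemma representation_image:
  assumes B: "independent B" "span B = UNIV" and B': "independent B'" "span B' = UNIV" "finite B'"
    and f: "is_linear f"
  shows "representation B (f x) b = (\<Sum>c\<in>B'. representation B' x c * representation B (f c) b)"
proof -
  have "(\<Sum>c\<in>B'. scale (representation B' x c) c) = x"
    using sum_representation_eq[OF B'(1) _ B'(3) order.refl, of x] B'(2) by simp
  then have "f x = (\<Sum>c\<in>B'. scale (representation B' x c) (f c))"
    using is_linear_sum[OF f, of "representation B' x" "\<lambda>c. c" B'] by simp
  then show ?thesis by (simp only: representation_linear_sum[OF B])
qed

lemma btrace_basis:
  assumes B: "independent B" "span B = UNIV" "finite B"
    and B': "independent B'" "span B' = UNIV" "finite B'"
    and f: "is_linear f"
  shows "btrace B f = btrace B' f"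
proof -
  have "btrace B f = (\<Sum>b\<in>B. \<Sum>c\<in>B'. representation B' b c * representation B (f c) b)"
    unfolding btrace_def using representation_image[OF B(1,2) B' f] by (rule sum.cong[OF refl])
  also have "\<dots> = (\<Sum>c\<in>B'. \<Sum>b\<in>B. representation B (f c) b * representation B' b c)"
    by (subst sum.swap) (simp add: mult.commute)
  also have "\<dots> = (\<Sum>c\<in>B'. representation B' (f c) c)"
  proof (rule sum.cong[OF refl])
    fix c
    have id: "is_linear (\<lambda>x. x)" by (simp add: is_linear_def)
    show "(\<Sum>b\<in>B. representation B (f c) b * representation B' b c) = representation B' (f c) c"
      using representation_image[OF B'(1,2) B id, of "f c" c] by simp
  qed
  finally show ?thesis by (simp add: btrace_def)
qed

lemma btrace_commute:
  assumes B: "independent B" "span B = UNIV" "finite B" and f: "is_linear f" and g: "is_linear g"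
  shows "btrace B (\<lambda>x. f (g x)) = btrace B (\<lambda>x. g (f x))"
proof -
  have "btrace B (\<lambda>x. f (g x)) = (\<Sum>b\<in>B. \<Sum>c\<in>B. representation B (g b) c * representation B (f c) b)"
    unfolding btrace_def using representation_image[OF B(1,2) B f] by (rule sum.cong[OF refl])
  also have "\<dots> = (\<Sum>c\<in>B. \<Sum>b\<in>B. representation B (f c) b * representation B (g b) c)"
    by (subst sum.swap) (simp add: mult.commute)
  also have "\<dots> = btrace B (\<lambda>x. g (f x))"
    unfolding btrace_def using representation_image[OF B(1,2) B g, symmetric] by (rule sum.cong[OF refl])
  finally show ?thesis .
qed

lemma btrace_linear:
  assumes B: "independent B" "span B = UNIV"
  shows "btrace B (\<lambda>x. f x + g x) = btrace B f + btrace B g"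
    and "btrace B (\<lambda>x. f x - g x) = btrace B f - btrace B g"
    and "btrace B (\<lambda>x. scale c (f x)) = c * btrace B f"
  by (simp_all add: btrace_def B representation_add representation_diff representation_scale
      sum.distrib sum_subtractf sum_distrib_left)

text \<open>Indexing \<open>w\<close> by the eigenvalue makes the eigenvalues distinct: T - a
  removes \<open>w a\<close> and multiplies every other \<open>w c\<close> by the nonzero c -
  a.\<close>

lemma eigenvector_sum_mem:
  assumes T: "is_linear T" and U: "subspace U" "\<And>x. x \<in> U \<Longrightarrow> T x \<in> U"
    and "finite L" "\<And>c. T (w c) = scale c (w c)" "(\<Sum>c\<in>L. w c) \<in> U" "c \<in> L"
  shows "w c \<in> U"
  using assms(4-7)
proof (induction L arbitrary: w c rule: finite_induct)
  case (insert a L)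
  let ?z = "\<Sum>c\<in>insert a L. w c"
  have scaled: "T (scale d (w c)) = scale c (scale d (w c))" for c d
    using T insert.prems(1)[of c] by (simp add: is_linear_def mult.commute)
  have "T ?z = (\<Sum>c\<in>insert a L. scale 1 (T (w c)))"
    using is_linear_sum[OF T, where c = "\<lambda>_. 1" and g = w] by simp
  also have "\<dots> = scale a (w a) + (\<Sum>c\<in>L. scale c (w c))"
    using insert by simp
  finally have "T ?z - scale a ?z = (\<Sum>c\<in>L. scale c (w c)) - scale a (\<Sum>c\<in>L. w c)"
    using insert by (simp add: scale_right_distrib)
  also have "\<dots> = (\<Sum>c\<in>L. scale (c - a) (w c))"
    by (simp add: scale_sum_right scale_left_diff_distrib sum_subtractf)
  finally have eq: "T ?z - scale a ?z = (\<Sum>c\<in>L. scale (c - a) (w c))" .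
  have "T ?z - scale a ?z \<in> U"
    by (rule subspace_diff[OF U(1) U(2) subspace_scale[OF U(1)]]) (rule insert.prems(2))+
  then have "(\<Sum>c\<in>L. scale (c - a) (w c)) \<in> U" by (simp only: eq)
  then have "scale (c - a) (w c) \<in> U" if "c \<in> L" for c
    using insert.IH[of "\<lambda>c. scale (c - a) (w c)"] scaled that by blast
  then have "scale (inverse (c - a)) (scale (c - a) (w c)) \<in> U" if "c \<in> L" for c
    using U(1) that by (blast intro: subspace_scale)
  then have L: "w c \<in> U" if "c \<in> L" for c
    using insert.hyps(2) that by (cases "c = a") force+
  have "w a = ?z - (\<Sum>c\<in>L. w c)" using insert.hyps by simp
  then have "w a \<in> U" using U(1) insert.prems(2) L by (metis subspace_diff subspace_sum)
  then show ?case using L insert.prems(3) by blast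
qed simp

lemma in_span_eigenvectors:
  assumes T: "is_linear T" and U: "subspace U" "\<And>x. x \<in> U \<Longrightarrow> T x \<in> U"
    and x: "x \<in> U" "x \<in> span {v. \<exists>c. T v = scale c v}"
  shows "x \<in> span {v \<in> U. \<exists>c. T v = scale c v}"
proof -
  have "\<exists>L w. finite L \<and> (\<forall>c. T (w c) = scale c (w c)) \<and> x = (\<Sum>c\<in>L. w c)"
    using x(2)
  proof (induction rule: span_induct_alt)
    case base
    show ?case by (intro exI[of _ "{}"] exI[of _ "\<lambda>_. 0"]) (simp add: is_linear_zero[OF T])
  next
    case (step a v y)
    then obtain L w c where L: "finite L" "\<forall>c. T (w c) = scale c (w c)" "y = (\<Sum>c\<in>L. w c)"
      and v: "T v = scale c v" by auto
    \<comment> \<open>The new eigenvector is merged into the summand of its eigenvalue, to keep the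
      indexing by eigenvalues; \<open>w1\<close> is 0 where there was no summand.\<close>
    define w1 where "w1 d = (if d \<in> L then w d else 0)" for d
    have "y = (\<Sum>d\<in>insert c L. w1 d)"
      unfolding L(3) w1_def using L(1) by (intro sum.mono_neutral_cong_left) auto
    then have "scale a v + y = (\<Sum>d\<in>insert c L. w1 d + (if d = c then scale a v else 0))"
      using L(1) by (simp add: sum.distrib del: sum.insert)
    moreover have "T (w1 d + (if d = c then scale a v else 0)) =
        scale d (w1 d + (if d = c then scale a v else 0))" for d
      using T L(2) v is_linear_zero[OF T]
      by (simp add: is_linear_def w1_def scale_right_distrib mult.commute)
    ultimately show ?case using L(1)
      by (intro exI[of _ "insert c L"] exI[of _ "\<lambda>d. w1 d + (if d = c then scale a v else 0)"]) simp
  qed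
  then obtain L w where L: "finite L" "\<And>c. T (w c) = scale c (w c)" "x = (\<Sum>c\<in>L. w c)" by blast
  have "w c \<in> span {v \<in> U. \<exists>c. T v = scale c v}" if "c \<in> L" for c
    using eigenvector_sum_mem[OF T U L(1,2) _ that] x(1) L(2,3) by (blast intro: span_base)
  then show ?thesis unfolding L(3) by (rule span_sum)
qed

lemma bracket_zero [simp]: "bracket x 0 = 0" "bracket 0 x = 0"
  using bracket_scale_right[of x 0 0] bracket_scale_left[of 0 0 x] by simp_all

lemma bracket_skew: "bracket x y = - bracket y x"
proof -
  have "bracket (x + y) (x + y) = bracket x (x + y) + bracket y (x + y)" by (rule bracket_add_left)
  then have "bracket x y + bracket y x = 0"
    by (simp add: bracket_alternating) (simp add: bracket_add_right bracket_alternating)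
  then show ?thesis by (simp add: eq_neg_iff_add_eq_0)
qed

lemma bracket_minus_right: "bracket x (- y) = - bracket x y"
  using bracket_scale_right[of x "- 1" y] by simp

lemma bracket_diff_right: "bracket x (y - z) = bracket x y - bracket x z"
  using bracket_add_right[of x y "- z"] by (simp add: bracket_minus_right)

lemma bracket_bracket: "bracket (bracket x y) z = bracket x (bracket y z) - bracket y (bracket x z)"
proof -
  have "bracket z (bracket x y) = - bracket (bracket x y) z" by (rule bracket_skew)
  moreover have "bracket y (bracket z x) = - bracket y (bracket x z)"
    using bracket_skew[of z x] by (simp add: bracket_minus_right)
  ultimately show ?thesis using jacobi[of x y z] by (simp add: algebra_simps)
qed

lemma is_linear_bracket: "is_linear (bracket x)"
  by (simp add: is_linear_def bracket_add_right bracket_scale_right)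

end

section \<open>Weight space decomposition under a Cartan subalgebra\<close>

locale cartan_data = simple_lie_algebra scale bracket
  for scale :: "complex \<Rightarrow> 'g::ab_group_add \<Rightarrow> 'g" and bracket +
  fixes H :: "'g set"
  assumes H: "cartan_subalgebra H"
begin

lemma H_subspace: "subspace H"
  and H_abelian: "y \<in> H \<Longrightarrow> y' \<in> H \<Longrightarrow> bracket y y' = 0"
  and H_maximal: "(\<And>y. y \<in> H \<Longrightarrow> bracket y x = 0) \<Longrightarrow> x \<in> H"
  and H_diag: "y \<in> H \<Longrightarrow> span {x. \<exists>c. bracket y x = scale c x} = UNIV"
  using H unfolding cartan_subalgebra_def by blast+

lemma independent_finite: "independent S \<Longrightarrow> finite S"
  using finite_dim independent_span_bound by (metis subset_UNIV)

text \<open>Only the values of \<open>\<gamma>\<close> on \<open>H\<close> count, so weights can be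
  added without the normalisation off \<open>H\<close> that \<open>roots\<close> imposes.\<close>

definition wspace :: "('g \<Rightarrow> complex) \<Rightarrow> 'g set" where
  "wspace \<gamma> = {x. \<forall>y\<in>H. bracket y x = scale (\<gamma> y) x}"

lemma wspaceD: "x \<in> wspace \<gamma> \<Longrightarrow> y \<in> H \<Longrightarrow> bracket y x = scale (\<gamma> y) x"
  by (simp add: wspace_def)

text \<open>The joint eigenspace \<open>U\<close> through \<open>x\<close> is invariant under a
  further \<open>y\<close> because \<open>H\<close> is abelian, and ad y remains diagonalizable on
  it.\<close>

lemma joint_eigenvectors_span:
  assumes "finite Y" "Y \<subseteq> H"
  shows "span {x. \<forall>y\<in>Y. \<exists>c. bracket y x = scale c x} = UNIV"
  using assms
proof (induction Y rule: finite_induct)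
  case empty
  then show ?case by simp
next
  case (insert y Y)
  let ?E = "\<lambda>Y. {x. \<forall>y\<in>Y. \<exists>c. bracket y x = scale c x}"
  have "?E Y \<subseteq> span (?E (insert y Y))"
  proof
    fix x assume "x \<in> ?E Y"
    then have "\<forall>y'\<in>Y. \<exists>c. bracket y' x = scale c x" by simp
    from bchoice[OF this] obtain c where c: "\<forall>y'\<in>Y. bracket y' x = scale (c y') x" by blast
    define U where "U = {v. \<forall>y'\<in>Y. bracket y' v = scale (c y') v}"
    have U: "subspace U"
      unfolding U_def by (rule subspaceI)
        (simp_all add: bracket_add_right bracket_scale_right scale_right_distrib mult.commute)
    have inv: "bracket y v \<in> U" if v: "v \<in> U" for v
      unfolding U_def
    proof (intro CollectI ballI)
      fix y' assume y': "y' \<in> Y"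
      have "bracket y' y = 0" using insert.prems y' by (intro H_abelian) auto
      then have "bracket y' (bracket y v) = bracket y (bracket y' v)"
        using bracket_bracket[of y' y v] by simp
      then show "bracket y' (bracket y v) = scale (c y') (bracket y v)"
        using v y' by (simp add: U_def bracket_scale_right)
    qed
    have "x \<in> span {v. \<exists>c. bracket y v = scale c v}" using H_diag[of y] insert.prems by simp
    moreover have "x \<in> U" using c by (simp add: U_def)
    ultimately have "x \<in> span {v \<in> U. \<exists>c. bracket y v = scale c v}"
      using in_span_eigenvectors[OF is_linear_bracket U inv] by blast
    moreover have "{v \<in> U. \<exists>c. bracket y v = scale c v} \<subseteq> ?E (insert y Y)"
      by (auto simp: U_def)
    ultimately show "x \<in> span (?E (insert y Y))" using span_mono by blast
  qed
  then have "span (?E Y) \<subseteq> span (?E (insert y Y))" by (simp add: span_minimal subspace_span)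
  then show ?case using insert by auto
qed

text \<open>The elements that act on a given \<open>x\<close> by scalars form a subspace, so
  diagonalizing a finite basis of \<open>H\<close> is enough.\<close>

lemma weight_vectors_span: "span (\<Union>\<gamma>. wspace \<gamma>) = UNIV"
proof -
  obtain Y where Y: "Y \<subseteq> H" "independent Y" "H \<subseteq> span Y" using maximal_independent_subset by blast
  have "{x. \<forall>y\<in>Y. \<exists>c. bracket y x = scale c x} \<subseteq> (\<Union>\<gamma>. wspace \<gamma>)"
  proof
    fix x assume x: "x \<in> {x. \<forall>y\<in>Y. \<exists>c. bracket y x = scale c x}"
    have "subspace {y. \<exists>c. bracket y x = scale c x}"
    proof (rule subspaceI)
      show "0 \<in> {y. \<exists>c. bracket y x = scale c x}" by (auto intro: exI[of _ 0])
    next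
      fix u v assume "u \<in> {y. \<exists>c. bracket y x = scale c x}" "v \<in> {y. \<exists>c. bracket y x = scale c x}"
      then show "u + v \<in> {y. \<exists>c. bracket y x = scale c x}"
        by (auto simp: bracket_add_left simp flip: scale_left_distrib)
    next
      fix a u assume "u \<in> {y. \<exists>c. bracket y x = scale c x}"
      then show "scale a u \<in> {y. \<exists>c. bracket y x = scale c x}"
        by (auto simp: bracket_scale_left)
    qed
    then have "span Y \<subseteq> {y. \<exists>c. bracket y x = scale c x}" using x by (intro span_minimal) auto
    then have "\<forall>y\<in>H. \<exists>c. bracket y x = scale c x" using Y(3) by blast
    then have "\<exists>\<gamma>. \<forall>y\<in>H. bracket y x = scale (\<gamma> y) x" by metis
    then show "x \<in> (\<Union>\<gamma>. wspace \<gamma>)" by (auto simp: wspace_def)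
  qed
  then have "span {x. \<forall>y\<in>Y. \<exists>c. bracket y x = scale c x} \<subseteq> span (\<Union>\<gamma>. wspace \<gamma>)" by (rule span_mono)
  then show ?thesis using joint_eigenvectors_span[OF independent_finite[OF Y(2)] Y(1)] by auto
qed

definition wbasis :: "'g set" where
  "wbasis = (SOME B. B \<subseteq> (\<Union>\<gamma>. wspace \<gamma>) \<and> independent B \<and> span B = UNIV)"

lemma wbasis:
  shows wbasis_weight: "wbasis \<subseteq> (\<Union>\<gamma>. wspace \<gamma>)"
    and wbasis_independent: "independent wbasis"
    and wbasis_span: "span wbasis = UNIV"
proof -
  obtain B where B: "B \<subseteq> (\<Union>\<gamma>. wspace \<gamma>)" "independent B" "(\<Union>\<gamma>. wspace \<gamma>) \<subseteq> span B"
    using maximal_independent_subset by blast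
  then have "span B = UNIV"
    using weight_vectors_span by (metis span_minimal subspace_span top.extremum_uniqueI)
  then have "\<exists>B. B \<subseteq> (\<Union>\<gamma>. wspace \<gamma>) \<and> independent B \<and> span B = UNIV" using B by blast
  from someI_ex[OF this] show "wbasis \<subseteq> (\<Union>\<gamma>. wspace \<gamma>)" "independent wbasis" "span wbasis = UNIV"
    unfolding wbasis_def by blast+
qed

lemma wbasis_finite: "finite wbasis"
  by (rule independent_finite[OF wbasis_independent])

definition wt :: "'g \<Rightarrow> 'g \<Rightarrow> complex" where
  "wt b = (SOME \<gamma>. b \<in> wspace \<gamma>)"

lemma wt: "b \<in> wbasis \<Longrightarrow> b \<in> wspace (wt b)"
  using wbasis_weight someI_ex[of "\<lambda>\<gamma>. b \<in> wspace \<gamma>"] unfolding wt_def by blast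

lemma wbasis_nonzero: "b \<in> wbasis \<Longrightarrow> b \<noteq> 0"
  using wbasis_independent dependent_zero by blast

lemma bracket_wt: "b \<in> wbasis \<Longrightarrow> y \<in> H \<Longrightarrow> bracket y b = scale (wt b y) b"
  by (rule wspaceD[OF wt])

lemma is_linear_ad2: "is_linear (\<lambda>z. bracket x (bracket y z))"
  by (rule is_linear_compose[OF is_linear_bracket is_linear_bracket])

lemma killing_wbasis: "killing x y = btrace wbasis (\<lambda>z. bracket x (bracket y z))"
proof -
  have "killing x y = btrace (extend_basis {}) (\<lambda>z. bracket x (bracket y z))"
    by (simp add: killing_def trace_def btrace_def)
  also have "\<dots> = btrace wbasis (\<lambda>z. bracket x (bracket y z))"
    using wbasis_independent wbasis_span wbasis_finite independent_extend_basis[OF independent_empty]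
      span_extend_basis[OF independent_empty]
    by (intro btrace_basis is_linear_ad2 independent_finite) auto
  finally show ?thesis .
qed

lemmas wbasis_btrace_linear = btrace_linear[OF wbasis_independent wbasis_span]
lemmas wbasis_btrace_commute = btrace_commute[OF wbasis_independent wbasis_span wbasis_finite]

lemma killing_H:
  assumes "y \<in> H" "y' \<in> H"
  shows "killing y y' = (\<Sum>b\<in>wbasis. wt b y * wt b y')"
  unfolding killing_wbasis btrace_def
proof (rule sum.cong[OF refl])
  fix b assume b: "b \<in> wbasis"
  have "bracket y (bracket y' b) = scale (wt b y * wt b y') b"
    using b assms by (simp add: bracket_wt bracket_scale_right mult.commute)
  then show "representation wbasis (bracket y (bracket y' b)) b = wt b y * wt b y'"
    using b by (simp add: representation_scale wbasis_independent wbasis_span representation_basis)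
qed

lemma killing_sym: "killing x y = killing y x"
  unfolding killing_wbasis by (rule wbasis_btrace_commute[OF is_linear_bracket is_linear_bracket])

lemma killing_add_right: "killing x (y + z) = killing x y + killing x z"
  unfolding killing_wbasis
  by (simp add: bracket_add_left bracket_add_right wbasis_btrace_linear)

lemma killing_scale_right: "killing x (scale c y) = c * killing x y"
  unfolding killing_wbasis
  by (simp add: bracket_scale_left bracket_scale_right wbasis_btrace_linear)

lemma killing_add_left: "killing (x + y) z = killing x z + killing y z"
  by (simp add: killing_sym[of _ z] killing_add_right)

lemma killing_scale_left: "killing (scale c x) z = c * killing x z"
  by (simp add: killing_sym[of _ z] killing_scale_right)

lemma killing_zero [simp]: "killing x 0 = 0" "killing 0 x = 0"
  using killing_scale_right[of x 0 0] killing_scale_left[of 0 0 x] by simp_all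

lemma killing_invariant: "killing (bracket x y) z = killing x (bracket y z)"
proof -
  have "killing (bracket x y) z = btrace wbasis (\<lambda>w. bracket x (bracket y (bracket z w))) -
      btrace wbasis (\<lambda>w. bracket y (bracket x (bracket z w)))"
    unfolding killing_wbasis by (simp add: bracket_bracket wbasis_btrace_linear)
  also have "btrace wbasis (\<lambda>w. bracket y (bracket x (bracket z w))) =
      btrace wbasis (\<lambda>w. bracket x (bracket z (bracket y w)))"
    using wbasis_btrace_commute[OF is_linear_bracket[of y] is_linear_ad2[of x z]] .
  also have "btrace wbasis (\<lambda>w. bracket x (bracket y (bracket z w))) -
      btrace wbasis (\<lambda>w. bracket x (bracket z (bracket y w))) = killing x (bracket y z)"
    unfolding killing_wbasis by (simp add: bracket_bracket bracket_diff_right wbasis_btrace_linear)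
  finally show ?thesis .
qed

lemma center_trivial:
  assumes "\<And>x. bracket h x = 0"
  shows "h = 0"
proof -
  let ?Z = "{h. \<forall>x. bracket h x = 0}"
  have "lie_ideal ?Z"
    unfolding lie_ideal_def
  proof (intro conjI allI ballI subspaceI)
    fix x y assume y: "y \<in> ?Z"
    have "bracket x y = 0" using bracket_skew[of x y] y by simp
    then show "bracket x y \<in> ?Z" by simp
  qed (auto simp: bracket_add_left bracket_scale_left)
  then have "?Z = {0} \<or> ?Z = UNIV" by (rule no_ideals)
  then show ?thesis using non_abelian assms by blast
qed

lemma zero_on_span:
  assumes "is_linear f" "\<And>b. b \<in> S \<Longrightarrow> f b = 0" "x \<in> span S"
  shows "f x = 0"
  using assms(3)
  by (induction rule: span_induct_alt) (use assms(1,2) is_linear_zero in \<open>auto simp: is_linear_def\<close>)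

lemma H_zero:
  assumes "h \<in> H" "\<And>b. b \<in> wbasis \<Longrightarrow> wt b h = 0"
  shows "h = 0"
proof (rule center_trivial)
  fix x
  show "bracket h x = 0"
  proof (rule zero_on_span[of "bracket h" wbasis x])
    show "bracket h b = 0" if "b \<in> wbasis" for b
      using bracket_wt[OF that assms(1)] assms(2)[OF that] by simp
  qed (simp_all add: is_linear_bracket wbasis_span)
qed

text \<open>Every basis vector that occurs in \<open>x\<close> has the weight of \<open>x\<close>.
  As \<open>wbasis\<close> is finite, only finitely many weights occur.\<close>

lemma weight_in_wbasis:
  assumes "x \<in> wspace \<gamma>" "x \<noteq> 0"
  shows "\<exists>b\<in>wbasis. \<forall>y\<in>H. wt b y = \<gamma> y"
proof -
  let ?r = "representation wbasis"
  have xs: "(\<Sum>b\<in>wbasis. scale (?r x b) b) = x"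
    using wbasis_independent wbasis_span wbasis_finite by (intro sum_representation_eq) auto
  have "\<exists>b\<in>wbasis. ?r x b \<noteq> 0"
  proof (rule ccontr)
    assume "\<not> (\<exists>b\<in>wbasis. ?r x b \<noteq> 0)"
    then have "(\<Sum>b\<in>wbasis. scale (?r x b) b) = 0" by (intro sum.neutral) simp
    then show False using xs assms(2) by simp
  qed
  then obtain b where b: "b \<in> wbasis" "?r x b \<noteq> 0" by blast
  have "wt b y = \<gamma> y" if y: "y \<in> H" for y
  proof -
    have "bracket y x = (\<Sum>b\<in>wbasis. scale (?r x b) (bracket y b))"
      using is_linear_sum[OF is_linear_bracket, of y "?r x" "\<lambda>b. b" wbasis] xs by simp
    also have "\<dots> = (\<Sum>b\<in>wbasis. scale (?r x b * wt b y) b)"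
      using y by (intro sum.cong) (auto simp: bracket_wt)
    finally have "?r (bracket y x) b = (\<Sum>c\<in>wbasis. (?r x c * wt c y) * ?r c b)"
      by (simp add: representation_linear_sum wbasis_independent wbasis_span)
    also have "\<dots> = (\<Sum>c\<in>wbasis. if c = b then ?r x b * wt b y else 0)"
      by (intro sum.cong) (auto simp: representation_basis wbasis_independent)
    also have "\<dots> = ?r x b * wt b y" using b wbasis_finite by simp
    finally have "?r (bracket y x) b = ?r x b * wt b y" .
    moreover have "?r (bracket y x) b = \<gamma> y * ?r x b"
      using wspaceD[OF assms(1) y] by (simp add: representation_scale wbasis_independent wbasis_span)
    ultimately show ?thesis using b(2) by simp
  qed
  then show ?thesis using b(1) by blast
qed

lemma wspace_zero: "(\<And>y. y \<in> H \<Longrightarrow> \<gamma> y = 0) \<Longrightarrow> x \<in> wspace \<gamma> \<Longrightarrow> x \<in> H"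
  by (rule H_maximal) (simp add: wspace_def)

lemma bracket_wspace:
  assumes "e \<in> wspace \<beta>" "x \<in> wspace \<gamma>"
  shows "bracket e x \<in> wspace (\<lambda>y. \<beta> y + \<gamma> y)"
  unfolding wspace_def
proof (intro CollectI ballI)
  fix y assume y: "y \<in> H"
  have "bracket y (bracket e x) = bracket (bracket y e) x + bracket e (bracket y x)"
    using bracket_bracket[of y e x] by simp
  then show "bracket y (bracket e x) = scale (\<beta> y + \<gamma> y) (bracket e x)"
    using wspaceD[OF assms(1) y] wspaceD[OF assms(2) y]
    by (simp add: bracket_scale_left bracket_scale_right scale_left_distrib)
qed

section \<open>Root strings\<close>

lemma power_wspace:
  assumes "e \<in> wspace \<beta>" "x \<in> wspace \<gamma>"
  shows "(bracket e ^^ k) x \<in> wspace (\<lambda>y. \<gamma> y + of_nat k * \<beta> y)"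
proof (induction k)
  case (Suc k)
  have "(\<lambda>y. \<beta> y + (\<gamma> y + of_nat k * \<beta> y)) = (\<lambda>y. \<gamma> y + of_nat (Suc k) * \<beta> y)"
    by (auto simp: algebra_simps)
  then show ?case using bracket_wspace[OF assms(1) Suc] by simp
qed (use assms in simp)

text \<open>Otherwise the string would give infinitely many weights with different values at
  \<open>y\<close>, too many for the finite \<open>wbasis\<close>.\<close>

lemma string_top:
  assumes e: "e \<in> wspace \<beta>" and y: "y \<in> H" "\<beta> y \<noteq> 0" and x: "x \<in> wspace \<gamma>" "x \<noteq> 0"
  shows "\<exists>q. (bracket e ^^ q) x \<noteq> 0 \<and> bracket e ((bracket e ^^ q) x) = 0"
proof -
  have "\<exists>k. (bracket e ^^ k) x = 0"
  proof (rule ccontr)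
    assume "\<nexists>k. (bracket e ^^ k) x = 0"
    then have "\<exists>b\<in>wbasis. \<forall>y\<in>H. wt b y = \<gamma> y + of_nat k * \<beta> y" for k
      by (intro weight_in_wbasis[OF power_wspace[OF e x(1), of k]]) auto
    then obtain f where f: "\<And>k. f k \<in> wbasis" "\<And>k. wt (f k) y = \<gamma> y + of_nat k * \<beta> y"
      using y(1) by metis
    have "inj f"
    proof (rule injI)
      fix k l assume "f k = f l"
      then have "\<gamma> y + of_nat k * \<beta> y = \<gamma> y + of_nat l * \<beta> y" using f(2) by metis
      then show "k = l" by (simp only: add_left_cancel mult_right_cancel[OF y(2)] of_nat_eq_iff)
    qed
    moreover have "range f \<subseteq> wbasis" using f(1) by blast
    ultimately show False
      using wbasis_finite finite_subset range_inj_infinite by blast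
  qed
  then obtain k where k: "(bracket e ^^ k) x = 0" "\<And>j. j < k \<Longrightarrow> (bracket e ^^ j) x \<noteq> 0"
    using exists_least_iff[of "\<lambda>k. (bracket e ^^ k) x = 0"] by blast
  then obtain q where "k = Suc q" using x(2) by (cases k) auto
  then show ?thesis using k(1) k(2)[of q] by (intro exI[of _ q]) simp
qed

lemma bracket_opposite:
  assumes "e \<in> wspace \<beta>" "f \<in> wspace (\<lambda>y. - \<beta> y)"
  shows "bracket e f \<in> H"
  by (rule wspace_zero[OF _ bracket_wspace[OF assms]]) simp

text \<open>The trace of \<open>h = [e, f]\<close> on the span of \<open>x, [e, x], [e, [e, x]], \<dots>\<close> vanishes.\<close>

lemma string_weight:
  assumes e: "e \<in> wspace \<beta>" and f: "f \<in> wspace (\<lambda>y. - \<beta> y)" and y: "y \<in> H" "\<beta> y \<noteq> 0"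
    and x: "x \<in> wspace \<mu>" "x \<noteq> 0" "bracket f x = 0"
  defines "h \<equiv> bracket e f"
  shows "\<exists>q::nat. 2 * \<mu> h = - of_nat q * \<beta> h"
proof -
  have h: "h \<in> H" unfolding h_def by (rule bracket_opposite[OF e f])
  define E where "E k = (bracket e ^^ k) x" for k
  have Ew: "bracket h (E k) = scale (\<mu> h + of_nat k * \<beta> h) (E k)" for k
    unfolding E_def using wspaceD[OF power_wspace[OF e x(1)] h] .
  have swap: "bracket f (bracket e v) = bracket e (bracket f v) - bracket h v" for v
    using bracket_bracket[of e f v] by (simp add: h_def)
  \<comment> \<open>The scalar is minus twice the partial trace, the sum of mu(h) + l beta(h) over l
    <= k; doubling avoids a division.\<close>
  have step: "scale 2 (bracket f (E (Suc k))) =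
      scale (- (of_nat (Suc k) * (2 * \<mu> h + of_nat k * \<beta> h))) (E k)" for k
  proof (induction k)
    case 0
    have "bracket f (E 1) = - bracket h (E 0)" using swap[of x] x(3) by (simp add: E_def)
    then show ?case using Ew[of 0] by simp
  next
    case (Suc k)
    have "scale 2 (bracket f (E (Suc (Suc k)))) =
        bracket e (scale 2 (bracket f (E (Suc k)))) - scale 2 (bracket h (E (Suc k)))"
      using swap[of "E (Suc k)"] by (simp add: E_def bracket_scale_right scale_right_diff_distrib)
    also have "\<dots> = scale (- (of_nat (Suc k) * (2 * \<mu> h + of_nat k * \<beta> h))) (E (Suc k)) -
        scale (2 * (\<mu> h + of_nat (Suc k) * \<beta> h)) (E (Suc k))"
      unfolding Suc Ew bracket_scale_right by (simp add: E_def)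
    also have "\<dots> = scale (- (of_nat (Suc (Suc k)) * (2 * \<mu> h + of_nat (Suc k) * \<beta> h))) (E (Suc k))"
      by (simp only: scale_left_diff_distrib[symmetric]) (simp add: algebra_simps)
    finally show ?case .
  qed
  obtain q where "E q \<noteq> 0" "E (Suc q) = 0"
    using string_top[OF e y x(1,2)] by (auto simp: E_def)
  then have "of_nat (Suc q) * (2 * \<mu> h + of_nat q * \<beta> h) = 0" using step[of q] by simp
  then have "2 * \<mu> h + of_nat q * \<beta> h = 0" by (simp only: mult_eq_0_iff of_nat_eq_0_iff) simp
  then show ?thesis by (intro exI[of _ q]) (simp add: eq_neg_iff_add_eq_0)
qed

text \<open>At the lower end of the string through \<open>x\<close>, of weight gamma - p beta,
  \<open>string_weight\<close> applies. Nothing is divided by beta(h): if beta(h) = 0, then gamma(h)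
  = 0 follows.\<close>

lemma real_ratio:
  assumes e: "e \<in> wspace \<beta>" and f: "f \<in> wspace (\<lambda>y. - \<beta> y)" and y: "y \<in> H" "\<beta> y \<noteq> 0"
    and x: "x \<in> wspace \<gamma>" "x \<noteq> 0"
  shows "\<exists>r::real. \<gamma> (bracket e f) = of_real r * \<beta> (bracket e f)"
proof -
  let ?h = "bracket e f"
  obtain p where p: "(bracket f ^^ p) x \<noteq> 0" "bracket f ((bracket f ^^ p) x) = 0"
    using string_top[OF f y(1) _ x] y(2) by auto
  obtain q where "2 * (\<gamma> ?h + of_nat p * - \<beta> ?h) = - of_nat q * \<beta> ?h"
    using string_weight[OF e f y power_wspace[OF f x(1)] p] by blast
  then have "\<gamma> ?h = of_real (real p - real q / 2) * \<beta> ?h"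
    by (simp add: field_simps)
  then show ?thesis by blast
qed

text \<open>If beta vanished at h = [e, f], so would every weight by \<open>real_ratio\<close>, and
  h would be central.\<close>

lemma coroot_nonzero:
  assumes e: "e \<in> wspace \<beta>" and f: "f \<in> wspace (\<lambda>y. - \<beta> y)" and y: "y \<in> H" "\<beta> y \<noteq> 0"
    and "bracket e f \<noteq> 0"
  shows "\<beta> (bracket e f) \<noteq> 0"
proof
  assume b: "\<beta> (bracket e f) = 0"
  have "wt b (bracket e f) = 0" if "b \<in> wbasis" for b
    using real_ratio[OF e f y wt[OF that] wbasis_nonzero[OF that]] b by auto
  then show False using H_zero[OF bracket_opposite[OF e f]] assms(5) by blast
qed

section \<open>Nondegeneracy of the Killing form\<close>

lemma H_disjoint_root_spaces:
  assumes h: "h \<in> H" "h \<in> span {x. \<exists>\<beta>. x \<in> wspace \<beta> \<and> (\<exists>y\<in>H. \<beta> y \<noteq> 0)}"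
  shows "h = 0"
proof -
  let ?N = "{x. \<exists>\<beta>. x \<in> wspace \<beta> \<and> (\<exists>y\<in>H. \<beta> y \<noteq> 0)}"
  obtain B where B: "B \<subseteq> ?N" "independent B" "?N \<subseteq> span B" using maximal_independent_subset by blast
  have finB: "finite B" by (rule independent_finite[OF B(2)])
  have "h \<in> span B" using h(2) B(3) by (meson span_minimal subspace_span subsetD)
  let ?r = "representation B h"
  have hs: "(\<Sum>b\<in>B. scale (?r b) b) = h"
    by (rule sum_representation_eq[OF B(2) \<open>h \<in> span B\<close> finB order.refl])
  have "?r b = 0" if b: "b \<in> B" for b
  proof -
    obtain \<beta> y where bw: "b \<in> wspace \<beta>" "y \<in> H" "\<beta> y \<noteq> 0" using b B(1) by blast
    have "\<forall>c\<in>B. \<exists>\<beta>. bracket y c = scale \<beta> c" using B(1) bw(2) by (blast dest: wspaceD)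
    then obtain g where g: "\<And>c. c \<in> B \<Longrightarrow> bracket y c = scale (g c) c" by metis
    have "0 = bracket y h" using H_abelian[OF bw(2) h(1)] by simp
    also have "\<dots> = (\<Sum>c\<in>B. scale (?r c) (bracket y c))"
      using is_linear_sum[OF is_linear_bracket, where g = "\<lambda>b. b"] hs by metis
    also have "\<dots> = (\<Sum>c\<in>B. scale (?r c * g c) c)"
      by (intro sum.cong) (auto simp: g)
    finally have "?r b * g b = 0"
      using independentD[OF B(2) finB order.refl, of "\<lambda>c. ?r c * g c" b] b by simp
    moreover have "scale (g b) b = scale (\<beta> y) b" using g[OF b] wspaceD[OF bw(1,2)] by (rule trans[OF sym])
    then have "g b = \<beta> y" using b B(2) dependent_zero scale_right_imp_eq by metis
    ultimately show ?thesis using bw(3) by simp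
  qed
  then have "(\<Sum>b\<in>B. scale (?r b) b) = 0" by (simp add: sum.neutral)
  then show ?thesis using hs by simp
qed

text \<open>This does the work of Cartan's criterion. The radical is an ideal. Were it everything,
  then for h = [e, f] with opposite root vectors killing(h, h) = 0 would be a sum of squares of real
  multiples of beta(h), so h = 0. The spaces of nonzero weight would then span an ideal: if it is 0,
  the algebra equals \<open>H\<close> and is abelian; if it is everything, \<open>H\<close> is 0,
  although \<open>H\<close> is its own centralizer.\<close>

lemma killing_nondegenerate:
  assumes "\<And>z. killing x z = 0"
  shows "x = 0"
proof -
  let ?R = "{x. \<forall>z. killing x z = 0}"
  have "lie_ideal ?R"
    unfolding lie_ideal_def
  proof (intro conjI allI ballI subspaceI)
    fix x y assume y: "y \<in> ?R"
    have "killing (bracket x y) z = killing y (bracket z x)" for z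
      using killing_invariant[of z x y] by (metis killing_sym killing_invariant)
    then show "bracket x y \<in> ?R" using y by simp
  qed (auto simp: killing_add_left killing_scale_left)
  then have "?R = {0} \<or> ?R = UNIV" by (rule no_ideals)
  moreover have "?R \<noteq> UNIV"
  proof
    assume R: "?R = UNIV"
    have k0: "killing x z = 0" for x z using R by blast
    have opp: "bracket e f = 0"
      if e: "e \<in> wspace \<beta>" and f: "f \<in> wspace (\<lambda>y. - \<beta> y)" and y: "y \<in> H" "\<beta> y \<noteq> 0" for e f \<beta> y
    proof (rule ccontr)
      assume ne: "bracket e f \<noteq> 0"
      let ?h = "bracket e f"
      have h: "?h \<in> H" by (rule bracket_opposite[OF e f])
      have "\<exists>r::real. wt b ?h = of_real r * \<beta> ?h" if "b \<in> wbasis" for b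
        by (rule real_ratio[OF e f y wt[OF that] wbasis_nonzero[OF that]])
      then obtain r where r: "\<And>b. b \<in> wbasis \<Longrightarrow> wt b ?h = of_real (r b) * \<beta> ?h" by metis
      have "0 = (\<Sum>b\<in>wbasis. wt b ?h * wt b ?h)" using killing_H[OF h h] k0 by simp
      also have "\<dots> = (\<Sum>b\<in>wbasis. of_real ((r b)\<^sup>2)) * (\<beta> ?h)\<^sup>2"
        unfolding sum_distrib_right by (intro sum.cong) (auto simp: r power2_eq_square)
      finally have "complex_of_real (\<Sum>b\<in>wbasis. (r b)\<^sup>2) = 0"
        using coroot_nonzero[OF e f y ne] by simp
      then have "\<forall>b\<in>wbasis. r b = 0"
        using wbasis_finite by (simp only: of_real_eq_0_iff) (simp add: sum_nonneg_eq_0_iff)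
      then show False using H_zero[OF h] r ne by simp
    qed
    let ?N = "{x. \<exists>\<beta>. x \<in> wspace \<beta> \<and> (\<exists>y\<in>H. \<beta> y \<noteq> 0)}"
    have N: "bracket b x \<in> span ?N" if b: "b \<in> wbasis" and x: "x \<in> ?N" for b x
    proof -
      obtain \<beta> y where xw: "x \<in> wspace \<beta>" "y \<in> H" "\<beta> y \<noteq> 0" using x by blast
      show ?thesis
      proof (cases "\<forall>y\<in>H. wt b y + \<beta> y = 0")
        case True
        then have "wt b y = - \<beta> y" if "y \<in> H" for y using that by (simp add: eq_neg_iff_add_eq_0)
        then have "b \<in> wspace (\<lambda>y. - \<beta> y)"
          using wt[OF b] by (simp add: wspace_def)
        then have "bracket x b = 0" using opp[OF xw(1) _ xw(2,3)] by blast
        then have "bracket b x = 0" using bracket_skew[of b x] by simp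
        then show ?thesis by (simp add: span_zero)
      next
        case False
        then show ?thesis using bracket_wspace[OF wt[OF b] xw(1)] by (intro span_base) blast
      qed
    qed
    have "lie_ideal (span ?N)"
      unfolding lie_ideal_def
    proof (intro conjI allI ballI)
      fix x y assume y: "y \<in> span ?N"
      have 1: "bracket b y \<in> span ?N" if b: "b \<in> wbasis" for b
        using y
      proof (induction rule: span_induct_alt)
        case (step c x y)
        then show ?case using N[OF b]
          by (simp only: bracket_add_right bracket_scale_right) (blast intro: span_add span_scale)
      qed (simp add: span_zero)
      have "x \<in> span wbasis" by (simp add: wbasis_span)
      then show "bracket x y \<in> span ?N"
      proof (induction rule: span_induct_alt)
        case (step c x y)
        then show ?case using 1
          by (simp only: bracket_add_left bracket_scale_left) (blast intro: span_add span_scale)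
      qed (simp add: span_zero)
    qed (rule subspace_span)
    then have "span ?N = {0} \<or> span ?N = UNIV" by (rule no_ideals)
    moreover have "span ?N \<noteq> {0}"
    proof
      assume N0: "span ?N = {0}"
      have "b \<in> H" if b: "b \<in> wbasis" for b
      proof (rule wspace_zero[OF _ wt[OF b]], rule ccontr)
        fix y assume "y \<in> H" "wt b y \<noteq> 0"
        then have "b \<in> ?N" using wt[OF b] by blast
        then have "b \<in> span ?N" by (rule span_base)
        then show False using N0 wbasis_nonzero[OF b] by simp
      qed
      then have "span wbasis \<subseteq> H" using H_subspace by (intro span_minimal) auto
      then show False using wbasis_span H_abelian non_abelian by blast
    qed
    moreover have "span ?N \<noteq> UNIV"
    proof
      assume "span ?N = UNIV"
      then have h0: "h = 0" if "h \<in> H" for h using H_disjoint_root_spaces[OF that] by simp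
      have "bracket y x = 0" if "y \<in> H" for x y using h0[OF that] by simp
      then have "x \<in> H" for x by (rule H_maximal)
      then show False using H_abelian non_abelian by blast
    qed
    ultimately show False by blast
  qed
  ultimately show ?thesis using assms by blast
qed

lemma killing_wspace_zero:
  assumes "x \<in> wspace \<beta>" "z \<in> wspace \<gamma>" "y \<in> H" "\<beta> y + \<gamma> y \<noteq> 0"
  shows "killing x z = 0"
proof -
  have "killing x (bracket y z) = - killing (bracket y x) z"
    using killing_invariant[of x y z] bracket_skew[of x y] killing_scale_left[of "- 1" "bracket y x" z] by simp
  then have "\<gamma> y * killing x z = - (\<beta> y * killing x z)"
    using wspaceD[OF assms(1,3)] wspaceD[OF assms(2,3)]
    by (simp add: killing_scale_left killing_scale_right)
  then have "(\<beta> y + \<gamma> y) * killing x z = 0" by (simp add: distrib_right)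
  then show ?thesis using assms(4) by simp
qed

lemma killing_zero_wbasis:
  assumes "\<And>b. b \<in> wbasis \<Longrightarrow> killing x b = 0"
  shows "x = 0"
proof (rule killing_nondegenerate)
  fix z
  have "z \<in> span wbasis" by (simp add: wbasis_span)
  then show "killing x z = 0"
    by (induction rule: span_induct_alt) (auto simp: killing_add_right killing_scale_right assms)
qed

text \<open>Spaces of nonzero weight are orthogonal to \<open>H\<close>, so the radical of the
  restricted form lies in the radical of the whole form.\<close>

lemma killing_H_nondegenerate:
  assumes x: "x \<in> H" "\<And>y. y \<in> H \<Longrightarrow> killing x y = 0"
  shows "x = 0"
proof (rule killing_zero_wbasis)
  fix b assume b: "b \<in> wbasis"
  have x0: "x \<in> wspace (\<lambda>_. 0)" using x(1) by (simp add: wspace_def H_abelian)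
  show "killing x b = 0"
  proof (cases "\<forall>y\<in>H. wt b y = 0")
    case True
    then show ?thesis using x(2) wspace_zero[OF _ wt[OF b]] by blast
  next
    case False
    then show ?thesis using killing_wspace_zero[OF x0 wt[OF b]] by auto
  qed
qed

text \<open>By invariance the pairing of [e, f] with y is alpha(y) times the pairing of e with f, so
  [e, f] represents alpha once the latter is 1. This also makes the definite description in
  \<open>killing_rep\<close> proper.\<close>

lemma killing_rep:
  assumes \<alpha>: "\<alpha> \<in> roots H"
  obtains e f where "e \<in> wspace \<alpha>" "f \<in> wspace (\<lambda>y. - \<alpha> y)" "bracket e f = killing_rep H \<alpha>"
    "killing_rep H \<alpha> \<in> H" "\<And>y. y \<in> H \<Longrightarrow> killing (killing_rep H \<alpha>) y = \<alpha> y"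
proof -
  obtain y0 e where y0: "y0 \<in> H" "\<alpha> y0 \<noteq> 0" and e: "e \<noteq> 0" "e \<in> wspace \<alpha>"
    using \<alpha> unfolding roots_def wspace_def by blast
  \<comment> \<open>Exists by nondegeneracy; the orthogonality of weight spaces then leaves only the
    weight -alpha for \<open>b\<close>.\<close>
  obtain b where b: "b \<in> wbasis" "killing e b \<noteq> 0" using killing_zero_wbasis e(1) by blast
  have "wt b y = - \<alpha> y" if "y \<in> H" for y
    using killing_wspace_zero[OF e(2) wt[OF b(1)] that] b(2) by (metis add.commute eq_neg_iff_add_eq_0)
  then have bw: "b \<in> wspace (\<lambda>y. - \<alpha> y)" using wt[OF b(1)] by (simp add: wspace_def)
  define f where "f = scale (inverse (killing e b)) b"
  have f: "f \<in> wspace (\<lambda>y. - \<alpha> y)"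
    using bw by (simp add: f_def wspace_def bracket_scale_right mult.commute)
  have h: "bracket e f \<in> H" by (rule bracket_opposite[OF e(2) f])
  have k: "killing (bracket e f) y = \<alpha> y" if y: "y \<in> H" for y
  proof -
    have "killing (bracket e f) y = killing e (bracket f y)" by (rule killing_invariant)
    also have "bracket f y = scale (\<alpha> y) f"
      using bracket_skew[of f y] wspaceD[OF f y] by simp
    also have "killing e (scale (\<alpha> y) f) = \<alpha> y"
      using b(2) by (simp add: f_def killing_scale_right)
    finally show ?thesis .
  qed
  have "killing_rep H \<alpha> = bracket e f"
    unfolding killing_rep_def
  proof (rule the_equality)
    show "bracket e f \<in> H \<and> (\<forall>y\<in>H. killing (bracket e f) y = \<alpha> y)" using h k by blast
  next
    fix x assume x: "x \<in> H \<and> (\<forall>y\<in>H. killing x y = \<alpha> y)"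
    have "x - bracket e f = 0"
    proof (rule killing_H_nondegenerate)
      show "x - bracket e f \<in> H" using x h H_subspace by (blast intro: subspace_diff)
      fix y assume "y \<in> H"
      then show "killing (x - bracket e f) y = 0"
        using x k killing_add_left[of "x - bracket e f" "bracket e f" y] by simp
    qed
    then show "x = bracket e f" by simp
  qed
  then show ?thesis using that e(2) f h k by metis
qed

end

text \<open>The weights at t are real multiples r_b alpha(t), so alpha(t) = killing(t, t) =
  alpha(t)^2 sum r_b^2: the nonzero alpha(t) is the inverse of a sum of real squares.\<close>

lemma (in cartan_data) wt_killing_rep_real:
  assumes \<alpha>: "\<alpha> \<in> roots H" and b: "b \<in> wbasis"
  shows "wt b (killing_rep H \<alpha>) \<in> \<real>"
proof -
  let ?t = "killing_rep H \<alpha>"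
  obtain e f where e: "e \<in> wspace \<alpha>" and f: "f \<in> wspace (\<lambda>y. - \<alpha> y)" and ef: "bracket e f = ?t"
    and t: "?t \<in> H" and k: "\<And>y. y \<in> H \<Longrightarrow> killing ?t y = \<alpha> y"
    using killing_rep[OF \<alpha>] by blast
  obtain y where y: "y \<in> H" "\<alpha> y \<noteq> 0" using \<alpha> unfolding roots_def by blast
  have "?t \<noteq> 0" using k[OF y(1)] y(2) by auto
  then have \<alpha>t: "\<alpha> ?t \<noteq> 0" using coroot_nonzero[OF e f y] ef by simp
  have "\<exists>r::real. wt b ?t = of_real r * \<alpha> ?t" if "b \<in> wbasis" for b
    using real_ratio[OF e f y wt[OF that] wbasis_nonzero[OF that]] ef by simp
  then obtain r where r: "\<And>b. b \<in> wbasis \<Longrightarrow> wt b ?t = of_real (r b) * \<alpha> ?t" by metis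
  have "\<alpha> ?t = (\<Sum>b\<in>wbasis. wt b ?t * wt b ?t)" using k[OF t] killing_H[OF t t] by simp
  also have "\<dots> = of_real (\<Sum>b\<in>wbasis. (r b)\<^sup>2) * \<alpha> ?t * \<alpha> ?t"
    unfolding of_real_sum sum_distrib_right
  proof (rule sum.cong[OF refl])
    fix b assume "b \<in> wbasis"
    from r[OF this] show "wt b ?t * wt b ?t = of_real ((r b)\<^sup>2) * \<alpha> ?t * \<alpha> ?t"
      by (simp only: power2_eq_square of_real_mult mult_ac)
  qed
  finally have "of_real (\<Sum>b\<in>wbasis. (r b)\<^sup>2) * \<alpha> ?t = 1" using \<alpha>t by simp
  then have "\<alpha> ?t = of_real (inverse (\<Sum>b\<in>wbasis. (r b)\<^sup>2))"
    by (metis inverse_unique of_real_inverse)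
  then have "\<alpha> ?t \<in> \<real>" by simp
  then show ?thesis using r[OF b] by (simp add: Reals_mult)
qed

text \<open>\<open>B\<close> is the Gram matrix of the real vectors formed by the values of all
  weights at the representatives of the simple roots; their linear independence makes it positive
  definite.\<close>

lemma (in cartan_data) cartan_matrix_finite_type:
  fixes \<alpha> :: "'i::finite \<Rightarrow> 'g \<Rightarrow> complex"
  assumes \<alpha>: "simple_roots H \<alpha>" and C: "is_cartan_matrix H \<alpha> C"
  shows "\<exists>B. finite_type C B"
proof -
  have \<alpha>r: "\<alpha> i \<in> roots H" for i using \<alpha> unfolding simple_roots_def by blast
  have indep: "c i = 0" if "\<And>y. y \<in> H \<Longrightarrow> (\<Sum>i\<in>UNIV. c i * \<alpha> i y) = 0" for c i
    using \<alpha> that unfolding simple_roots_def by blast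
  define t where "t i = killing_rep H (\<alpha> i)" for i
  have tH: "t i \<in> H" and tk: "\<And>y. y \<in> H \<Longrightarrow> killing (t i) y = \<alpha> i y" for i
    using killing_rep[OF \<alpha>r[of i]] unfolding t_def by blast+
  define \<rho> where "\<rho> b i = Re (wt b (t i))" for b i
  have \<rho>: "wt b (t i) = of_real (\<rho> b i)" if "b \<in> wbasis" for b i
    using wt_killing_rep_real[OF \<alpha>r that, of i] by (simp add: \<rho>_def t_def of_real_Re)
  define B where "B i j = (\<Sum>b\<in>wbasis. \<rho> b i * \<rho> b j)" for i j
  have B: "\<alpha> i (t j) = of_real (B i j)" for i j
  proof -
    have "\<alpha> i (t j) = killing (t i) (t j)" using tk[OF tH] by simp
    then show ?thesis by (simp add: killing_H[OF tH tH] B_def \<rho>)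
  qed
  have sym: "B i j = B j i" for i j by (simp add: B_def mult.commute)
  have dual: "dual_form H (\<alpha> i) (\<alpha> j) = of_real (B i j)" for i j
    using tk[OF tH] B by (simp add: dual_form_def flip: t_def)
  have pos: "(\<Sum>i\<in>UNIV. \<Sum>j\<in>UNIV. B i j * k i * k j) > 0" if k: "k \<noteq> (\<lambda>_. 0)" for k
  proof -
    have "(\<Sum>i\<in>UNIV. \<Sum>j\<in>UNIV. B i j * k i * k j) =
        (\<Sum>i\<in>UNIV. \<Sum>j\<in>UNIV. \<Sum>b\<in>wbasis. \<rho> b i * k i * (\<rho> b j * k j))"
      unfolding B_def sum_distrib_right by (intro sum.cong refl) (simp add: algebra_simps)
    also have "\<dots> = (\<Sum>b\<in>wbasis. \<Sum>i\<in>UNIV. \<Sum>j\<in>UNIV. \<rho> b i * k i * (\<rho> b j * k j))"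
      by (subst sum.swap[of _ _ wbasis], subst sum.swap[of _ wbasis]) (rule refl)
    also have "\<dots> = (\<Sum>b\<in>wbasis. (\<Sum>i\<in>UNIV. \<rho> b i * k i)\<^sup>2)"
      by (simp add: power2_eq_square sum_product)
    finally have eq: "(\<Sum>i\<in>UNIV. \<Sum>j\<in>UNIV. B i j * k i * k j) = (\<Sum>b\<in>wbasis. (\<Sum>i\<in>UNIV. \<rho> b i * k i)\<^sup>2)" .
    have "(\<Sum>b\<in>wbasis. (\<Sum>i\<in>UNIV. \<rho> b i * k i)\<^sup>2) \<noteq> 0"
    proof
      assume "(\<Sum>b\<in>wbasis. (\<Sum>i\<in>UNIV. \<rho> b i * k i)\<^sup>2) = 0"
      then have z: "(\<Sum>i\<in>UNIV. \<rho> b i * k i) = 0" if "b \<in> wbasis" for b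
        using that wbasis_finite by (simp add: sum_nonneg_eq_0_iff)
      have "(\<Sum>i\<in>UNIV. of_real (k i) * \<alpha> i y) = 0" if y: "y \<in> H" for y
      proof -
        have "(\<Sum>i\<in>UNIV. of_real (k i) * \<alpha> i y) = (\<Sum>i\<in>UNIV. \<Sum>b\<in>wbasis. of_real (\<rho> b i * k i) * wt b y)"
          by (intro sum.cong refl)
            (simp add: tk[OF y, symmetric] killing_H[OF tH y] \<rho> sum_distrib_left algebra_simps)
        also have "\<dots> = (\<Sum>b\<in>wbasis. of_real (\<Sum>i\<in>UNIV. \<rho> b i * k i) * wt b y)"
          by (subst sum.swap) (simp add: sum_distrib_right)
        also have "\<dots> = 0" by (intro sum.neutral) (simp add: z)
        finally show ?thesis .
      qed
      then have "complex_of_real (k i) = 0" for i by (rule indep)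
      then show False using k by auto
    qed
    moreover have "(\<Sum>b\<in>wbasis. (\<Sum>i\<in>UNIV. \<rho> b i * k i)\<^sup>2) \<ge> 0" by (simp add: sum_nonneg)
    ultimately show ?thesis using eq by simp
  qed
  have Bpos: "B i i > 0" for i using pos by (rule pos_def_diag)
  have cartan: "of_int (C i j) * B i i = 2 * B i j" for i j
  proof -
    have "complex_of_int (C i j) = 2 * of_real (B i j) / of_real (B i i)"
      using C unfolding is_cartan_matrix_def dual by blast
    then have "complex_of_real (of_int (C i j) * B i i) = complex_of_real (2 * B i j)"
      using Bpos[of i] by (simp add: field_simps)
    then show ?thesis by (simp only: of_real_eq_iff)
  qed
  have diag: "C i i = 2" for i
  proof -
    have "real_of_int (C i i) = 2" using cartan[of i i] Bpos[of i] by simp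
    then show ?thesis by linarith
  qed
  \<comment> \<open>alpha_j - alpha_i has coefficients of both signs, so it is not a root. Hence
    \<open>x\<close> is the lower end of its alpha_i-string, and \<open>string_weight\<close> makes
    \<open>C i j\<close> equal to -q.\<close>
  have offdiag: "C i j \<le> 0" if ij: "i \<noteq> j" for i j
  proof -
    obtain e f where e: "e \<in> wspace (\<alpha> i)" and f: "f \<in> wspace (\<lambda>y. - \<alpha> i y)" and ef: "bracket e f = t i"
      using killing_rep[OF \<alpha>r[of i]] unfolding t_def by blast
    obtain x where x: "x \<noteq> 0" "x \<in> wspace (\<alpha> j)"
      using \<alpha>r[of j] unfolding roots_def wspace_def by blast
    have "bracket f x = 0"
    proof (rule ccontr)
      assume ne: "bracket f x \<noteq> 0"
      define d where "d l = (if l = j then 1 else if l = i then - 1 else 0 :: complex)" for l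
      have dsum: "(\<Sum>l\<in>UNIV. d l * \<alpha> l y) = \<alpha> j y - \<alpha> i y" for y
      proof -
        have "(\<Sum>l\<in>UNIV. d l * \<alpha> l y) = (\<Sum>l\<in>{i, j}. d l * \<alpha> l y)"
          by (rule sum.mono_neutral_right) (auto simp: d_def)
        then show ?thesis using ij by (simp add: d_def)
      qed
      have fx: "bracket f x \<in> wspace (\<lambda>y. - \<alpha> i y + \<alpha> j y)" by (rule bracket_wspace[OF f x(2)])
      \<comment> \<open>Set to 0 off \<open>H\<close>, as \<open>roots\<close> demands of a
        functional.\<close>
      define \<beta> where "\<beta> y = (if y \<in> H then \<alpha> j y - \<alpha> i y else 0)" for y
      have "\<exists>y\<in>H. \<beta> y \<noteq> 0"
      proof (rule ccontr)
        assume "\<not> (\<exists>y\<in>H. \<beta> y \<noteq> 0)"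
        then have b0: "\<alpha> j y - \<alpha> i y = 0" if "y \<in> H" for y using that by (auto simp: \<beta>_def)
        have "d j = 0"
        proof (rule indep)
          fix y assume "y \<in> H"
          then show "(\<Sum>l\<in>UNIV. d l * \<alpha> l y) = 0" unfolding dsum by (rule b0)
        qed
        then show False by (simp add: d_def)
      qed
      moreover have "\<forall>y\<in>H. bracket y (bracket f x) = scale (\<beta> y) (bracket f x)"
        using wspaceD[OF fx] by (simp add: \<beta>_def)
      ultimately have "\<beta> \<in> roots H" using ne by (auto simp: roots_def \<beta>_def)
      then obtain k :: "'i \<Rightarrow> nat" where "\<beta> = (\<lambda>y. \<Sum>i\<in>UNIV. of_nat (k i) * \<alpha> i y) \<or>
          \<beta> = (\<lambda>y. - (\<Sum>i\<in>UNIV. of_nat (k i) * \<alpha> i y))"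
        using \<alpha> unfolding simple_roots_def by blast
      then show False
      proof
        assume b: "\<beta> = (\<lambda>y. \<Sum>i\<in>UNIV. of_nat (k i) * \<alpha> i y)"
        have "d i - of_nat (k i) = 0"
        proof (rule indep)
          fix y assume "y \<in> H"
          then show "(\<Sum>l\<in>UNIV. (d l - of_nat (k l)) * \<alpha> l y) = 0"
            using fun_cong[OF b, of y] by (simp add: left_diff_distrib sum_subtractf dsum \<beta>_def)
        qed
        then have "of_nat (k i) = d i" by simp
        then have "of_nat (k i + 1) = (0 :: complex)" using ij by (simp add: d_def)
        then show False by (simp only: of_nat_eq_0_iff)
      next
        assume b: "\<beta> = (\<lambda>y. - (\<Sum>i\<in>UNIV. of_nat (k i) * \<alpha> i y))"
        have "d j + of_nat (k j) = 0"
        proof (rule indep)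
          fix y assume "y \<in> H"
          then show "(\<Sum>l\<in>UNIV. (d l + of_nat (k l)) * \<alpha> l y) = 0"
            using fun_cong[OF b, of y] by (simp add: distrib_right sum.distrib dsum \<beta>_def)
        qed
        then have "of_nat (1 + k j) = (0 :: complex)" by (simp add: d_def)
        then show False by (simp only: of_nat_eq_0_iff)
      qed
    qed
    moreover obtain y where y: "y \<in> H" "\<alpha> i y \<noteq> 0" using \<alpha>r[of i] unfolding roots_def by blast
    ultimately obtain q :: nat where "2 * \<alpha> j (t i) = - of_nat q * \<alpha> i (t i)"
      using string_weight[OF e f y x(2,1)] ef by auto
    then have "complex_of_real (2 * B i j) = complex_of_real (- real q * B i i)"
      by (simp add: B sym[of j i])
    then have "of_int (C i j) * B i i = - real q * B i i"
      unfolding cartan by (simp only: of_real_eq_iff)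
    then have "real_of_int (C i j) = - real q" by (metis Bpos less_irrefl mult_right_cancel)
    then show ?thesis by linarith
  qed
  have "finite_type C B"
    by unfold_locales (fact diag offdiag sym cartan pos)+
  then show ?thesis by blast
qed

section \<open>The basis\<close>

lemma Kminus_subspace:
  "x \<in> Kminus C \<Longrightarrow> y \<in> Kminus C \<Longrightarrow> x + y \<in> Kminus C"
  "x \<in> Kminus C \<Longrightarrow> y \<in> Kminus C \<Longrightarrow> x - y \<in> Kminus C"
  "x \<in> Kminus C \<Longrightarrow> cscale c x \<in> Kminus C"
  "0 \<in> Kminus C"
  by (auto simp: Kminus_eq_Ker intro: Ker_add Ker_diff Ker_cscale)

lemma Kminus_eqI:
  assumes "x \<in> Kminus C" "y \<in> Kminus C" "\<And>m. dominant m \<Longrightarrow> lookup x m = lookup y m"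
  shows "x = y"
proof -
  have "x - y = 0"
    by (rule Ker_dom_zero[of UNIV _ C])
      (use assms in \<open>auto simp: Kminus_eq_Ker nonneg_on_UNIV lookup_minus intro: Ker_diff\<close>)
  then show ?thesis by simp
qed

lemma has_unique_dominant_iff:
  assumes "dominant m"
  shows "has_unique_dominant C m x \<longleftrightarrow>
    x \<in> Kminus C \<and> (\<forall>m'. dominant m' \<longrightarrow> lookup x m' = (if m' = m then 1 else 0))"
  using assms unfolding has_unique_dominant_def by (auto simp: in_keys_iff set_eq_iff)

lemma (in finite_type) ex1_unique_dominant:
  assumes m: "dominant m"
  shows "\<exists>!x. has_unique_dominant C m x"
proof -
  obtain x where "\<forall>i. x \<in> Ker C i" "lookup x m = 1" "\<forall>m'\<in>keys x. dominant m' \<longrightarrow> m' = m"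
    using exists_unique_dominant[OF m] by blast
  then have "has_unique_dominant C m x"
    using m by (auto simp: has_unique_dominant_def Kminus_eq_Ker in_keys_iff)
  moreover have "y = z" if "has_unique_dominant C m y" "has_unique_dominant C m z" for y z
    using that unfolding has_unique_dominant_iff[OF m] by (intro Kminus_eqI[of y C]) auto
  ultimately show ?thesis by blast
qed

theorem proposition3p3:
  fixes scale :: "complex \<Rightarrow> 'g::ab_group_add \<Rightarrow> 'g"
    and bracket :: "'g \<Rightarrow> 'g \<Rightarrow> 'g"
    and H :: "'g set"
    and \<alpha> :: "'i::finite \<Rightarrow> 'g \<Rightarrow> complex"
    and C :: "'i \<Rightarrow> 'i \<Rightarrow> int"
    and t :: complex
  assumes "simple_lie_algebra scale bracket"
    and "lie_algebra.cartan_subalgebra scale bracket H"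
    and "lie_algebra.simple_roots scale bracket H \<alpha>"
    and "lie_algebra.is_cartan_matrix scale bracket H \<alpha> C"
    and "t \<noteq> 0" and "\<forall>n::nat. n > 0 \<longrightarrow> t ^ n \<noteq> 1"
  shows "(\<forall>x\<in>Kminus C. \<forall>y\<in>Kminus C.
            (\<forall>m. dominant m \<longrightarrow> lookup x m = lookup y m) \<longrightarrow> x = y)
       \<and> (\<forall>m. dominant m \<longrightarrow> (\<exists>!x. has_unique_dominant C m x))
       \<and> inj_on (Felt C) {m. dominant m}
       \<and> \<not> module.dependent cscale (Felt C ` {m. dominant m})
       \<and> module.span cscale (Felt C ` {m. dominant m}) = Kminus C"
proof -
  interpret simple_lie_algebra scale bracket by (rule assms(1))
  interpret cartan_data scale bracket H by unfold_locales (rule assms(2))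
  obtain B where "finite_type C B" using cartan_matrix_finite_type[OF assms(3,4)] by blast
  then interpret finite_type C B .
  interpret Y: vector_space "cscale :: complex \<Rightarrow> 'i ylaurent \<Rightarrow> 'i ylaurent"
    by (rule vector_space_cscale)
  let ?D = "{m :: 'i ymon. dominant m}"
  have F: "has_unique_dominant C m (Felt C m)" if "dominant m" for m
    unfolding Felt_def by (rule theI'[OF ex1_unique_dominant[OF that]])
  have FK: "Felt C m \<in> Kminus C" if "dominant m" for m
    using F[OF that] by (simp add: has_unique_dominant_def)
  have Fl: "lookup (Felt C m) m' = (if m' = m then 1 else 0)" if "dominant m" "dominant m'" for m m'
    using F[OF that(1)] that by (simp add: has_unique_dominant_iff)
  have inj: "inj_on (Felt C) ?D"
  proof (rule inj_onI)
    fix m m' assume "m \<in> ?D" "m' \<in> ?D" "Felt C m = Felt C m'"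
    then show "m = m'" using Fl[of m m] Fl[of m' m] by (simp split: if_splits)
  qed
  have "\<not> Y.dependent (Felt C ` ?D)"
  proof
    assume "Y.dependent (Felt C ` ?D)"
    then obtain T u v where T: "finite T" "T \<subseteq> Felt C ` ?D" "(\<Sum>w\<in>T. cscale (u w) w) = 0"
      and v: "v \<in> T" "u v \<noteq> 0"
      unfolding Y.dependent_explicit by blast
    obtain m where m: "dominant m" "v = Felt C m" using v(1) T(2) by blast
    \<comment> \<open>At dominant monomials the coefficients of the \<open>Felt\<close> form an
      identity matrix, so evaluation at \<open>m\<close> isolates \<open>u v\<close>.\<close>
    have "lookup (\<Sum>w\<in>T. cscale (u w) w) m = (\<Sum>w\<in>T. if w = v then u v else 0)"
      unfolding lookup_sum
    proof (rule sum.cong[OF refl])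
      fix w assume "w \<in> T"
      then obtain m' where "dominant m'" "w = Felt C m'" using T(2) by blast
      then show "lookup (cscale (u w) w) m = (if w = v then u v else 0)"
        using m Fl[of m' m] Fl[of m m] by (auto simp: lookup_cscale)
    qed
    then show False using T(1,3) v by simp
  qed
  moreover have "Y.span (Felt C ` ?D) = Kminus C"
  proof
    have "Y.subspace (Kminus C)"
      by (rule Y.subspaceI) (auto intro: Kminus_subspace)
    then show "Y.span (Felt C ` ?D) \<subseteq> Kminus C" using FK by (intro Y.span_minimal) auto
  next
    show "Kminus C \<subseteq> Y.span (Felt C ` ?D)"
    proof
      fix x assume x: "x \<in> Kminus C"
      \<comment> \<open>The coordinates of \<open>x\<close> are its dominant coefficients, finitely
        many of which are nonzero.\<close>
      let ?S = "keys x \<inter> ?D"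
      let ?y = "\<Sum>m\<in>?S. cscale (lookup x m) (Felt C m)"
      have y: "?y \<in> Y.span (Felt C ` ?D)"
        by (intro Y.span_sum Y.span_scale Y.span_base) auto
      have "?y \<in> Kminus C"
        unfolding Kminus_eq_Ker using FK
        by (auto intro!: Ker_sum Ker_cscale simp: Kminus_eq_Ker)
      moreover have "lookup x m = lookup ?y m" if m: "dominant m" for m
      proof -
        have "lookup ?y m = (\<Sum>m'\<in>?S. if m' = m then lookup x m else 0)"
          unfolding lookup_sum using m by (intro sum.cong) (auto simp: lookup_cscale Fl)
        also have "\<dots> = lookup x m" using m by (simp add: in_keys_iff)
        finally show ?thesis by simp
      qed
      ultimately have "x = ?y" by (rule Kminus_eqI[OF x])
      then show "x \<in> Y.span (Felt C ` ?D)" using y by simp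
    qed
  qed
  ultimately show ?thesis
    using Kminus_eqI[of _ C] ex1_unique_dominant inj by blast
qed

end
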